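(* Let $d\ge1$ and $p,q\in\mathbb R$. Consider on $\mathcal I^2(S^1,\mathbb R^d)$ the second order length-weighted Sobolev metric $$G_c(h,k)=\int_{S^1}\ell_c^{\,q}\langle h,k\rangle+\ell_c^{\,p}\langle D_s^2h,D_s^2k\rangle\,\mathrm{d}s .$$ Then $G$ is not metrically complete, i.e. $(\mathcal I^2(S^1,\mathbb R^d),\operatorname{dist})$ is not a complete metric space, in each of the following cases: (1) $q=-3$ and $p<1$; (2) $q=-3$ and $p>1$.
   Context: $S^1=\mathbb R/2\pi\mathbb Z$ with parameter $\theta$, and $'=\partial_\theta$. $\mathcal I^2(S^1,\mathbb R^d)=\{c\in H^2(S^1,\mathbb R^d): c'(\theta)\ne0\text{ for all }\theta\}$, an open subset of the Sobolev space $H^2(S^1,\mathbb R^d)$, hence a Hilbert manifold with tangent space $H^2(S^1,\mathbb R^d)$ at each point. For a curve $c$: $D_s=\frac1{|c'|}\partial_\theta$ and $\mathrm{d}s=|c'|\,\mathrm{d}\theta$ are differentiation and integration with respect to arc length, and $\ell_c=\int_{S^1}1\,\mathrm{d}s$ is the length of $c$. $\operatorname{dist}$ is the geodesic distance induced by $G$ on $\mathcal I^2(S^1,\mathbb R^d)$: $\operatorname{dist}(c_0,c_1)$ is the infimum of $\int_0^1\sqrt{G_c(\partial_tc,\partial_tc)}\,\mathrm{d}t$ over piecewise smooth paths in $\mathcal I^2(S^1,\mathbb R^d)$ from $c_0$ to $c_1$ (and $\infty$ if $c_0,c_1$ lie in different connected components).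
   Formalization: The dimension is taken to be d ≥ 2 instead of d ≥ 1: for d = 1 every closed differentiable curve in R has a critical point, so the space of immersions is empty and trivially complete, and the claim fails there. *)

theory Defs
  imports "HOL-Analysis.Analysis"
begin

section \<open>Auxiliary facts on Lebesgue integrals\<close>

lemma AE_zero_if_set_integrals_zero:
  fixes F :: "real \<Rightarrow> real"
  assumes F: "integrable lborel F" and 0: "\<And>a. (LINT x:{..a}|lborel. F x) = 0" and tot: "integral\<^sup>L lborel F = 0"
  shows "AE x in lborel. F x = 0"
proof -
  have si: "set_integrable lborel A F" if "A \<in> sets borel" for A
    unfolding set_integrable_def using F that by (intro integrable_mult_indicator) auto
  have Z: "(LINT x:A|lborel. F x) = 0" if "A \<in> sets borel" for A
  proof -
    have "Int_stable (range (\<lambda>a::real. {..a}))"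
      by (auto simp: Int_stable_def)
    moreover have "range (\<lambda>a::real. {..a}) \<subseteq> Pow UNIV" by simp
    moreover have "A \<in> sigma_sets UNIV (range (\<lambda>a::real. {..a}))"
      using that by (simp add: borel_eq_atMost)
    ultimately show ?thesis
    proof (induct rule: sigma_sets_induct_disjoint)
      fix A :: "real set" assume "A \<in> range (\<lambda>a. {..a})"
      then show "(LINT x:A|lborel. F x) = 0" using 0 by auto
    next
      show "(LINT x:{}|lborel. F x) = 0" by (simp add: set_lebesgue_integral_def)
    next
      fix A :: "real set" assume "A \<in> sigma_sets UNIV (range (\<lambda>a::real. {..a}))"
        and A0: "(LINT x:A|lborel. F x) = 0"
      then have A: "A \<in> sets borel" by (simp add: borel_eq_atMost)
      have "(LINT x:A \<union> (UNIV - A)|lborel. F x) = (LINT x:A|lborel. F x) + (LINT x:UNIV - A|lborel. F x)"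
        using A by (intro set_integral_Un si) auto
      then show "(LINT x:UNIV - A|lborel. F x) = 0"
        using A0 tot by (simp add: set_lebesgue_integral_def)
    next
      fix A :: "nat \<Rightarrow> real set"
      assume dj: "disjoint_family A" and "range A \<subseteq> sigma_sets UNIV (range (\<lambda>a::real. {..a}))"
        and A0: "\<And>i. (LINT x:A i|lborel. F x) = 0"
      then have A: "A i \<in> sets borel" for i by (auto simp: borel_eq_atMost)
      have "(LINT x:(\<Union>i. A i)|lborel. F x) = (\<Sum>i. (LINT x:A i|lborel. F x))"
        using dj A by (intro lebesgue_integral_countable_add si) (auto simp: disjoint_family_on_def)
      then show "(LINT x:(\<Union>i. A i)|lborel. F x) = 0" using A0 by simp
    qed
  qed
  have Fm[measurable]: "F \<in> borel_measurable borel" using F by (auto dest: borel_measurable_integrable)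
  have P: "{x. F x > 0} \<in> sets borel" "{x. F x < 0} \<in> sets borel" by measurable
  have ind: "integrable lborel (\<lambda>x. indicator A x * F x)" if "A \<in> sets borel" for A
    using si[OF that] by (simp add: set_integrable_def)
  have "AE x in lborel. indicator {x. F x > 0} x * F x = 0"
    using Z[OF P(1)] ind[OF P(1)]
    by (subst integral_nonneg_eq_0_iff_AE[symmetric]) (auto simp: set_lebesgue_integral_def split: split_indicator)
  moreover have "AE x in lborel. - (indicator {x. F x < 0} x * F x) = 0"
    using Z[OF P(2)] ind[OF P(2)]
    by (subst integral_nonneg_eq_0_iff_AE[symmetric]) (auto simp: set_lebesgue_integral_def split: split_indicator)
  ultimately show ?thesis
    by eventually_elim (auto simp: indicator_def split: if_splits)
qed

lemma AE_zero_if_primitive_zero_real: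
  fixes h :: "real \<Rightarrow> real"
  assumes h: "integrable (lebesgue_on {0..L}) h" and "0 \<le> L"
    and 0: "\<And>\<theta>. \<theta> \<in> {0..L} \<Longrightarrow> (h has_integral 0) {0..\<theta>}"
  shows "AE \<theta> in lebesgue_on {0..L}. h \<theta> = 0"
proof -
  define H where "H x = (if x \<in> {0..L} then h x else 0)" for x
  have H: "integrable lebesgue H"
    unfolding H_def using h by (subst Lebesgue_Measure.integrable_restrict_UNIV) auto
  obtain F where F[measurable]: "F \<in> borel_measurable lborel" and eq: "AE x in lborel. H x = F x"
    using completion_ex_borel_measurable_real[OF borel_measurable_integrable[OF H]] by auto
  have Hm: "H \<in> borel_measurable lebesgue" using H by auto
  have eqc: "AE x in lebesgue. H x = F x" using eq by (rule AE_completion)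
  have "integrable lebesgue F"
    using H by (rule integrable_cong_AE_imp) (use eqc F in \<open>auto intro: measurable_completion\<close>)
  then have Fi: "integrable lborel F" by (simp add: integrable_completion)
  have Z: "(LINT x:A|lborel. F x) = (LINT x:A|lebesgue. H x)" if A: "A \<in> sets borel" for A
  proof -
    have "(LINT x:A|lborel. F x) = (LINT x:A|lebesgue. F x)"
      unfolding set_lebesgue_integral_def using A by (subst integral_completion) auto
    also have "\<dots> = (LINT x:A|lebesgue. H x)"
      unfolding set_lebesgue_integral_def
    proof (rule integral_cong_AE)
      show "(\<lambda>x. indicat_real A x *\<^sub>R F x) \<in> borel_measurable lebesgue"
        using A by (intro measurable_completion) auto
      show "(\<lambda>x. indicat_real A x *\<^sub>R H x) \<in> borel_measurable lebesgue"
        using A Hm by (intro borel_measurable_scaleR borel_measurable_indicator) auto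
      show "AE x in lebesgue. indicat_real A x *\<^sub>R F x = indicat_real A x *\<^sub>R H x"
        using eqc by eventually_elim simp
    qed
    finally show ?thesis .
  qed
  have HI: "(LINT x:A|lebesgue. H x) = integral A H" if "A \<in> sets borel" for A
    using H that unfolding set_integrable_def
    by (intro set_lebesgue_integral_eq_integral(2), unfold set_integrable_def)
      (rule integrable_mult_indicator, auto)
  have I: "(H has_integral 0) {..a}" for a
  proof (cases "a < 0")
    case True
    then show ?thesis by (intro has_integral_is_0) (auto simp: H_def)
  next
    case False
    then have "(h has_integral 0) {0..min a L}" using 0 \<open>0 \<le> L\<close> by auto
    then have "((\<lambda>x. if x \<in> {0..min a L} then h x else 0) has_integral 0) {..a}"
      by (subst has_integral_restrict) auto
    then show ?thesis by (rule has_integral_eq[rotated]) (auto simp: H_def)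
  qed
  have U: "(H has_integral 0) UNIV"
  proof -
    have "(h has_integral 0) {0..L}" using 0 \<open>0 \<le> L\<close> by auto
    then have "((\<lambda>x. if x \<in> {0..L} then h x else 0) has_integral 0) UNIV"
      by (subst has_integral_restrict) auto
    then show ?thesis by (simp add: H_def[abs_def])
  qed
  have "AE x in lborel. F x = 0"
  proof (rule AE_zero_if_set_integrals_zero[OF Fi])
    show "(LINT x:{..a}|lborel. F x) = 0" for a
      using Z[of "{..a}"] HI[of "{..a}"] I[of a] by (simp add: integral_unique)
    show "integral\<^sup>L lborel F = 0"
      using Z[of UNIV] HI[of UNIV] U by (simp add: integral_unique set_lebesgue_integral_def)
  qed
  then have "AE x in lebesgue. F x = 0" by (rule AE_completion)
  with eqc have "AE x in lebesgue. H x = 0" by eventually_elim simp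
  then show ?thesis
    by (subst AE_restrict_space_iff) (auto simp: H_def elim!: eventually_mono)
qed

lemma AE_zero_if_primitive_zero:
  fixes h :: "real \<Rightarrow> 'a::euclidean_space"
  assumes h: "integrable (lebesgue_on {0..L}) h" and "0 \<le> L"
    and 0: "\<And>\<theta>. \<theta> \<in> {0..L} \<Longrightarrow> (h has_integral 0) {0..\<theta>}"
  shows "AE \<theta> in lebesgue_on {0..L}. h \<theta> = 0"
proof -
  have "AE \<theta> in lebesgue_on {0..L}. \<forall>b\<in>Basis. h \<theta> \<bullet> b = 0"
  proof (rule AE_finite_allI[OF finite_Basis])
    fix b :: 'a assume "b \<in> Basis"
    show "AE \<theta> in lebesgue_on {0..L}. h \<theta> \<bullet> b = 0"
    proof (rule AE_zero_if_primitive_zero_real[OF _ \<open>0 \<le> L\<close>])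
      show "integrable (lebesgue_on {0..L}) (\<lambda>\<theta>. h \<theta> \<bullet> b)" using h by auto
      show "((\<lambda>\<theta>. h \<theta> \<bullet> b) has_integral 0) {0..\<theta>}" if "\<theta> \<in> {0..L}" for \<theta>
        using has_integral_linear[OF 0[OF that] bounded_linear_inner_left[of b]] by (simp add: o_def)
    qed
  qed
  then show ?thesis by eventually_elim (simp add: euclidean_eq_iff[where 'a='a])
qed


section \<open>Sobolev functions on the circle\<close>

text \<open>
  Functions on $S^1 = \mathbb{R}/2\pi\mathbb{Z}$ are $2\pi$-periodic functions on the line,
  integrated over one period.
\<close>

abbreviation circle :: "real measure" where
  "circle \<equiv> lebesgue_on {0..2 * pi}"

abbreviation periodic :: "(real \<Rightarrow> 'a) \<Rightarrow> bool" where
  "periodic f \<equiv> periodic_fun_simple f (2 * pi)"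

definition L2_circle :: "(real \<Rightarrow> 'a::euclidean_space) set" where
  "L2_circle = {g \<in> borel_measurable circle. integrable circle (\<lambda>\<theta>. (norm (g \<theta>))\<^sup>2)}"

text \<open>
  For periodic \<^term>\<open>f\<close> the relation below says that \<^term>\<open>f\<close> (as its absolutely continuous
  representative) has weak derivative \<^term>\<open>g\<close> in $L^2(S^1)$.
\<close>

definition has_weak_deriv :: "(real \<Rightarrow> 'a::euclidean_space) \<Rightarrow> (real \<Rightarrow> 'a) \<Rightarrow> bool" where
  "has_weak_deriv f g \<longleftrightarrow>
     g \<in> L2_circle \<and> (\<forall>\<theta>\<in>{0..2 * pi}. (g has_integral (f \<theta> - f 0)) {0..\<theta>})"

text \<open>
  The weak derivative is determined only almost everywhere
  (lemma \<open>has_weak_deriv_unique\<close>); it is only ever used under an integral.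
\<close>

definition weak_deriv :: "(real \<Rightarrow> 'a::euclidean_space) \<Rightarrow> real \<Rightarrow> 'a" where
  "weak_deriv f = (SOME g. has_weak_deriv f g)"

definition H1_circle :: "(real \<Rightarrow> 'a::euclidean_space) set" where
  "H1_circle = {f. periodic f \<and> (\<exists>g. has_weak_deriv f g)}"

abbreviation \<theta>_deriv :: "(real \<Rightarrow> 'a::real_normed_vector) \<Rightarrow> real \<Rightarrow> 'a" where
  "\<theta>_deriv f \<equiv> \<lambda>\<theta>. vector_derivative f (at \<theta>)"

text \<open>
  An element of $H^2(S^1)$ is represented by its $C^1$ representative, so that the condition
  $c'(\theta) \neq 0$ for all $\theta$ has a pointwise meaning.
\<close>

definition H2_circle :: "(real \<Rightarrow> 'a::euclidean_space) set" where
  "H2_circle = {c. periodic c \<and> (\<forall>\<theta>. c differentiable at \<theta>) \<and> \<theta>_deriv c \<in> H1_circle}"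

lemma L2_circle_integrable_inner:
  assumes "f \<in> L2_circle" "g \<in> L2_circle"
  shows "integrable circle (\<lambda>\<theta>. f \<theta> \<bullet> g \<theta>)"
proof (rule Bochner_Integration.integrable_bound)
  show "integrable circle (\<lambda>\<theta>. (norm (f \<theta>))\<^sup>2 + (norm (g \<theta>))\<^sup>2)"
    using assms by (auto simp: L2_circle_def)
  show "(\<lambda>\<theta>. f \<theta> \<bullet> g \<theta>) \<in> borel_measurable circle"
    using assms by (auto simp: L2_circle_def)
  have "\<bar>x \<bullet> y\<bar> \<le> (norm x)\<^sup>2 + (norm y)\<^sup>2" for x y :: 'a
  proof -
    have "\<bar>x \<bullet> y\<bar> \<le> norm x * norm y" by (rule Cauchy_Schwarz_ineq2)
    moreover have "0 \<le> (norm x - norm y)\<^sup>2" by simp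
    moreover have "0 \<le> norm x * norm y" by simp
    ultimately show ?thesis unfolding power2_diff by linarith
  qed
  then show "AE \<theta> in circle. norm (f \<theta> \<bullet> g \<theta>) \<le> norm ((norm (f \<theta>))\<^sup>2 + (norm (g \<theta>))\<^sup>2)"
    by simp
qed

lemma L2_circle_add:
  assumes "f \<in> L2_circle" "g \<in> L2_circle"
  shows "(\<lambda>\<theta>. f \<theta> + g \<theta>) \<in> L2_circle"
proof -
  have "integrable circle (\<lambda>\<theta>. (norm (f \<theta>))\<^sup>2 + (norm (g \<theta>))\<^sup>2 + 2 * (f \<theta> \<bullet> g \<theta>))"
    using assms L2_circle_integrable_inner[OF assms] by (auto simp: L2_circle_def)
  moreover have "(norm (f \<theta>))\<^sup>2 + (norm (g \<theta>))\<^sup>2 + 2 * (f \<theta> \<bullet> g \<theta>) = (norm (f \<theta> + g \<theta>))\<^sup>2" for \<theta>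
    by (simp add: power2_norm_eq_inner inner_add_left inner_add_right inner_commute)
  ultimately show ?thesis using assms by (auto simp: L2_circle_def)
qed

lemma L2_circle_scaleR: "f \<in> L2_circle \<Longrightarrow> (\<lambda>\<theta>. r *\<^sub>R f \<theta>) \<in> L2_circle"
  by (auto simp: L2_circle_def power_mult_distrib)

lemma continuous_imp_L2_circle:
  assumes "continuous_on UNIV f"
  shows "f \<in> L2_circle"
proof -
  have "f \<in> borel_measurable circle"
    by (intro continuous_imp_measurable_on_sets_lebesgue continuous_on_subset[OF assms]) auto
  moreover have "integrable circle (\<lambda>\<theta>. (norm (f \<theta>))\<^sup>2)"
    using assms
    by (intro continuous_imp_integrable_real continuous_intros) (auto intro: continuous_on_subset)
  ultimately show ?thesis by (simp add: L2_circle_def)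
qed

lemma L2_circle_integrable:
  assumes "f \<in> L2_circle"
  shows "integrable circle f"
proof (rule Bochner_Integration.integrable_bound)
  show "integrable circle (\<lambda>\<theta>. 1 + (norm (f \<theta>))\<^sup>2)"
    using assms by (auto simp: L2_circle_def)
  show "f \<in> borel_measurable circle" using assms by (simp add: L2_circle_def)
  have "norm x \<le> 1 + (norm x)\<^sup>2" for x :: 'a
    using power2_diff[of "norm x" 1] zero_le_power2[of "norm x - 1"] norm_ge_zero[of x]
    by (simp del: norm_ge_zero)
  then show "AE \<theta> in circle. norm (f \<theta>) \<le> norm (1 + (norm (f \<theta>))\<^sup>2)" by simp
qed

lemma has_weak_deriv_add:
  "has_weak_deriv f f' \<Longrightarrow> has_weak_deriv g g' \<Longrightarrow>
    has_weak_deriv (\<lambda>\<theta>. f \<theta> + g \<theta>) (\<lambda>\<theta>. f' \<theta> + g' \<theta>)"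
  unfolding has_weak_deriv_def
  by (auto intro: L2_circle_add simp: add_diff_add intro!: has_integral_add)

lemma has_weak_deriv_scaleR:
  "has_weak_deriv f f' \<Longrightarrow> has_weak_deriv (\<lambda>\<theta>. r *\<^sub>R f \<theta>) (\<lambda>\<theta>. r *\<^sub>R f' \<theta>)"
  unfolding has_weak_deriv_def
  by (auto intro: L2_circle_scaleR simp: scaleR_diff_right[symmetric] intro!: has_integral_cmul)

lemma has_weak_deriv_unique:
  assumes "has_weak_deriv f g" "has_weak_deriv f h"
  shows "AE \<theta> in circle. g \<theta> = h \<theta>"
proof -
  have "AE \<theta> in circle. g \<theta> - h \<theta> = 0"
  proof (rule AE_zero_if_primitive_zero)
    show "integrable circle (\<lambda>\<theta>. g \<theta> - h \<theta>)"
      using assms by (auto simp: has_weak_deriv_def intro: L2_circle_integrable)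
    show "((\<lambda>\<theta>. g \<theta> - h \<theta>) has_integral 0) {0..\<theta>}" if "\<theta> \<in> {0..2 * pi}" for \<theta>
      using has_integral_diff[of g "f \<theta> - f 0" "{0..\<theta>}" h "f \<theta> - f 0"] assms that
      by (auto simp: has_weak_deriv_def)
  qed simp
  then show ?thesis by simp
qed

lemma has_weak_deriv_weak_deriv: "f \<in> H1_circle \<Longrightarrow> has_weak_deriv f (weak_deriv f)"
  unfolding weak_deriv_def H1_circle_def using someI_ex[of "has_weak_deriv f"] by simp

lemma H1_circle_add: "f \<in> H1_circle \<Longrightarrow> g \<in> H1_circle \<Longrightarrow> (\<lambda>\<theta>. f \<theta> + g \<theta>) \<in> H1_circle"
  unfolding H1_circle_def periodic_fun_simple_def by (auto intro: has_weak_deriv_add)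

lemma H1_circle_scaleR: "f \<in> H1_circle \<Longrightarrow> (\<lambda>\<theta>. r *\<^sub>R f \<theta>) \<in> H1_circle"
  unfolding H1_circle_def periodic_fun_simple_def by (auto intro: has_weak_deriv_scaleR)

lemma weak_deriv_add_AE:
  assumes "f \<in> H1_circle" "g \<in> H1_circle"
  shows "AE \<theta> in circle. weak_deriv (\<lambda>\<theta>. f \<theta> + g \<theta>) \<theta> = weak_deriv f \<theta> + weak_deriv g \<theta>"
  by (rule has_weak_deriv_unique[where f = "\<lambda>\<theta>. f \<theta> + g \<theta>"])
    (intro has_weak_deriv_add has_weak_deriv_weak_deriv H1_circle_add assms)+

lemma weak_deriv_scaleR_AE:
  assumes "f \<in> H1_circle"
  shows "AE \<theta> in circle. weak_deriv (\<lambda>\<theta>. r *\<^sub>R f \<theta>) \<theta> = r *\<^sub>R weak_deriv f \<theta>"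
  by (rule has_weak_deriv_unique[where f = "\<lambda>\<theta>. r *\<^sub>R f \<theta>"])
    (intro has_weak_deriv_scaleR has_weak_deriv_weak_deriv H1_circle_scaleR assms)+

lemma weak_deriv_L2: "f \<in> H1_circle \<Longrightarrow> weak_deriv f \<in> L2_circle"
  using has_weak_deriv_weak_deriv by (auto simp: has_weak_deriv_def)

lemma H1_circle_L2:
  assumes "f \<in> H1_circle"
  shows "f \<in> L2_circle"
proof -
  from assms obtain g where g: "has_weak_deriv f g" by (auto simp: H1_circle_def)
  then have gi: "integral {0..\<theta>} g = f \<theta> - f 0" if "\<theta> \<in> {0..2 * pi}" for \<theta>
    using that by (auto simp: has_weak_deriv_def intro: integral_unique)
  have "g integrable_on {0..2 * pi}"
    using g by (auto simp: has_weak_deriv_def has_integral_integrable)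
  then have "continuous_on {0..2 * pi} (\<lambda>\<theta>. f 0 + integral {0..\<theta>} g)"
    by (intro continuous_intros indefinite_integral_continuous_1)
  then have cont: "continuous_on {0..2 * pi} f"
    by (rule continuous_on_eq) (simp add: gi)
  then have "f \<in> borel_measurable circle"
    by (auto intro!: continuous_imp_measurable_on_sets_lebesgue)
  moreover have "integrable circle (\<lambda>\<theta>. (norm (f \<theta>))\<^sup>2)"
    using cont by (intro continuous_imp_integrable_real continuous_intros)
  ultimately show ?thesis by (simp add: L2_circle_def)
qed

lemma H2_circle_add:
  assumes "f \<in> H2_circle" "g \<in> H2_circle"
  shows "(\<lambda>\<theta>. f \<theta> + g \<theta>) \<in> H2_circle"
    and "\<theta>_deriv (\<lambda>\<theta>. f \<theta> + g \<theta>) = (\<lambda>\<theta>. \<theta>_deriv f \<theta> + \<theta>_deriv g \<theta>)"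
proof -
  show "\<theta>_deriv (\<lambda>\<theta>. f \<theta> + g \<theta>) = (\<lambda>\<theta>. \<theta>_deriv f \<theta> + \<theta>_deriv g \<theta>)"
    using assms by (auto simp: H2_circle_def fun_eq_iff)
  with assms show "(\<lambda>\<theta>. f \<theta> + g \<theta>) \<in> H2_circle"
    by (auto simp: H2_circle_def periodic_fun_simple_def intro: H1_circle_add)
qed

lemma H2_circle_scaleR:
  assumes "f \<in> H2_circle"
  shows "(\<lambda>\<theta>. r *\<^sub>R f \<theta>) \<in> H2_circle"
    and "\<theta>_deriv (\<lambda>\<theta>. r *\<^sub>R f \<theta>) = (\<lambda>\<theta>. r *\<^sub>R \<theta>_deriv f \<theta>)"
proof -
  show "\<theta>_deriv (\<lambda>\<theta>. r *\<^sub>R f \<theta>) = (\<lambda>\<theta>. r *\<^sub>R \<theta>_deriv f \<theta>)"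
    using assms by (auto simp: H2_circle_def fun_eq_iff)
  with assms show "(\<lambda>\<theta>. r *\<^sub>R f \<theta>) \<in> H2_circle"
    by (auto simp: H2_circle_def periodic_fun_simple_def intro: H1_circle_scaleR)
qed

lemma zero_H2_circle: "(\<lambda>\<theta>. 0) \<in> H2_circle"
  by (auto simp: H2_circle_def H1_circle_def periodic_fun_simple_def has_weak_deriv_def L2_circle_def
      intro!: exI[of _ "\<lambda>\<theta>. 0"])

section \<open>The Hilbert space $H^2(S^1)$\<close>

typedef (overloaded) ('a::euclidean_space) H2 = "H2_circle :: (real \<Rightarrow> 'a) set"
  morphisms H2_fun Abs_H2
  using zero_H2_circle by blast

instantiation H2 :: (euclidean_space) real_vector
begin

definition zero_H2 :: "'a H2" where "0 = Abs_H2 (\<lambda>\<theta>. 0)"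
definition plus_H2 :: "'a H2 \<Rightarrow> 'a H2 \<Rightarrow> 'a H2" where
  "f + g = Abs_H2 (\<lambda>\<theta>. H2_fun f \<theta> + H2_fun g \<theta>)"
definition scaleR_H2 :: "real \<Rightarrow> 'a H2 \<Rightarrow> 'a H2" where
  "r *\<^sub>R f = Abs_H2 (\<lambda>\<theta>. r *\<^sub>R H2_fun f \<theta>)"
definition uminus_H2 :: "'a H2 \<Rightarrow> 'a H2" where "- f = (-1) *\<^sub>R (f :: 'a H2)"
definition minus_H2 :: "'a H2 \<Rightarrow> 'a H2 \<Rightarrow> 'a H2" where "f - g = f + - (g :: 'a H2)"

lemma H2_fun_zero: "H2_fun (0::'a H2) = (\<lambda>\<theta>. 0)"
  by (simp add: zero_H2_def Abs_H2_inverse zero_H2_circle)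

lemma H2_fun_plus: "H2_fun (f + g :: 'a H2) = (\<lambda>\<theta>. H2_fun f \<theta> + H2_fun g \<theta>)"
  by (simp add: plus_H2_def Abs_H2_inverse H2_circle_add H2_fun)

lemma H2_fun_scaleR: "H2_fun (r *\<^sub>R f :: 'a H2) = (\<lambda>\<theta>. r *\<^sub>R H2_fun f \<theta>)"
  by (simp add: scaleR_H2_def Abs_H2_inverse H2_circle_scaleR H2_fun)

lemma H2_fun_uminus: "H2_fun (- f :: 'a H2) = (\<lambda>\<theta>. - H2_fun f \<theta>)"
  by (simp add: uminus_H2_def H2_fun_scaleR)

lemma H2_fun_minus: "H2_fun (f - g :: 'a H2) = (\<lambda>\<theta>. H2_fun f \<theta> - H2_fun g \<theta>)"
  by (simp add: minus_H2_def H2_fun_plus H2_fun_uminus)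

instance
  by standard
    (auto simp: H2_fun_inject[symmetric] H2_fun_zero H2_fun_plus H2_fun_scaleR H2_fun_uminus
      H2_fun_minus scaleR_add_right scaleR_add_left)

end

lemmas H2_fun_simps = H2_fun_zero H2_fun_plus H2_fun_scaleR H2_fun_uminus H2_fun_minus

lemma H2_fun_deriv_plus:
  "\<theta>_deriv (H2_fun (f + g)) = (\<lambda>\<theta>. \<theta>_deriv (H2_fun f) \<theta> + \<theta>_deriv (H2_fun g) \<theta>)"
  by (simp add: H2_fun_plus H2_circle_add H2_fun)

lemma H2_fun_deriv_scaleR:
  "\<theta>_deriv (H2_fun (r *\<^sub>R f)) = (\<lambda>\<theta>. r *\<^sub>R \<theta>_deriv (H2_fun f) \<theta>)"
  by (simp add: H2_fun_scaleR H2_circle_scaleR H2_fun)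

lemma H2_fun_deriv_H1: "\<theta>_deriv (H2_fun f) \<in> H1_circle"
  using H2_fun[of f] by (simp add: H2_circle_def)

lemma H2_fun_continuous: "continuous_on A (H2_fun f)"
  using H2_fun[of f]
  by (auto simp: H2_circle_def intro!: continuous_at_imp_continuous_on differentiable_imp_continuous_within)

lemma H2_fun_L2: "H2_fun f \<in> L2_circle"
  by (intro continuous_imp_L2_circle H2_fun_continuous)

lemma continuous_periodic_AE_zero:
  fixes f :: "real \<Rightarrow> 'a::euclidean_space"
  assumes cont: "continuous_on UNIV f" and per: "periodic f" and ae: "AE \<theta> in circle. f \<theta> = 0"
  shows "f \<theta> = 0"
proof -
  have ae': "AE \<theta> in lebesgue. \<theta> \<in> {0..2 * pi} \<longrightarrow> f \<theta> = 0"
    using ae by (subst (asm) AE_restrict_space_iff) auto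
  have "((\<lambda>\<theta>. (norm (f \<theta>))\<^sup>2) has_integral 0) {0..2 * pi}"
    by (subst has_integral_AE[where g = "\<lambda>_. 0"]) (use ae' in \<open>auto simp: AE_completion_iff\<close>)
  moreover have "continuous_on {0..2 * pi} (\<lambda>\<theta>. (norm (f \<theta>))\<^sup>2)"
    using cont by (intro continuous_intros) (auto intro: continuous_on_subset)
  ultimately have zero: "f x = 0" if "x \<in> {0..2 * pi}" for x
    using has_integral_0_cbox_imp_0[of 0 "2 * pi" "\<lambda>\<theta>. (norm (f \<theta>))\<^sup>2" x] that
    using pi_gt_zero by (simp add: box_real not_le)
  interpret periodic_fun_simple f "2 * pi" by (fact per)
  define k where "k = \<lfloor>\<theta> / (2 * pi)\<rfloor>"
  have "of_int k \<le> \<theta> / (2 * pi)" "\<theta> / (2 * pi) < of_int k + 1"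
    unfolding k_def by linarith+
  then have "of_int k * (2 * pi) \<le> \<theta>" "\<theta> < (of_int k + 1) * (2 * pi)"
    by (simp_all only: pos_le_divide_eq pos_divide_less_eq pi_gt_zero mult_pos_pos zero_less_numeral)
  then have "\<theta> - of_int k * (2 * pi) \<in> {0..2 * pi}"
    by (simp add: distrib_right)
  then have "f (\<theta> - of_int k * (2 * pi)) = 0" by (rule zero)
  moreover have "f (\<theta> - of_int k * (2 * pi)) = f \<theta>" by (rule minus_of_int)
  ultimately show ?thesis by simp
qed

instantiation H2 :: (euclidean_space) real_inner
begin

definition inner_H2 :: "'a H2 \<Rightarrow> 'a H2 \<Rightarrow> real" where
  "inner_H2 f g = (\<integral>\<theta>. H2_fun f \<theta> \<bullet> H2_fun g \<theta>
      + \<theta>_deriv (H2_fun f) \<theta> \<bullet> \<theta>_deriv (H2_fun g) \<theta>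
      + weak_deriv (\<theta>_deriv (H2_fun f)) \<theta> \<bullet> weak_deriv (\<theta>_deriv (H2_fun g)) \<theta> \<partial>circle)"

definition norm_H2 :: "'a H2 \<Rightarrow> real" where "norm_H2 f = sqrt (inner f f)"
definition sgn_H2 :: "'a H2 \<Rightarrow> 'a H2" where "sgn_H2 f = f /\<^sub>R norm f"
definition dist_H2 :: "'a H2 \<Rightarrow> 'a H2 \<Rightarrow> real" where "dist_H2 f g = norm (f - g)"
definition uniformity_H2 :: "('a H2 \<times> 'a H2) filter" where
  "uniformity_H2 = (INF e\<in>{0<..}. principal {(x, y). dist x y < e})"
definition open_H2 :: "'a H2 set \<Rightarrow> bool" where
  "open_H2 U \<longleftrightarrow> (\<forall>x\<in>U. eventually (\<lambda>(x', y). x' = x \<longrightarrow> y \<in> U) uniformity)"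

lemma integrable_inner_H2:
  fixes f g :: "'a H2"
  shows "integrable circle (\<lambda>\<theta>. H2_fun f \<theta> \<bullet> H2_fun g \<theta>)"
    and "integrable circle (\<lambda>\<theta>. \<theta>_deriv (H2_fun f) \<theta> \<bullet> \<theta>_deriv (H2_fun g) \<theta>)"
    and "integrable circle
      (\<lambda>\<theta>. weak_deriv (\<theta>_deriv (H2_fun f)) \<theta> \<bullet> weak_deriv (\<theta>_deriv (H2_fun g)) \<theta>)"
  by (intro L2_circle_integrable_inner H2_fun_L2 H1_circle_L2 weak_deriv_L2 H2_fun_deriv_H1)+

instance
proof
  fix f g h :: "'a H2" and r :: real
  let ?w = "\<lambda>f::'a H2. weak_deriv (\<theta>_deriv (H2_fun f))"
  have meas: "(\<lambda>\<theta>. H2_fun f \<theta> \<bullet> H2_fun g \<theta> + \<theta>_deriv (H2_fun f) \<theta> \<bullet> \<theta>_deriv (H2_fun g) \<theta>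
      + ?w f \<theta> \<bullet> ?w g \<theta>) \<in> borel_measurable circle" for f g :: "'a H2"
    by (intro borel_measurable_add borel_measurable_integrable integrable_inner_H2)
  show "dist f g = norm (f - g)" by (rule dist_H2_def)
  show "uniformity = (INF e\<in>{0<..}. principal {(x, y :: 'a H2). dist x y < e})"
    by (rule uniformity_H2_def)
  show "open U = (\<forall>x\<in>U. eventually (\<lambda>(x', y). x' = x \<longrightarrow> y \<in> U) uniformity)"
    for U :: "'a H2 set" by (rule open_H2_def)
  show "sgn f = f /\<^sub>R norm f" by (rule sgn_H2_def)
  show "norm f = sqrt (inner f f)" by (rule norm_H2_def)
  show "inner f g = inner g f" by (simp add: inner_H2_def inner_commute)
  show "inner (f + g) h = inner f h + inner g h"
  proof -
    have "inner (f + g) h = (\<integral>\<theta>.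
        (H2_fun f \<theta> \<bullet> H2_fun h \<theta> + \<theta>_deriv (H2_fun f) \<theta> \<bullet> \<theta>_deriv (H2_fun h) \<theta> + ?w f \<theta> \<bullet> ?w h \<theta>)
      + (H2_fun g \<theta> \<bullet> H2_fun h \<theta> + \<theta>_deriv (H2_fun g) \<theta> \<bullet> \<theta>_deriv (H2_fun h) \<theta> + ?w g \<theta> \<bullet> ?w h \<theta>) \<partial>circle)"
      unfolding inner_H2_def
    proof (rule integral_cong_AE)
      show "AE \<theta> in circle. H2_fun (f + g) \<theta> \<bullet> H2_fun h \<theta>
          + \<theta>_deriv (H2_fun (f + g)) \<theta> \<bullet> \<theta>_deriv (H2_fun h) \<theta> + ?w (f + g) \<theta> \<bullet> ?w h \<theta> =
        (H2_fun f \<theta> \<bullet> H2_fun h \<theta> + \<theta>_deriv (H2_fun f) \<theta> \<bullet> \<theta>_deriv (H2_fun h) \<theta> + ?w f \<theta> \<bullet> ?w h \<theta>)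
      + (H2_fun g \<theta> \<bullet> H2_fun h \<theta> + \<theta>_deriv (H2_fun g) \<theta> \<bullet> \<theta>_deriv (H2_fun h) \<theta> + ?w g \<theta> \<bullet> ?w h \<theta>)"
        using weak_deriv_add_AE[OF H2_fun_deriv_H1[of f] H2_fun_deriv_H1[of g]]
        unfolding H2_fun_deriv_plus
        by eventually_elim
            (simp add: fun_cong[OF H2_fun_plus] fun_cong[OF H2_fun_deriv_plus] inner_add_left)
    qed (intro meas borel_measurable_add)+
    also have "\<dots> = inner f h + inner g h"
      unfolding inner_H2_def
      by (intro Bochner_Integration.integral_add Bochner_Integration.integrable_add integrable_inner_H2)
    finally show ?thesis .
  qed
  have scaleR: "inner (r *\<^sub>R f) g = r * inner f g" for r :: real and f g :: "'a H2"
  proof -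
    have "inner (r *\<^sub>R f) g = (\<integral>\<theta>. r *
        (H2_fun f \<theta> \<bullet> H2_fun g \<theta> + \<theta>_deriv (H2_fun f) \<theta> \<bullet> \<theta>_deriv (H2_fun g) \<theta> + ?w f \<theta> \<bullet> ?w g \<theta>) \<partial>circle)"
      unfolding inner_H2_def
    proof (rule integral_cong_AE)
      show "AE \<theta> in circle. H2_fun (r *\<^sub>R f) \<theta> \<bullet> H2_fun g \<theta>
          + \<theta>_deriv (H2_fun (r *\<^sub>R f)) \<theta> \<bullet> \<theta>_deriv (H2_fun g) \<theta> + ?w (r *\<^sub>R f) \<theta> \<bullet> ?w g \<theta> =
        r * (H2_fun f \<theta> \<bullet> H2_fun g \<theta> + \<theta>_deriv (H2_fun f) \<theta> \<bullet> \<theta>_deriv (H2_fun g) \<theta> + ?w f \<theta> \<bullet> ?w g \<theta>)"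
        using weak_deriv_scaleR_AE[OF H2_fun_deriv_H1[of f], of r]
        unfolding H2_fun_deriv_scaleR
        by eventually_elim
            (simp add: fun_cong[OF H2_fun_scaleR] fun_cong[OF H2_fun_deriv_scaleR] distrib_left)
    qed (intro meas borel_measurable_times borel_measurable_const)+
    also have "\<dots> = r * inner f g"
      unfolding inner_H2_def by (rule integral_mult_right_zero)
    finally show ?thesis .
  qed
  show "inner (r *\<^sub>R f) g = r * inner f g" by (rule scaleR)
  show "0 \<le> inner f f"
    unfolding inner_H2_def by (rule Bochner_Integration.integral_nonneg) simp
  show "inner f f = 0 \<longleftrightarrow> f = 0"
  proof
    assume "inner f f = 0"
    then have "AE \<theta> in circle. H2_fun f \<theta> \<bullet> H2_fun f \<theta>
      + \<theta>_deriv (H2_fun f) \<theta> \<bullet> \<theta>_deriv (H2_fun f) \<theta> + ?w f \<theta> \<bullet> ?w f \<theta> = 0"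
      unfolding inner_H2_def
      by (subst (asm) integral_nonneg_eq_0_iff_AE)
        (auto intro!: Bochner_Integration.integrable_add integrable_inner_H2)
    then have "AE \<theta> in circle. H2_fun f \<theta> = 0"
    proof eventually_elim
      case (elim \<theta>)
      then have "H2_fun f \<theta> \<bullet> H2_fun f \<theta> = 0"
        using inner_ge_zero[of "H2_fun f \<theta>"] inner_ge_zero[of "\<theta>_deriv (H2_fun f) \<theta>"]
          inner_ge_zero[of "?w f \<theta>"] by linarith
      then show ?case by simp
    qed
    then have "H2_fun f \<theta> = 0" for \<theta>
      using H2_fun[of f] by (intro continuous_periodic_AE_zero H2_fun_continuous) (auto simp: H2_circle_def)
    then show "f = 0" by (simp add: H2_fun_inject[symmetric] H2_fun_zero fun_eq_iff)
  qed (use scaleR[of 0 0 0] in simp)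
qed

end

section \<open>Immersed curves and the length-weighted metric\<close>

definition immersions :: "('a::euclidean_space) H2 set" where
  "immersions = {c. \<forall>\<theta>. \<theta>_deriv (H2_fun c) \<theta> \<noteq> 0}"

definition curve_length :: "('a::euclidean_space) H2 \<Rightarrow> real" where
  "curve_length c = (\<integral>\<theta>. norm (\<theta>_deriv (H2_fun c) \<theta>) \<partial>circle)"

text \<open>
  $D_s h$ and $D_s^2 h = D_s (D_s h)$. For \<^term>\<open>h\<close> in $H^2$ the function $D_s h$ is only in $H^1$,
  so the outer derivative is a weak one.
\<close>

definition Ds :: "('a::euclidean_space) H2 \<Rightarrow> 'a H2 \<Rightarrow> real \<Rightarrow> 'a" where
  "Ds c h = (\<lambda>\<theta>. \<theta>_deriv (H2_fun h) \<theta> /\<^sub>R norm (\<theta>_deriv (H2_fun c) \<theta>))"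

definition Ds2 :: "('a::euclidean_space) H2 \<Rightarrow> 'a H2 \<Rightarrow> real \<Rightarrow> 'a" where
  "Ds2 c h = (\<lambda>\<theta>. weak_deriv (Ds c h) \<theta> /\<^sub>R norm (\<theta>_deriv (H2_fun c) \<theta>))"

definition sobolev_metric ::
  "real \<Rightarrow> real \<Rightarrow> ('a::euclidean_space) H2 \<Rightarrow> 'a H2 \<Rightarrow> 'a H2 \<Rightarrow> real" where
  "sobolev_metric p q c h k =
     (\<integral>\<theta>. (curve_length c powr q * (H2_fun h \<theta> \<bullet> H2_fun k \<theta>)
            + curve_length c powr p * (Ds2 c h \<theta> \<bullet> Ds2 c k \<theta>))
          * norm (\<theta>_deriv (H2_fun c) \<theta>) \<partial>circle)"

section \<open>Geodesic distance and completeness\<close>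

definition smooth_on_interval :: "real \<Rightarrow> real \<Rightarrow> (real \<Rightarrow> 'b::real_normed_vector) \<Rightarrow> bool" where
  "smooth_on_interval a b \<gamma> \<longleftrightarrow>
     (\<exists>D. (\<forall>t\<in>{a..b}. D 0 t = \<gamma> t) \<and>
       (\<forall>n::nat. \<forall>t\<in>{a..b}. (D n has_vector_derivative D (Suc n) t) (at t within {a..b})))"

text \<open>Smooth, up to the end points, on each closed interval between consecutive break points.\<close>

definition piecewise_smooth_path :: "(real \<Rightarrow> 'b::real_normed_vector) \<Rightarrow> bool" where
  "piecewise_smooth_path \<gamma> \<longleftrightarrow>
     path \<gamma> \<and>
     (\<exists>K. finite K \<and>
       (\<forall>a b. 0 \<le> a \<and> a < b \<and> b \<le> 1 \<and> {a<..<b} \<inter> K = {} \<longrightarrow> smooth_on_interval a b \<gamma>))"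

definition path_length :: "real \<Rightarrow> real \<Rightarrow> (real \<Rightarrow> ('a::euclidean_space) H2) \<Rightarrow> ennreal" where
  "path_length p q \<gamma> =
     (\<integral>\<^sup>+t\<in>{0..1}. ennreal (sqrt (sobolev_metric p q (\<gamma> t)
        (vector_derivative \<gamma> (at t)) (vector_derivative \<gamma> (at t)))) \<partial>lborel)"

text \<open>The infimum over the empty set is \<^term>\<open>\<infinity> :: ennreal\<close>.\<close>

definition geodesic_dist ::
  "real \<Rightarrow> real \<Rightarrow> ('a::euclidean_space) H2 \<Rightarrow> 'a H2 \<Rightarrow> ennreal" where
  "geodesic_dist p q c\<^sub>0 c\<^sub>1 =
     (INF \<gamma>\<in>{\<gamma>. piecewise_smooth_path \<gamma> \<and> path_image \<gamma> \<subseteq> immersions \<and>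
             pathstart \<gamma> = c\<^sub>0 \<and> pathfinish \<gamma> = c\<^sub>1}. path_length p q \<gamma>)"

text \<open>
  Completeness for a distance that may take the value \<open>\<infinity>\<close>, which
  \<^const>\<open>Metric_space.mcomplete\<close> does not cover.
\<close>

definition metrically_complete :: "'b set \<Rightarrow> ('b \<Rightarrow> 'b \<Rightarrow> ennreal) \<Rightarrow> bool" where
  "metrically_complete S d \<longleftrightarrow>
     (\<forall>x::nat \<Rightarrow> 'b. range x \<subseteq> S \<and> (\<forall>\<epsilon>>0. \<exists>N. \<forall>m\<ge>N. \<forall>n\<ge>N. d (x m) (x n) < \<epsilon>)
        \<longrightarrow> (\<exists>l\<in>S. (\<lambda>n. d (x n) l) \<longlonglongrightarrow> 0))"

text \<open>On the line there are no closed immersed curves, so the theory starts in dimension two.\<close>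

lemma immersions_empty_dim1:
  assumes "DIM('a::euclidean_space) = 1"
  shows "(immersions :: 'a H2 set) = {}"
proof -
  have False if "c \<in> immersions" for c :: "'a H2"
  proof -
    obtain b :: 'a where b: "Basis = {b}" using assms by (rule card_1_singletonE)
    let ?c = "H2_fun c"
    have diff: "?c differentiable at \<theta>" for \<theta> using H2_fun[of c] by (simp add: H2_circle_def)
    have per: "periodic ?c" using H2_fun[of c] by (simp add: H2_circle_def)
    have der: "((\<lambda>\<theta>. ?c \<theta> \<bullet> b) has_real_derivative \<theta>_deriv ?c \<theta> \<bullet> b) (at \<theta>)" for \<theta>
    proof -
      have "(?c has_vector_derivative \<theta>_deriv ?c \<theta>) (at \<theta>)"
        using diff by (simp add: vector_derivative_works)
      then show ?thesis
        unfolding has_real_derivative_iff_has_vector_derivative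
        by (rule bounded_linear.has_vector_derivative[OF bounded_linear_inner_left])
    qed
    have "\<exists>z. 0 < z \<and> z < 2 * pi \<and>
        (?c (2 * pi) \<bullet> b) - (?c 0 \<bullet> b) = (2 * pi - 0) * (\<theta>_deriv ?c z \<bullet> b)"
      by (rule MVT2) (simp, rule der)
    then obtain z where "(?c (2 * pi) \<bullet> b) - (?c 0 \<bullet> b) = (2 * pi - 0) * (\<theta>_deriv ?c z \<bullet> b)"
      by blast
    moreover have "?c (2 * pi) = ?c 0"
      using per[unfolded periodic_fun_simple_def, rule_format, of 0] by simp
    ultimately have z: "\<theta>_deriv ?c z \<bullet> b = 0" by simp
    have "\<theta>_deriv ?c z = 0"
      by (rule euclidean_eqI) (simp add: b z)
    then show False using that by (auto simp: immersions_def)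
  qed
  then show ?thesis by blast
qed

end

theory Submission
  imports Defs
begin

text \<open>
  A power of the length, $\ell_c^{(p-1)/2}$, is Lipschitz for the geodesic distance: by the Poincare and
  Cauchy-Schwarz inequalities the second order part of the metric controls the variation of the
  length. So it suffices to find a Cauchy sequence along which $\ell_c^{(p-1)/2}$ tends to zero.

  For \<open>q = -3\<close> the zeroth order part of the metric is scale invariant and only sees the size of a
  curve relative to its length. Lissajous curves of frequencies growing like $4^k$ have size
  $4^{-k}$ relative to their length, so rescaling them from $R^k$ to $R^{k+1}$ is cheap, and the
  second order part is cheap as soon as $R^{p-1}$ is small. Consecutive curves share one frequency;
  the other one is replaced by a frequency whose cosine agrees with the old one at the zeros of the
  shared cosine, so all curves on the straight segment in between are immersed.
\<close>

section \<open>Products and compositions of primitives\<close>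

text \<open>With \<open>q = -3\<close>, rescaling one fixed shape by a given factor costs a fixed
  amount in the zeroth order part, so repeating this forever has infinite length. The shape must
  therefore change on the way so that the costs become summable, and the obstacle is to change it
  while the derivative stays away from zero at a known rate. Exchanging frequencies loses a factor 5
  of minimal speed per step; together with the growth of the second derivative this lets the bound
  on \<open>Ds2\<close> grow like \<open>5 ^ (4 * k) = 625 ^ k\<close>. The ratio \<open>R\<close>
  is then fixed by \<open>R powr (p - 1) = 1 / 6250000\<close>, which makes the second order part
  decay as fast as the zeroth order part. Such an \<open>R\<close> exists for every
  \<open>p \<noteq> 1\<close>: the lengths shrink when \<open>p > 1\<close> and grow when
  \<open>p < 1\<close>, so one argument serves both cases. In both, a limit curve would need a
  vanishing power of a positive length. Only upper bounds on the distances between the chosen curves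
  are required, so straight segments in the vector space suffice as paths.\<close>

lemma increments_zero_if_locally_small:
  fixes A :: "real \<Rightarrow> 'a::real_normed_vector" and V :: "real \<Rightarrow> real"
  assumes "a \<le> b"
    and small: "\<And>e x. e > 0 \<Longrightarrow> x \<in> {a..b} \<Longrightarrow> \<exists>d>0. \<forall>y z. a \<le> y \<and> y \<le> x \<and> x \<le> z \<and> z \<le> b \<and> z - y < d
          \<longrightarrow> norm (A z - A y) \<le> e * (V z - V y)"
  shows "A b = A a"
proof -
  \<comment> \<open>The estimate is additive over adjacent intervals, so bisection turns the local
    bounds into one bound on \<open>{a..b}\<close>. This replaces differentiation almost everywhere
    when the densities are merely integrable.\<close>
  have *: "norm (A b - A a) \<le> e * (V b - V a)" if "e > 0" for e
  proof -
    have "a \<le> a \<and> b \<le> b \<longrightarrow> norm (A b - A a) \<le> e * (V b - V a)"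
      using \<open>a \<le> b\<close>
    proof (induct rule: Bolzano[where P = "\<lambda>y z. a \<le> y \<and> z \<le> b \<longrightarrow> norm (A z - A y) \<le> e * (V z - V y)"])
      case (trans x y z)
      then show ?case
        using norm_triangle_ineq[of "A z - A y" "A y - A x"] by (auto simp: algebra_simps)
    next
      case (local x)
      then show ?case using small[OF that, of x] by force
    qed
    then show ?thesis by simp
  qed
  have "norm (A b - A a) \<le> 0 + e" if "e > 0" for e
  proof -
    have "norm (A b - A a) \<le> e / (\<bar>V b - V a\<bar> + 1) * (V b - V a)"
      using that by (intro *) (auto intro: divide_pos_pos add_nonneg_pos)
    also have "\<dots> \<le> e / (\<bar>V b - V a\<bar> + 1) * (\<bar>V b - V a\<bar> + 1)"
      using that by (intro mult_left_mono) auto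
    finally show ?thesis by (simp add: add_nonneg_eq_0_iff)
  qed
  then have "norm (A b - A a) \<le> 0" by (rule field_le_epsilon)
  then show ?thesis by simp
qed

text \<open>Absolute continuity, encoded by the integral formula so that no pointwise derivative is
  involved. Absolute integrability is included because a merely gauge integrable \<open>F\<close>
  may cease to be integrable after multiplication by a continuous function.\<close>

definition is_primitive :: "real \<Rightarrow> real \<Rightarrow> (real \<Rightarrow> 'a::euclidean_space) \<Rightarrow> (real \<Rightarrow> 'a) \<Rightarrow> bool" where
  "is_primitive a b f F \<longleftrightarrow>
     F absolutely_integrable_on {a..b} \<and> (\<forall>x\<in>{a..b}. (F has_integral (f x - f a)) {a..x})"

lemma is_primitive_increment:
  assumes "is_primitive a b f F" "a \<le> y" "y \<le> z" "z \<le> b"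
  shows "(F has_integral (f z - f y)) {y..z}"
proof -
  have z: "(F has_integral (f z - f a)) {a..z}" and y: "(F has_integral (f y - f a)) {a..y}"
    using assms by (auto simp: is_primitive_def)
  have "F integrable_on {y..z}"
    using z assms by (auto intro: integrable_subinterval_real)
  then obtain I where I: "(F has_integral I) {y..z}" by (auto simp: integrable_on_def)
  have "(F has_integral (f y - f a + I)) {a..z}"
    using assms by (intro has_integral_combine[OF _ _ y I]) auto
  with z have "f y - f a + I = f z - f a" by (rule has_integral_unique[symmetric])
  then have "I = f z - f y" by (simp add: algebra_simps)
  with I show ?thesis by simp
qed

lemma is_primitive_continuous:
  assumes "is_primitive a b f F"
  shows "continuous_on {a..b} f"
proof (cases "a \<le> b")
  case True
  have "F integrable_on {a..b}"
    using assms by (auto simp: is_primitive_def set_lebesgue_integral_eq_integral(1))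
  then have "continuous_on {a..b} (\<lambda>x. f a + integral {a..x} F)"
    by (intro continuous_intros indefinite_integral_continuous_1)
  then show ?thesis
    by (rule continuous_on_eq) (use assms in \<open>auto simp: is_primitive_def dest!: bspec integral_unique\<close>)
qed simp

lemma continuous_abs_integrable_product:
  fixes f :: "real \<Rightarrow> 'a::euclidean_space" and G :: "real \<Rightarrow> 'b::euclidean_space"
    and h :: "'a \<Rightarrow> 'b \<Rightarrow> 'c::euclidean_space"
  assumes "bounded_bilinear h" "continuous_on {a..b} f" "G absolutely_integrable_on {a..b}"
  shows "(\<lambda>x. h (f x) (G x)) absolutely_integrable_on {a..b}"
proof (rule absolutely_integrable_bounded_measurable_product[where h = h and f = f and g = G])
  show "bilinear h" using assms(1) by (simp add: bilinear_conv_bounded_bilinear)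
  show "f \<in> borel_measurable (lebesgue_on {a..b})"
    using assms(2) by (rule continuous_imp_measurable_on_sets_lebesgue) simp
  show "bounded (f ` {a..b})"
    using assms(2) by (intro compact_imp_bounded compact_continuous_image) auto
qed (use assms(3) in auto)

text \<open>The error is measured against the integral of \<open>W\<close> and not against
  \<open>z - y\<close>, since the densities may be unbounded. The difference between
  \<open>f\<close> and the indefinite integral of \<open>F\<close> is then constant.\<close>

lemma is_primitive_if_locally_small:
  fixes f F :: "real \<Rightarrow> 'a::euclidean_space"
  assumes F: "F absolutely_integrable_on {a..b}" and W: "W absolutely_integrable_on {a..b}"
    and small: "\<And>e x. e > 0 \<Longrightarrow> x \<in> {a..b} \<Longrightarrow> \<exists>d>0. \<forall>y z. a \<le> y \<and> y \<le> x \<and> x \<le> z \<and> z \<le> b \<and> z - y < d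
          \<longrightarrow> norm (f z - f y - integral {y..z} F) \<le> e * integral {y..z} W"
  shows "is_primitive a b f F"
  unfolding is_primitive_def
proof (intro conjI ballI)
  fix x assume x: "x \<in> {a..b}"
  have Fi: "F integrable_on {y..z}" and Wi: "W integrable_on {y..z}" if "a \<le> y" "z \<le> b" for y z
  proof -
    have "F integrable_on {a..b}" "W integrable_on {a..b}"
      using F W by (auto intro: set_lebesgue_integral_eq_integral(1))
    then show "F integrable_on {y..z}" "W integrable_on {y..z}"
      using that by (auto intro: integrable_subinterval_real)
  qed
  define A where "A t = f t - integral {a..t} F" for t
  have "A x = A a"
  proof (rule increments_zero_if_locally_small[where V = "\<lambda>t. integral {a..t} W"])
    show "a \<le> x" using x by simp
    fix e :: real and t assume "e > 0" and t: "t \<in> {a..x}"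
    then obtain d where d: "d > 0" "\<And>y z. a \<le> y \<Longrightarrow> y \<le> t \<Longrightarrow> t \<le> z \<Longrightarrow> z \<le> b \<Longrightarrow> z - y < d
          \<Longrightarrow> norm (f z - f y - integral {y..z} F) \<le> e * integral {y..z} W"
      using small[of e t] x by fastforce
    show "\<exists>d>0. \<forall>y z. a \<le> y \<and> y \<le> t \<and> t \<le> z \<and> z \<le> x \<and> z - y < d
          \<longrightarrow> norm (A z - A y) \<le> e * (integral {a..z} W - integral {a..y} W)"
    proof (intro exI[of _ d] conjI d(1) allI impI)
      fix y z assume yz: "a \<le> y \<and> y \<le> t \<and> t \<le> z \<and> z \<le> x \<and> z - y < d"
      have 1: "integral {a..y} F + integral {y..z} F = integral {a..z} F"
        using yz x by (intro Henstock_Kurzweil_Integration.integral_combine Fi) auto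
      have 2: "integral {a..y} W + integral {y..z} W = integral {a..z} W"
        using yz x by (intro Henstock_Kurzweil_Integration.integral_combine Wi) auto
      show "norm (A z - A y) \<le> e * (integral {a..z} W - integral {a..y} W)"
        using d(2)[of y z] yz x by (simp add: A_def algebra_simps flip: 1 2)
    qed
  qed
  then have "integral {a..x} F = f x - f a" by (simp add: A_def algebra_simps)
  then show "(F has_integral (f x - f a)) {a..x}"
    using integrable_integral[OF Fi[of a x]] x by auto
qed (fact F)


text \<open>Freezing \<open>f\<close> at the left end and \<open>g\<close> at the right end makes
  the Leibniz formula exact: \<open>h (f y) (g z - g y) + h (f z - f y) (g z) = h (f z) (g z) - h (f
  y) (g y)\<close>. What remains is the oscillation of \<open>f\<close> and \<open>g\<close> near
  \<open>x\<close>, multiplied by the densities.\<close>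

lemma is_primitive_prod:
  fixes f F :: "real \<Rightarrow> 'a::euclidean_space" and g G :: "real \<Rightarrow> 'b::euclidean_space"
    and h :: "'a \<Rightarrow> 'b \<Rightarrow> 'c::euclidean_space"
  assumes h: "bounded_bilinear h" and f: "is_primitive a b f F" and g: "is_primitive a b g G"
  shows "is_primitive a b (\<lambda>x. h (f x) (g x)) (\<lambda>x. h (f x) (G x) + h (F x) (g x))"
proof -
  interpret bounded_bilinear h by (fact h)
  obtain K where K: "K > 0" "\<And>x y. norm (h x y) \<le> norm x * norm y * K" using pos_bounded by blast
  have contf: "continuous_on {a..b} f" and contg: "continuous_on {a..b} g"
    using f g by (auto intro: is_primitive_continuous)
  have FA: "F absolutely_integrable_on {a..b}" and GA: "G absolutely_integrable_on {a..b}"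
    using f g by (auto simp: is_primitive_def)
  note 1 = continuous_abs_integrable_product[OF h contf GA]
  note 2 = continuous_abs_integrable_product[OF bounded_bilinear.flip[OF h] contg FA]
  show ?thesis
  proof (rule is_primitive_if_locally_small[where W = "\<lambda>s. norm (F s) + norm (G s)"])
    show "(\<lambda>s. h (f s) (G s) + h (F s) (g s)) absolutely_integrable_on {a..b}"
      using 1 2 by (rule set_integral_add)
    show "(\<lambda>s. norm (F s) + norm (G s)) absolutely_integrable_on {a..b}"
      using FA GA by (intro set_integral_add) (auto intro: absolutely_integrable_norm[unfolded o_def])
    fix e :: real and x assume e: "e > 0" and x: "x \<in> {a..b}"
    \<comment> \<open>Comparing two values through the value at \<open>x\<close> costs the factor 2,
      the bound on \<open>h\<close> the factor \<open>K\<close>.\<close>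
    define e' where "e' = e / (2 * K)"
    have e': "e' > 0" using e K by (simp add: e'_def)
    obtain d1 where d1: "d1 > 0" "\<And>y. y \<in> {a..b} \<Longrightarrow> dist y x < d1 \<Longrightarrow> dist (f y) (f x) < e'"
      using contf x e' unfolding continuous_on_iff by blast
    obtain d2 where d2: "d2 > 0" "\<And>y. y \<in> {a..b} \<Longrightarrow> dist y x < d2 \<Longrightarrow> dist (g y) (g x) < e'"
      using contg x e' unfolding continuous_on_iff by blast
    show "\<exists>d>0. \<forall>y z. a \<le> y \<and> y \<le> x \<and> x \<le> z \<and> z \<le> b \<and> z - y < d \<longrightarrow>
      norm (h (f z) (g z) - h (f y) (g y) - integral {y..z} (\<lambda>s. h (f s) (G s) + h (F s) (g s)))
       \<le> e * integral {y..z} (\<lambda>s. norm (F s) + norm (G s))"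
    proof (intro exI[of _ "min d1 d2"] conjI allI impI)
      show "min d1 d2 > 0" using d1 d2 by simp
      fix y z assume yz: "a \<le> y \<and> y \<le> x \<and> x \<le> z \<and> z \<le> b \<and> z - y < min d1 d2"
      have nf: "norm (f y - f s) \<le> 2 * e'" and ng: "norm (g z - g s) \<le> 2 * e'" if "s \<in> {y..z}" for s
      proof -
        have "dist (f y) (f x) < e'" "dist (f s) (f x) < e'"
          using d1 yz that by (auto simp: dist_real_def)
        then show "norm (f y - f s) \<le> 2 * e'"
          using dist_triangle2[of "f y" "f s" "f x"] by (simp add: dist_norm)
        have "dist (g z) (g x) < e'" "dist (g s) (g x) < e'"
          using d2 yz that by (auto simp: dist_real_def)
        then show "norm (g z - g s) \<le> 2 * e'"
          using dist_triangle2[of "g z" "g s" "g x"] by (simp add: dist_norm)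
      qed
      have A: "F absolutely_integrable_on {y..z}" "G absolutely_integrable_on {y..z}"
        "(\<lambda>s. h (f s) (G s)) absolutely_integrable_on {y..z}"
        "(\<lambda>s. h (F s) (g s)) absolutely_integrable_on {y..z}"
        using FA GA 1 2 yz by (auto intro: absolutely_integrable_on_subinterval)
      then have I: "(\<lambda>s. h (f s) (G s)) integrable_on {y..z}" "(\<lambda>s. h (F s) (g s)) integrable_on {y..z}"
        "(\<lambda>s. norm (F s)) integrable_on {y..z}" "(\<lambda>s. norm (G s)) integrable_on {y..z}"
        by (auto simp: absolutely_integrable_on_def)
      have "((\<lambda>s. h (f y) (G s)) has_integral h (f y) (g z - g y)) {y..z}"
        using has_integral_linear[OF is_primitive_increment[OF g] bounded_linear_right, of y z] yz
        by (simp add: o_def)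
      moreover have "((\<lambda>s. h (F s) (g z)) has_integral h (f z - f y) (g z)) {y..z}"
        using has_integral_linear[OF is_primitive_increment[OF f] bounded_linear_left, of y z] yz
        by (simp add: o_def)
      ultimately have "((\<lambda>s. h (f y) (G s) + h (F s) (g z) - (h (f s) (G s) + h (F s) (g s))) has_integral
          (h (f y) (g z - g y) + h (f z - f y) (g z)
            - integral {y..z} (\<lambda>s. h (f s) (G s) + h (F s) (g s)))) {y..z}"
        using I by (intro has_integral_diff has_integral_add integrable_integral integrable_add)
      moreover have "h (f y) (g z - g y) + h (f z - f y) (g z) = h (f z) (g z) - h (f y) (g y)"
        by (simp add: diff_left diff_right)
      moreover have "h (f y) (G s) + h (F s) (g z) - (h (f s) (G s) + h (F s) (g s))
          = h (f y - f s) (G s) + h (F s) (g z - g s)" for s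
        by (simp add: diff_left diff_right)
      ultimately have D: "((\<lambda>s. h (f y - f s) (G s) + h (F s) (g z - g s)) has_integral
          (h (f z) (g z) - h (f y) (g y) - integral {y..z} (\<lambda>s. h (f s) (G s) + h (F s) (g s)))) {y..z}"
        by simp
      have "norm (integral {y..z} (\<lambda>s. h (f y - f s) (G s) + h (F s) (g z - g s)))
          \<le> integral {y..z} (\<lambda>s. e * (norm (F s) + norm (G s)))"
      proof (rule integral_norm_bound_integral)
        show "(\<lambda>s. h (f y - f s) (G s) + h (F s) (g z - g s)) integrable_on {y..z}"
          using D by blast
        show "(\<lambda>s. e * (norm (F s) + norm (G s))) integrable_on {y..z}"
          using I by (intro integrable_on_mult_right integrable_add)
        fix s assume s: "s \<in> {y..z}"
        have "norm (h (f y - f s) (G s)) \<le> 2 * e' * norm (G s) * K"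
          using K(1) nf[OF s] by (intro order_trans[OF K(2)] mult_right_mono) auto
        moreover have "norm (h (F s) (g z - g s)) \<le> norm (F s) * (2 * e') * K"
          using K(1) ng[OF s] by (intro order_trans[OF K(2)] mult_right_mono mult_left_mono) auto
        moreover have "2 * e' * K = e" using K(1) by (simp add: e'_def)
        then have "2 * e' * norm (G s) * K = e * norm (G s)" "norm (F s) * (2 * e') * K = e * norm (F s)"
          by (auto simp: algebra_simps)
        ultimately show "norm (h (f y - f s) (G s) + h (F s) (g z - g s)) \<le> e * (norm (F s) + norm (G s))"
          using norm_triangle_ineq[of "h (f y - f s) (G s)" "h (F s) (g z - g s)"]
          by (simp add: distrib_left)
      qed
      then show "norm (h (f z) (g z) - h (f y) (g y) - integral {y..z} (\<lambda>s. h (f s) (G s) + h (F s) (g s)))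
         \<le> e * integral {y..z} (\<lambda>s. norm (F s) + norm (G s))"
        using integral_unique[OF D] by simp
    qed
  qed
qed

text \<open>The mean value theorem gives a single \<open>w\<close> with increment
  \<open>psi' (f w) * (f z - f y)\<close>; replacing \<open>psi' (f w)\<close> by
  \<open>psi' (f s)\<close> under the integral costs only the oscillation of this continuous
  function near \<open>x\<close>.\<close>

lemma is_primitive_compose:
  fixes f F :: "real \<Rightarrow> real"
  assumes f: "is_primitive a b f F"
    and psi: "\<And>s. s \<in> {a..b} \<Longrightarrow> (psi has_real_derivative psi' (f s)) (at (f s))"
    and cont: "continuous_on {a..b} (\<lambda>s. psi' (f s))"
  shows "is_primitive a b (\<lambda>x. psi (f x)) (\<lambda>x. psi' (f x) * F x)"
proof -
  have contf: "continuous_on {a..b} f" using f by (rule is_primitive_continuous)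
  have FA: "F absolutely_integrable_on {a..b}" using f by (auto simp: is_primitive_def)
  note 1 = continuous_abs_integrable_product[OF bounded_bilinear_mult cont FA]
  show ?thesis
  proof (rule is_primitive_if_locally_small[where W = "\<lambda>s. norm (F s)", OF 1])
    show "(\<lambda>s. norm (F s)) absolutely_integrable_on {a..b}"
      using absolutely_integrable_norm[OF FA] by (simp add: o_def)
    fix e :: real and x assume e: "e > 0" and x: "x \<in> {a..b}"
    then have "\<exists>d>0. \<forall>y\<in>{a..b}. dist y x < d \<longrightarrow> dist (psi' (f y)) (psi' (f x)) < e / 2"
      by (intro cont[unfolded continuous_on_iff, rule_format]) simp_all
    then obtain d where d: "d > 0" "\<And>y. y \<in> {a..b} \<Longrightarrow> dist y x < d \<Longrightarrow> dist (psi' (f y)) (psi' (f x)) < e / 2"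
      by blast
    show "\<exists>d>0. \<forall>y z. a \<le> y \<and> y \<le> x \<and> x \<le> z \<and> z \<le> b \<and> z - y < d \<longrightarrow>
      norm (psi (f z) - psi (f y) - integral {y..z} (\<lambda>s. psi' (f s) * F s))
       \<le> e * integral {y..z} (\<lambda>s. norm (F s))"
    proof (intro exI[of _ d] conjI allI impI d(1))
      fix y z assume yz: "a \<le> y \<and> y \<le> x \<and> x \<le> z \<and> z \<le> b \<and> z - y < d"
      \<comment> \<open>\<open>psi\<close> is known to be differentiable only at values of
        \<open>f\<close>, so every number between \<open>f y\<close> and \<open>f z\<close> must be
        such a value before the mean value theorem applies.\<close>
      have img: "\<exists>w\<in>{y..z}. f w = v" if "v \<in> closed_segment (f y) (f z)" for v
      proof -
have "connected (f ` {y..z})"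
          using contf yz by (intro connected_continuous_image) (auto intro: continuous_on_subset)
        then have "convex (f ` {y..z})" by (metis is_interval_connected_1 is_interval_convex_1)
        then have "closed_segment (f y) (f z) \<subseteq> f ` {y..z}"
          using yz by (intro closed_segment_subset) auto
        then show ?thesis using that by auto
      qed
      have "\<exists>w\<in>{y..z}. psi (f z) - psi (f y) = psi' (f w) * (f z - f y)"
      proof (cases "f y = f z")
        case True
        then show ?thesis using yz by auto
      next
        case False
        have *: "\<exists>w\<in>{y..z}. psi v - psi u = psi' (f w) * (v - u)"
          if "u < v" "{u..v} \<subseteq> closed_segment (f y) (f z)" for u v
        proof -
          have "\<exists>D. (psi has_real_derivative D) (at r) \<and> (\<exists>w\<in>{y..z}. D = psi' (f w))" if "r \<in> {u..v}" for r
          proof -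
            obtain w where "w \<in> {y..z}" "f w = r" using img \<open>r \<in> {u..v}\<close> \<open>{u..v} \<subseteq> _\<close> by blast
            then show ?thesis using psi[of w] yz by (intro exI[of _ "psi' (f w)"]) auto
          qed
          then obtain D where D: "\<And>r. r \<in> {u..v} \<Longrightarrow> (psi has_real_derivative D r) (at r)"
            "\<And>r. r \<in> {u..v} \<Longrightarrow> \<exists>w\<in>{y..z}. D r = psi' (f w)" by metis
          have "\<exists>r. u < r \<and> r < v \<and> psi v - psi u = (v - u) * D r"
            using that D(1) by (intro MVT2) auto
          then show ?thesis using D(2) by (metis atLeastAtMost_iff less_imp_le mult.commute)
        qed
        show ?thesis
        proof (cases "f y < f z")
          case True
          then show ?thesis using *[of "f y" "f z"] by (simp add: closed_segment_eq_real_ivl)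
        next
          case F: False
          then obtain w where "w \<in> {y..z}" "psi (f y) - psi (f z) = psi' (f w) * (f y - f z)"
            using *[of "f z" "f y"] False by (auto simp: closed_segment_eq_real_ivl)
          then show ?thesis by (intro bexI[of _ w]) (auto simp: algebra_simps)
        qed
      qed
      then obtain w where w: "w \<in> {y..z}" "psi (f z) - psi (f y) = psi' (f w) * (f z - f y)" by blast
      have np: "\<bar>psi' (f w) - psi' (f s)\<bar> \<le> e" if "s \<in> {y..z}" for s
      proof -
        have "dist (psi' (f w)) (psi' (f x)) < e / 2" "dist (psi' (f s)) (psi' (f x)) < e / 2"
          using d yz w that by (auto simp: dist_real_def)
        then show ?thesis
          using dist_triangle2[of "psi' (f w)" "psi' (f s)" "psi' (f x)"] by (simp add: dist_real_def)
      qed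
      have A: "F absolutely_integrable_on {y..z}" "(\<lambda>s. psi' (f s) * F s) absolutely_integrable_on {y..z}"
        using FA 1 yz by (auto intro: absolutely_integrable_on_subinterval)
      then have I: "(\<lambda>s. psi' (f s) * F s) integrable_on {y..z}" "(\<lambda>s. norm (F s)) integrable_on {y..z}"
        by (auto simp: absolutely_integrable_on_def)
      have "((\<lambda>s. psi' (f w) * F s) has_integral psi' (f w) * (f z - f y)) {y..z}"
        using yz by (intro has_integral_mult_right is_primitive_increment[OF f]) auto
      then have "((\<lambda>s. psi' (f w) * F s - psi' (f s) * F s) has_integral
          (psi (f z) - psi (f y) - integral {y..z} (\<lambda>s. psi' (f s) * F s))) {y..z}"
        unfolding w(2) using I by (intro has_integral_diff integrable_integral)
      then have D: "((\<lambda>s. (psi' (f w) - psi' (f s)) * F s) has_integral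
          (psi (f z) - psi (f y) - integral {y..z} (\<lambda>s. psi' (f s) * F s))) {y..z}"
        by (simp add: left_diff_distrib)
      have "norm (integral {y..z} (\<lambda>s. (psi' (f w) - psi' (f s)) * F s))
          \<le> integral {y..z} (\<lambda>s. e * norm (F s))"
      proof (rule integral_norm_bound_integral)
        show "(\<lambda>s. (psi' (f w) - psi' (f s)) * F s) integrable_on {y..z}" using D by blast
        show "(\<lambda>s. e * norm (F s)) integrable_on {y..z}" using I by (intro integrable_on_mult_right)
        show "norm ((psi' (f w) - psi' (f s)) * F s) \<le> e * norm (F s)" if "s \<in> {y..z}" for s
          using np[OF that] by (auto simp: abs_mult intro!: mult_right_mono)
      qed
      then show "norm (psi (f z) - psi (f y) - integral {y..z} (\<lambda>s. psi' (f s) * F s))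
         \<le> e * integral {y..z} (\<lambda>s. norm (F s))"
        using integral_unique[OF D] by simp
    qed
  qed
qed


section \<open>Arc length derivatives of Sobolev functions\<close>

lemma has_weak_deriv_iff_is_primitive:
  "has_weak_deriv f g \<longleftrightarrow> g \<in> L2_circle \<and> is_primitive 0 (2 * pi) f g"
proof -
  have "g absolutely_integrable_on {0..2 * pi}" if "g \<in> L2_circle"
    using L2_circle_integrable[OF that]
    by (simp add: set_integrable_def integrable_restrict_space)
  then show ?thesis unfolding has_weak_deriv_def is_primitive_def by blast
qed

lemma has_weak_deriv_continuous: "has_weak_deriv f g \<Longrightarrow> continuous_on {0..2 * pi} f"
  by (auto simp: has_weak_deriv_iff_is_primitive intro: is_primitive_continuous)

lemma L2_circle_continuous_product:
  fixes f :: "real \<Rightarrow> 'a::euclidean_space" and G :: "real \<Rightarrow> 'b::euclidean_space"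
    and h :: "'a \<Rightarrow> 'b \<Rightarrow> 'c::euclidean_space"
  assumes h: "bounded_bilinear h" and f: "continuous_on {0..2 * pi} f" and G: "G \<in> L2_circle"
  shows "(\<lambda>x. h (f x) (G x)) \<in> L2_circle"
proof -
  obtain K where K: "K > 0" "\<And>x y. norm (h x y) \<le> norm x * norm y * K"
    using bounded_bilinear.pos_bounded[OF h] by blast
  have "bounded (f ` {0..2 * pi})"
    using f by (intro compact_imp_bounded compact_continuous_image) auto
  then obtain B where B: "B > 0" "\<And>x. x \<in> {0..2 * pi} \<Longrightarrow> norm (f x) \<le> B"
    by (auto simp: bounded_pos)
  have "G absolutely_integrable_on {0..2 * pi}"
    using L2_circle_integrable[OF G] by (simp add: set_integrable_def integrable_restrict_space)
  then have "(\<lambda>x. h (f x) (G x)) absolutely_integrable_on {0..2 * pi}"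
    by (rule continuous_abs_integrable_product[OF h f])
  then have "integrable circle (\<lambda>x. h (f x) (G x))"
    by (simp add: set_integrable_def integrable_restrict_space)
  then have m: "(\<lambda>x. h (f x) (G x)) \<in> borel_measurable circle" by auto
  moreover have "integrable circle (\<lambda>x. (norm (h (f x) (G x)))\<^sup>2)"
  proof (rule Bochner_Integration.integrable_bound)
    show "integrable circle (\<lambda>x. (B * K)\<^sup>2 * (norm (G x))\<^sup>2)"
      using G by (auto simp: L2_circle_def)
    show "(\<lambda>x. (norm (h (f x) (G x)))\<^sup>2) \<in> borel_measurable circle" using m by simp
    have "(norm (h (f x) (G x)))\<^sup>2 \<le> (B * K)\<^sup>2 * (norm (G x))\<^sup>2" if "x \<in> {0..2 * pi}" for x
    proof -
      have "norm (h (f x) (G x)) \<le> B * norm (G x) * K"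
        using K B(2)[OF that] by (intro order_trans[OF K(2)] mult_right_mono) auto
      then have "(norm (h (f x) (G x)))\<^sup>2 \<le> (B * norm (G x) * K)\<^sup>2" by (intro power_mono) auto
      then show ?thesis by (simp add: power_mult_distrib algebra_simps)
    qed
    then show "AE x in circle. norm ((norm (h (f x) (G x)))\<^sup>2) \<le> norm ((B * K)\<^sup>2 * (norm (G x))\<^sup>2)"
      by (intro AE_I2) (simp add: power_mult_distrib)
  qed
  ultimately show ?thesis by (simp add: L2_circle_def)
qed

text \<open>The factor \<open>1 / norm (c \<theta>)\<close> is the inverse square root of
  \<open>c \<theta> \<bullet> c \<theta>\<close>. The inner product is a product of primitives and
  the inverse square root is smooth on positive numbers, so product rule and chain rule
  suffice.\<close>

lemma has_weak_deriv_divide_norm: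
  fixes a A :: "real \<Rightarrow> 'a::euclidean_space" and c C :: "real \<Rightarrow> 'b::euclidean_space"
  assumes a: "has_weak_deriv a A" and c: "has_weak_deriv c C" and nz: "\<And>\<theta>. c \<theta> \<noteq> 0"
  shows "has_weak_deriv (\<lambda>\<theta>. a \<theta> /\<^sub>R norm (c \<theta>))
           (\<lambda>\<theta>. A \<theta> /\<^sub>R norm (c \<theta>) - ((c \<theta> \<bullet> C \<theta>) / norm (c \<theta>) ^ 3) *\<^sub>R a \<theta>)"
proof -
  define psi where "psi r = inverse (sqrt r)" for r :: real
  define psi' where "psi' r = - ((inverse (sqrt r)) ^ 3 / 2)" for r :: real
  have pos: "c \<theta> \<bullet> c \<theta> > 0" for \<theta> using nz by simp
  have contc: "continuous_on {0..2 * pi} c" and conta: "continuous_on {0..2 * pi} a"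
    using a c by (auto intro: has_weak_deriv_continuous)
  have A: "A \<in> L2_circle" "is_primitive 0 (2 * pi) a A" and C: "C \<in> L2_circle" "is_primitive 0 (2 * pi) c C"
    using a c by (auto simp: has_weak_deriv_iff_is_primitive)
  have cont: "continuous_on {0..2 * pi} (\<lambda>\<theta>. psi (c \<theta> \<bullet> c \<theta>))"
    "continuous_on {0..2 * pi} (\<lambda>\<theta>. psi' (c \<theta> \<bullet> c \<theta>))"
    unfolding psi_def psi'_def using contc nz by (auto intro!: continuous_intros)
  have "is_primitive 0 (2 * pi) (\<lambda>\<theta>. c \<theta> \<bullet> c \<theta>) (\<lambda>\<theta>. c \<theta> \<bullet> C \<theta> + C \<theta> \<bullet> c \<theta>)"
    by (intro is_primitive_prod bounded_bilinear_inner C)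
  then have "is_primitive 0 (2 * pi) (\<lambda>\<theta>. psi (c \<theta> \<bullet> c \<theta>)) (\<lambda>\<theta>. psi' (c \<theta> \<bullet> c \<theta>) * (c \<theta> \<bullet> C \<theta> + C \<theta> \<bullet> c \<theta>))"
  proof (rule is_primitive_compose)
    have "(psi has_real_derivative psi' r) (at r)" if "r > 0" for r
      unfolding psi_def psi'_def using that
      by (auto intro!: derivative_eq_intros simp: field_simps power3_eq_cube power2_eq_square)
    then show "(psi has_real_derivative psi' (c s \<bullet> c s)) (at (c s \<bullet> c s))" for s
      using pos by blast
  qed (fact cont)
  then have P: "is_primitive 0 (2 * pi) (\<lambda>\<theta>. psi (c \<theta> \<bullet> c \<theta>) *\<^sub>R a \<theta>)
      (\<lambda>\<theta>. psi (c \<theta> \<bullet> c \<theta>) *\<^sub>R A \<theta> + (psi' (c \<theta> \<bullet> c \<theta>) * (c \<theta> \<bullet> C \<theta> + C \<theta> \<bullet> c \<theta>)) *\<^sub>R a \<theta>)"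
    by (rule is_primitive_prod[OF bounded_bilinear_scaleR _ A(2)])
  have eq: "psi (c \<theta> \<bullet> c \<theta>) *\<^sub>R A \<theta> + (psi' (c \<theta> \<bullet> c \<theta>) * (c \<theta> \<bullet> C \<theta> + C \<theta> \<bullet> c \<theta>)) *\<^sub>R a \<theta>
      = A \<theta> /\<^sub>R norm (c \<theta>) - ((c \<theta> \<bullet> C \<theta>) / norm (c \<theta>) ^ 3) *\<^sub>R a \<theta>" for \<theta>
  proof -
    have "psi' (c \<theta> \<bullet> c \<theta>) * (c \<theta> \<bullet> C \<theta> + C \<theta> \<bullet> c \<theta>) = - ((c \<theta> \<bullet> C \<theta>) / norm (c \<theta>) ^ 3)"
      by (simp add: psi'_def norm_eq_sqrt_inner[symmetric] inner_commute[of "C \<theta>"] field_simps)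
    then show ?thesis by (simp add: psi_def norm_eq_sqrt_inner[symmetric])
  qed
  have "(\<lambda>\<theta>. psi (c \<theta> \<bullet> c \<theta>) *\<^sub>R A \<theta> + (psi' (c \<theta> \<bullet> c \<theta>) * (c \<theta> \<bullet> C \<theta> + C \<theta> \<bullet> c \<theta>)) *\<^sub>R a \<theta>) \<in> L2_circle"
  proof (rule L2_circle_add)
    show "(\<lambda>\<theta>. psi (c \<theta> \<bullet> c \<theta>) *\<^sub>R A \<theta>) \<in> L2_circle"
      by (rule L2_circle_continuous_product[OF bounded_bilinear_scaleR cont(1) A(1)])
    have "(\<lambda>\<theta>. c \<theta> \<bullet> C \<theta>) \<in> L2_circle"
      by (rule L2_circle_continuous_product[OF bounded_bilinear_inner contc C(1)])
    then have "(\<lambda>\<theta>. c \<theta> \<bullet> C \<theta> + C \<theta> \<bullet> c \<theta>) \<in> L2_circle"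
      using L2_circle_add[of "\<lambda>\<theta>. c \<theta> \<bullet> C \<theta>" "\<lambda>\<theta>. c \<theta> \<bullet> C \<theta>"] by (simp add: inner_commute)
    then have "(\<lambda>\<theta>. psi' (c \<theta> \<bullet> c \<theta>) * (c \<theta> \<bullet> C \<theta> + C \<theta> \<bullet> c \<theta>)) \<in> L2_circle"
      by (rule L2_circle_continuous_product[OF bounded_bilinear_mult cont(2)])
    then show "(\<lambda>\<theta>. (psi' (c \<theta> \<bullet> c \<theta>) * (c \<theta> \<bullet> C \<theta> + C \<theta> \<bullet> c \<theta>)) *\<^sub>R a \<theta>) \<in> L2_circle"
      by (rule L2_circle_continuous_product[OF bounded_bilinear.flip[OF bounded_bilinear_scaleR] conta])
  qed
  with P show ?thesis
    unfolding has_weak_deriv_iff_is_primitive eq by (simp add: psi_def norm_eq_sqrt_inner)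
qed

lemma Ds_weak_deriv:
  assumes "c \<in> immersions" "has_weak_deriv (\<theta>_deriv (H2_fun c)) C" "has_weak_deriv (\<theta>_deriv (H2_fun h)) H"
  shows "has_weak_deriv (Ds c h) (\<lambda>\<theta>. H \<theta> /\<^sub>R norm (\<theta>_deriv (H2_fun c) \<theta>)
       - ((\<theta>_deriv (H2_fun c) \<theta> \<bullet> C \<theta>) / norm (\<theta>_deriv (H2_fun c) \<theta>) ^ 3) *\<^sub>R \<theta>_deriv (H2_fun h) \<theta>)"
  unfolding Ds_def using assms by (intro has_weak_deriv_divide_norm) (auto simp: immersions_def)

text \<open>This membership is what makes the choice in \<open>weak_deriv (Ds c h)\<close>, and
  hence \<open>Ds2\<close>, an actual derivative instead of an arbitrary function.\<close>

lemma Ds_H1: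
  assumes "c \<in> immersions"
  shows "Ds c h \<in> H1_circle"
proof -
  have "periodic (\<theta>_deriv (H2_fun c))" "periodic (\<theta>_deriv (H2_fun h))"
    using H2_fun_deriv_H1[of c] H2_fun_deriv_H1[of h] by (auto simp: H1_circle_def)
  then have "periodic (Ds c h)" by (simp add: Ds_def periodic_fun_simple_def)
  then show ?thesis
    using Ds_weak_deriv[OF assms has_weak_deriv_weak_deriv[OF H2_fun_deriv_H1]
        has_weak_deriv_weak_deriv[OF H2_fun_deriv_H1]]
    by (auto simp: H1_circle_def)
qed

lemma weak_deriv_Ds_AE:
  assumes "c \<in> immersions" "has_weak_deriv (\<theta>_deriv (H2_fun c)) C" "has_weak_deriv (\<theta>_deriv (H2_fun h)) H"
  shows "AE \<theta> in circle. weak_deriv (Ds c h) \<theta> = H \<theta> /\<^sub>R norm (\<theta>_deriv (H2_fun c) \<theta>)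
       - ((\<theta>_deriv (H2_fun c) \<theta> \<bullet> C \<theta>) / norm (\<theta>_deriv (H2_fun c) \<theta>) ^ 3) *\<^sub>R \<theta>_deriv (H2_fun h) \<theta>"
  using assms by (intro has_weak_deriv_unique[OF has_weak_deriv_weak_deriv[OF Ds_H1] Ds_weak_deriv])

section \<open>Variation of the length\<close>

lemma H2_fun_deriv_continuous: "continuous_on {0..2 * pi} (\<theta>_deriv (H2_fun c))"
  using has_weak_deriv_weak_deriv[OF H2_fun_deriv_H1] by (rule has_weak_deriv_continuous)

lemma integrable_circle_continuous:
  fixes f :: "real \<Rightarrow> real"
  shows "continuous_on {0..2 * pi} f \<Longrightarrow> integrable circle f"
  by (rule continuous_imp_integrable_real)

lemma speed_bounded_below:
  assumes "c \<in> immersions"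
  obtains m where "m > 0" "\<And>\<theta>. \<theta> \<in> {0..2 * pi} \<Longrightarrow> m \<le> norm (\<theta>_deriv (H2_fun c) \<theta>)"
proof -
  have "\<exists>\<theta>\<in>{0..2 * pi}. \<forall>\<phi>\<in>{0..2 * pi}. norm (\<theta>_deriv (H2_fun c) \<theta>) \<le> norm (\<theta>_deriv (H2_fun c) \<phi>)"
    by (intro continuous_attains_inf continuous_intros H2_fun_deriv_continuous) auto
  then obtain \<theta> where "\<forall>\<phi>\<in>{0..2 * pi}. norm (\<theta>_deriv (H2_fun c) \<theta>) \<le> norm (\<theta>_deriv (H2_fun c) \<phi>)"
    by blast
  then show ?thesis
    using assms by (intro that[of "norm (\<theta>_deriv (H2_fun c) \<theta>)"]) (auto simp: immersions_def)
qed

lemma circle_integral_const: "(\<integral>\<theta>. r \<partial>circle) = 2 * pi * (r::real)"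
  by (simp add: measure_restrict_space)

lemma circle_integral_mono:
  fixes f g :: "real \<Rightarrow> real"
  assumes "integrable circle f" "integrable circle g" "\<And>\<theta>. \<theta> \<in> {0..2 * pi} \<Longrightarrow> f \<theta> \<le> g \<theta>"
  shows "integral\<^sup>L circle f \<le> integral\<^sup>L circle g"
  using assms by (intro integral_mono) auto

lemma curve_length_integrable: "integrable circle (\<lambda>\<theta>. norm (\<theta>_deriv (H2_fun c) \<theta>))"
  by (intro integrable_circle_continuous continuous_intros H2_fun_deriv_continuous)

lemma curve_length_pos:
  assumes "c \<in> immersions"
  shows "curve_length c > 0"
proof -
  obtain m where m: "m > 0" "\<And>\<theta>. \<theta> \<in> {0..2 * pi} \<Longrightarrow> m \<le> norm (\<theta>_deriv (H2_fun c) \<theta>)"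
    using speed_bounded_below[OF assms] by metis
  have "0 < 2 * pi * m" using m by simp
  also have "\<dots> = (\<integral>\<theta>. m \<partial>circle)" by (rule circle_integral_const[symmetric])
  also have "\<dots> \<le> curve_length c"
    unfolding curve_length_def
    by (intro circle_integral_mono curve_length_integrable m(2) integrable_circle_continuous) auto
  finally show ?thesis .
qed

text \<open>Cauchy-Schwarz for \<open>v\<close> and \<open>v + w\<close> makes the remainder
  nonnegative; the square of \<open>norm (v + w) - norm v\<close> being nonnegative bounds it from
  above. Only \<open>norm v\<close> occurs in the denominator, so \<open>w\<close> may be of any
  size.\<close>

lemma norm_add_second_order:
  fixes v w :: "'a::real_inner"
  assumes "v \<noteq> 0"
  shows "\<bar>norm (v + w) - norm v - (v \<bullet> w) / norm v\<bar> \<le> (norm w)\<^sup>2 / (2 * norm v)"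
proof -
  let ?n = "norm v" and ?k = "norm (v + w)"
  have n: "?n > 0" using assms by simp
  have sq: "?k\<^sup>2 = ?n\<^sup>2 + 2 * (v \<bullet> w) + (norm w)\<^sup>2"
    by (simp add: power2_norm_eq_inner inner_add_left inner_add_right inner_commute)
  have "?n\<^sup>2 + v \<bullet> w = v \<bullet> (v + w)" by (simp add: power2_norm_eq_inner inner_add_right)
  also have "\<dots> \<le> ?n * ?k" by (rule norm_cauchy_schwarz)
  finally have 1: "0 \<le> ?n * ?k - ?n\<^sup>2 - v \<bullet> w" by simp
  have "0 \<le> (?k - ?n)\<^sup>2" by simp
  then have 2: "2 * (?n * ?k - ?n\<^sup>2 - v \<bullet> w) \<le> (norm w)\<^sup>2"
    using sq by (simp add: power2_diff algebra_simps)
  have "?k - ?n - (v \<bullet> w) / ?n = (?n * ?k - ?n\<^sup>2 - v \<bullet> w) / ?n"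
    using n by (simp add: field_simps power2_eq_square)
  moreover have "0 \<le> (?n * ?k - ?n\<^sup>2 - v \<bullet> w) / ?n"
    using 1 n by (intro divide_nonneg_pos)
  moreover have "(?n * ?k - ?n\<^sup>2 - v \<bullet> w) / ?n \<le> (norm w)\<^sup>2 / (2 * ?n)"
    using 2 n divide_right_mono[of "?n * ?k - ?n\<^sup>2 - v \<bullet> w" "(norm w)\<^sup>2 / 2" ?n] by simp
  ultimately show ?thesis by linarith
qed

text \<open>The first variation of length, the integral of the inner product of \<open>D_s c\<close>
  and \<open>D_s h\<close> with respect to arc length: the two factors \<open>1 / |c'|\<close> and
  the density \<open>|c'|\<close> leave a single division.\<close>

definition length_variation :: "('a::euclidean_space) H2 \<Rightarrow> 'a H2 \<Rightarrow> real" where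
  "length_variation c h = (\<integral>\<theta>. (\<theta>_deriv (H2_fun c) \<theta> \<bullet> \<theta>_deriv (H2_fun h) \<theta>) / norm (\<theta>_deriv (H2_fun c) \<theta>) \<partial>circle)"

lemma length_variation_integrable:
  assumes "c \<in> immersions"
  shows "integrable circle (\<lambda>\<theta>. (\<theta>_deriv (H2_fun c) \<theta> \<bullet> \<theta>_deriv (H2_fun h) \<theta>) / norm (\<theta>_deriv (H2_fun c) \<theta>))"
  using assms
  by (intro integrable_circle_continuous continuous_intros H2_fun_deriv_continuous) (auto simp: immersions_def)

lemma integral_deriv_sq_le: "(\<integral>\<theta>. (norm (\<theta>_deriv (H2_fun h) \<theta>))\<^sup>2 \<partial>circle) \<le> (norm h)\<^sup>2"
  unfolding power2_norm_eq_inner inner_H2_def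
  by (intro circle_integral_mono Bochner_Integration.integrable_add integrable_inner_H2) auto

lemma length_variation_le:
  assumes "c \<in> immersions"
  shows "\<bar>length_variation c h\<bar> \<le> (\<integral>\<theta>. norm (\<theta>_deriv (H2_fun h) \<theta>) \<partial>circle)"
proof -
  let ?c = "\<theta>_deriv (H2_fun c)" and ?h = "\<theta>_deriv (H2_fun h)"
  have "norm (length_variation c h) \<le> (\<integral>\<theta>. norm ((?c \<theta> \<bullet> ?h \<theta>) / norm (?c \<theta>)) \<partial>circle)"
    unfolding length_variation_def by (rule integral_norm_bound)
  also have "\<dots> \<le> (\<integral>\<theta>. norm (?h \<theta>) \<partial>circle)"
  proof (rule circle_integral_mono)
    fix \<theta>
    have "norm (?c \<theta>) > 0" using assms by (simp add: immersions_def)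
    then show "norm ((?c \<theta> \<bullet> ?h \<theta>) / norm (?c \<theta>)) \<le> norm (?h \<theta>)"
      using Cauchy_Schwarz_ineq2[of "?c \<theta>" "?h \<theta>"] by (simp add: pos_divide_le_eq mult.commute)
  qed (intro integrable_norm length_variation_integrable[OF assms] curve_length_integrable)+
  finally show ?thesis by simp
qed

text \<open>The second order remainder of the norm integrates to at most
  \<open>(norm (y - c))\<^sup>2 / (2 * m)\<close> with \<open>m\<close> a lower bound for the speed
  of \<open>c\<close>, which dictates the radius \<open>e * (2 * m)\<close>.\<close>

lemma curve_length_has_derivative:
  assumes c: "c \<in> immersions"
  shows "(curve_length has_derivative length_variation c) (at c)"
  unfolding has_derivative_at_alt
proof (intro conjI allI impI)
  let ?c = "\<theta>_deriv (H2_fun c)"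
  show "bounded_linear (length_variation c)"
  proof (rule bounded_linear_intro)
    show "length_variation c (x + y) = length_variation c x + length_variation c y" for x y
      unfolding length_variation_def fun_cong[OF H2_fun_deriv_plus] inner_add_right add_divide_distrib
      by (intro Bochner_Integration.integral_add length_variation_integrable c)
    show "length_variation c (r *\<^sub>R x) = r *\<^sub>R length_variation c x" for r x
      unfolding length_variation_def fun_cong[OF H2_fun_deriv_scaleR] inner_scaleR_right
      by (simp flip: times_divide_eq_right)
    fix h :: "'a H2"
    let ?h = "\<theta>_deriv (H2_fun h)"
    have "(\<integral>\<theta>. norm (?h \<theta>) \<partial>circle) \<le> norm h * (pi + 1)"
    proof (cases "norm h = 0")
      case True
      then show ?thesis by (simp add: zero_H2_circle H2_fun_zero)
    next
      case False
      then have n: "norm h > 0" by simp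
      \<comment> \<open>The inequality between arithmetic and geometric mean with weight
        \<open>norm h\<close> compares the integral of the norm with that of its square; the result
        is linear in \<open>norm h\<close>.\<close>
      have "(\<integral>\<theta>. norm (?h \<theta>) \<partial>circle) \<le> (\<integral>\<theta>. norm h / 2 + (norm (?h \<theta>))\<^sup>2 / (2 * norm h) \<partial>circle)"
      proof (rule circle_integral_mono)
        fix \<theta>
        have "0 \<le> (norm h - norm (?h \<theta>))\<^sup>2" by simp
        then have "norm (?h \<theta>) * (2 * norm h) \<le> (norm h)\<^sup>2 + (norm (?h \<theta>))\<^sup>2"
          by (simp add: power2_diff algebra_simps)
        then show "norm (?h \<theta>) \<le> norm h / 2 + (norm (?h \<theta>))\<^sup>2 / (2 * norm h)"
          using n by (simp add: field_simps power2_eq_square)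
      qed (use n in \<open>auto intro!: integrable_circle_continuous continuous_intros H2_fun_deriv_continuous\<close>)
      also have "\<dots> = pi * norm h + (\<integral>\<theta>. (norm (?h \<theta>))\<^sup>2 \<partial>circle) / (2 * norm h)"
        using n by (subst Bochner_Integration.integral_add)
          (auto simp: measure_restrict_space intro!: integrable_circle_continuous continuous_intros H2_fun_deriv_continuous)
      also have "\<dots> \<le> pi * norm h + (norm h)\<^sup>2 / (2 * norm h)"
        using n by (intro add_left_mono divide_right_mono integral_deriv_sq_le) auto
      also have "\<dots> \<le> norm h * (pi + 1)"
        using n by (simp add: power2_eq_square field_simps)
      finally show ?thesis .
    qed
    then show "norm (length_variation c h) \<le> norm h * (pi + 1)"
      using length_variation_le[OF c, of h] by simp
  qed
  fix e :: real assume e: "e > 0"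
  obtain m where m: "m > 0" "\<And>\<theta>. \<theta> \<in> {0..2 * pi} \<Longrightarrow> m \<le> norm (?c \<theta>)"
    using speed_bounded_below[OF c] by metis
  show "\<exists>d>0. \<forall>y. norm (y - c) < d \<longrightarrow>
      norm (curve_length y - curve_length c - length_variation c (y - c)) \<le> e * norm (y - c)"
  proof (intro exI[of _ "e * (2 * m)"] conjI allI impI)
    show "0 < e * (2 * m)" using e m by simp
    fix y assume y: "norm (y - c) < e * (2 * m)"
    let ?h = "\<theta>_deriv (H2_fun (y - c))"
    have yc: "\<theta>_deriv (H2_fun y) \<theta> = ?c \<theta> + ?h \<theta>" for \<theta>
      using fun_cong[OF H2_fun_deriv_plus[of c "y - c"], of \<theta>] by simp
    have *: "curve_length y - curve_length c - length_variation c (y - c)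
        = (\<integral>\<theta>. norm (?c \<theta> + ?h \<theta>) - norm (?c \<theta>) - (?c \<theta> \<bullet> ?h \<theta>) / norm (?c \<theta>) \<partial>circle)"
      unfolding curve_length_def length_variation_def yc[symmetric]
      by (subst Bochner_Integration.integral_diff | intro Bochner_Integration.integrable_diff
          curve_length_integrable length_variation_integrable c refl)+
    have "norm (curve_length y - curve_length c - length_variation c (y - c))
        \<le> (\<integral>\<theta>. norm (norm (?c \<theta> + ?h \<theta>) - norm (?c \<theta>) - (?c \<theta> \<bullet> ?h \<theta>) / norm (?c \<theta>)) \<partial>circle)"
      unfolding * by (rule integral_norm_bound)
    also have "\<dots> \<le> (\<integral>\<theta>. (norm (?h \<theta>))\<^sup>2 / (2 * m) \<partial>circle)"
    proof (rule circle_integral_mono)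
      fix \<theta> :: real assume \<theta>: "\<theta> \<in> {0..2 * pi}"
      have "norm (norm (?c \<theta> + ?h \<theta>) - norm (?c \<theta>) - (?c \<theta> \<bullet> ?h \<theta>) / norm (?c \<theta>)) \<le> (norm (?h \<theta>))\<^sup>2 / (2 * norm (?c \<theta>))"
        using norm_add_second_order[of "?c \<theta>" "?h \<theta>"] c by (simp add: immersions_def)
      also have "\<dots> \<le> (norm (?h \<theta>))\<^sup>2 / (2 * m)"
        using m(1) m(2)[OF \<theta>] by (intro divide_left_mono mult_pos_pos) auto
      finally show "norm (norm (?c \<theta> + ?h \<theta>) - norm (?c \<theta>) - (?c \<theta> \<bullet> ?h \<theta>) / norm (?c \<theta>)) \<le> (norm (?h \<theta>))\<^sup>2 / (2 * m)" .
    next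
      show "integrable circle (\<lambda>\<theta>. norm (norm (?c \<theta> + ?h \<theta>) - norm (?c \<theta>) - (?c \<theta> \<bullet> ?h \<theta>) / norm (?c \<theta>)))"
        using c by (intro integrable_circle_continuous continuous_intros H2_fun_deriv_continuous)
          (auto simp: immersions_def)
      show "integrable circle (\<lambda>\<theta>. (norm (?h \<theta>))\<^sup>2 / (2 * m))"
        using m(1) by (intro integrable_circle_continuous continuous_intros H2_fun_deriv_continuous) auto
    qed
    also have "\<dots> = (\<integral>\<theta>. (norm (?h \<theta>))\<^sup>2 \<partial>circle) / (2 * m)" by simp
    also have "\<dots> \<le> (norm (y - c))\<^sup>2 / (2 * m)"
      using m(1) by (intro divide_right_mono integral_deriv_sq_le) auto
    also have "\<dots> \<le> e * norm (y - c)"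
    proof -
      have "norm (y - c) * norm (y - c) \<le> (e * (2 * m)) * norm (y - c)"
        using y by (intro mult_right_mono) auto
      then show ?thesis using m(1) by (simp add: field_simps power2_eq_square)
    qed
    finally show "norm (curve_length y - curve_length c - length_variation c (y - c)) \<le> e * norm (y - c)" .
  qed
qed

section \<open>Control of the length variation by the metric\<close>

lemma Ds2_sq_integrable:
  assumes c: "c \<in> immersions"
  shows "integrable circle (\<lambda>\<theta>. (Ds2 c h \<theta> \<bullet> Ds2 c h \<theta>) * norm (\<theta>_deriv (H2_fun c) \<theta>))"
proof -
  let ?c = "\<theta>_deriv (H2_fun c)"
  have nz: "?c \<theta> \<noteq> 0" for \<theta> using c by (simp add: immersions_def)
  \<comment> \<open>Two factors \<open>1 / |c'|\<close> from \<open>Ds2\<close> and one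
    \<open>|c'|\<close> from the arc length leave \<open>1 / |c'|\<close>, whose square root is the
    continuous weight.\<close>
  have "(\<lambda>\<theta>. (inverse (sqrt (norm (?c \<theta>)))) *\<^sub>R weak_deriv (Ds c h) \<theta>) \<in> L2_circle"
    using nz by (intro L2_circle_continuous_product[OF bounded_bilinear_scaleR] continuous_intros
        H2_fun_deriv_continuous weak_deriv_L2 Ds_H1 c) auto
  then have "integrable circle (\<lambda>\<theta>. (norm ((inverse (sqrt (norm (?c \<theta>)))) *\<^sub>R weak_deriv (Ds c h) \<theta>))\<^sup>2)"
    by (simp add: L2_circle_def)
  moreover have "(norm ((inverse (sqrt (norm (?c \<theta>)))) *\<^sub>R weak_deriv (Ds c h) \<theta>))\<^sup>2
      = (Ds2 c h \<theta> \<bullet> Ds2 c h \<theta>) * norm (?c \<theta>)" for \<theta>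
    using nz[of \<theta>]
    by (simp add: Ds2_def power_mult_distrib power2_norm_eq_inner[symmetric] power_inverse
        field_simps power2_eq_square)
  ultimately show ?thesis by simp
qed

lemma sobolev_metric_eq:
  assumes c: "c \<in> immersions"
  shows "sobolev_metric p q c h h =
      curve_length c powr q * (\<integral>\<theta>. (H2_fun h \<theta> \<bullet> H2_fun h \<theta>) * norm (\<theta>_deriv (H2_fun c) \<theta>) \<partial>circle)
    + curve_length c powr p * (\<integral>\<theta>. (Ds2 c h \<theta> \<bullet> Ds2 c h \<theta>) * norm (\<theta>_deriv (H2_fun c) \<theta>) \<partial>circle)"
proof -
  have "integrable circle (\<lambda>\<theta>. (H2_fun h \<theta> \<bullet> H2_fun h \<theta>) * norm (\<theta>_deriv (H2_fun c) \<theta>))"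
    by (intro integrable_circle_continuous continuous_intros H2_fun_continuous H2_fun_deriv_continuous)
  then show ?thesis
    using Ds2_sq_integrable[OF c, of h]
    by (simp add: sobolev_metric_def distrib_right mult.assoc)
qed

text \<open>
  Since \<open>Ds c h\<close> has mean zero with respect to arc length, it is bounded by the total variation
  of \<open>Ds c h\<close>, which Cauchy-Schwarz compares with the second order part of the metric.
\<close>

lemma length_variation_le_sobolev_metric:
  assumes c: "c \<in> immersions"
  shows "curve_length c powr ((p - 3) / 2) * \<bar>length_variation c h\<bar> \<le> sqrt (sobolev_metric p q c h h)"
proof -
  let ?c = "\<theta>_deriv (H2_fun c)" and ?h = "\<theta>_deriv (H2_fun h)" and ?w = "Ds c h"
  define l where "l = curve_length c"
  define W where "W = (\<integral>\<theta>. (Ds2 c h \<theta> \<bullet> Ds2 c h \<theta>) * norm (?c \<theta>) \<partial>circle)"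
  define V where "V = (\<integral>\<theta>. norm (weak_deriv ?w \<theta>) \<partial>circle)"
  have l: "l > 0" using curve_length_pos[OF c] by (simp add: l_def)
  have nz: "norm (?c \<theta>) > 0" for \<theta> using c by (simp add: immersions_def)
  have w: "weak_deriv ?w \<in> L2_circle" "is_primitive 0 (2 * pi) ?w (weak_deriv ?w)"
    using has_weak_deriv_weak_deriv[OF Ds_H1[OF c]] by (auto simp: has_weak_deriv_iff_is_primitive)
  have wi: "integrable circle (\<lambda>\<theta>. norm (weak_deriv ?w \<theta>))"
    using L2_circle_integrable[OF w(1)] by simp
  have contw: "continuous_on {0..2 * pi} ?w" using w(2) by (rule is_primitive_continuous)
  have W0: "W \<ge> 0" unfolding W_def by (intro Bochner_Integration.integral_nonneg) auto
  have V0: "V \<ge> 0" unfolding V_def by (intro Bochner_Integration.integral_nonneg) auto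
  have osc: "norm (?w x - ?w y) \<le> V" if "x \<in> {0..2 * pi}" "y \<in> {0..2 * pi}" for x y
  proof -
    have *: "norm (?w z - ?w y) \<le> V" if "0 \<le> y" "y \<le> z" "z \<le> 2 * pi" for y z
    proof -
      have ni: "(\<lambda>\<theta>. norm (weak_deriv ?w \<theta>)) integrable_on {0..2 * pi}"
        using w(2) by (simp add: is_primitive_def absolutely_integrable_on_def)
      then have ni': "(\<lambda>\<theta>. norm (weak_deriv ?w \<theta>)) integrable_on {y..z}"
        using that by (auto intro: integrable_subinterval_real)
      have hi: "(weak_deriv ?w has_integral (?w z - ?w y)) {y..z}"
        using that by (intro is_primitive_increment[OF w(2)])
      have "norm (?w z - ?w y) \<le> integral {y..z} (\<lambda>\<theta>. norm (weak_deriv ?w \<theta>))"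
        using integral_norm_bound_integral[OF _ ni', of "weak_deriv ?w"] hi
        by (auto simp: integral_unique)
      also have "\<dots> \<le> integral {0..2 * pi} (\<lambda>\<theta>. norm (weak_deriv ?w \<theta>))"
        using that ni ni' by (intro integral_subset_le) auto
      also have "\<dots> = V"
        unfolding V_def using wi by (simp add: lebesgue_integral_eq_integral)
      finally show ?thesis .
    qed
    show ?thesis
      using *[of x y] *[of y x] that by (cases "x \<le> y") (auto simp: norm_minus_commute)
  qed
  \<comment> \<open>The arc length integral of \<open>D_s h\<close> is the integral of
    \<open>h'\<close> over a period, which vanishes.\<close>
  have mean: "((\<lambda>\<theta>. norm (?c \<theta>) *\<^sub>R ?w \<theta>) has_integral 0) {0..2 * pi}"
  proof -
    have "norm (?c \<theta>) *\<^sub>R ?w \<theta> = ?h \<theta>" for \<theta>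
      using nz[of \<theta>] by (simp add: Ds_def)
    moreover have "(?h has_integral H2_fun h (2 * pi) - H2_fun h 0) {0..2 * pi}"
    proof (rule fundamental_theorem_of_calculus)
      fix x
      have "H2_fun h differentiable at x" using H2_fun[of h] by (simp add: H2_circle_def)
      then show "(H2_fun h has_vector_derivative ?h x) (at x within {0..2 * pi})"
        using has_vector_derivative_at_within vector_derivative_works by blast
    qed simp
    moreover have "H2_fun h (2 * pi) = H2_fun h 0"
    proof -
      have "periodic (H2_fun h)" using H2_fun[of h] by (simp add: H2_circle_def)
      from this[unfolded periodic_fun_simple_def, rule_format, of 0] show ?thesis by simp
    qed
    ultimately show ?thesis by simp
  qed
  have sup: "norm (?w x) \<le> V" if x: "x \<in> {0..2 * pi}" for x
  proof -
    have len: "((\<lambda>\<theta>. norm (?c \<theta>)) has_integral l) {0..2 * pi}"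
      using has_integral_integral_lebesgue_on[OF curve_length_integrable[of c]]
      by (simp add: l_def curve_length_def)
    have "((\<lambda>\<theta>. norm (?c \<theta>) *\<^sub>R ?w x) has_integral l *\<^sub>R ?w x) {0..2 * pi}"
      using has_integral_linear[OF len bounded_linear_scaleR_left] by (simp add: o_def)
    from has_integral_diff[OF this mean]
    have 1: "((\<lambda>\<theta>. norm (?c \<theta>) *\<^sub>R (?w x - ?w \<theta>)) has_integral l *\<^sub>R ?w x) {0..2 * pi}"
      by (simp add: scaleR_diff_right)
    have 2: "((\<lambda>\<theta>. norm (?c \<theta>) * V) has_integral l * V) {0..2 * pi}"
      by (intro has_integral_mult_left len)
    have "norm (integral {0..2 * pi} (\<lambda>\<theta>. norm (?c \<theta>) *\<^sub>R (?w x - ?w \<theta>)))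
        \<le> integral {0..2 * pi} (\<lambda>\<theta>. norm (?c \<theta>) * V)"
      using 1 2 by (intro integral_norm_bound_integral) (auto intro!: mult_left_mono osc[OF x])
    then have "norm (l *\<^sub>R ?w x) \<le> l * V"
      unfolding integral_unique[OF 1] integral_unique[OF 2] .
    then show ?thesis using l by simp
  qed
  have "\<bar>length_variation c h\<bar> \<le> (\<integral>\<theta>. norm (?h \<theta>) \<partial>circle)" by (rule length_variation_le[OF c])
  also have "\<dots> \<le> (\<integral>\<theta>. V * norm (?c \<theta>) \<partial>circle)"
  proof (rule circle_integral_mono)
    fix \<theta> :: real assume "\<theta> \<in> {0..2 * pi}"
    from sup[OF this] show "norm (?h \<theta>) \<le> V * norm (?c \<theta>)"
      using nz[of \<theta>] by (simp add: Ds_def field_simps)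
  qed (use curve_length_integrable in auto)
  also have "\<dots> = V * l" by (simp add: l_def curve_length_def)
  finally have L: "\<bar>length_variation c h\<bar> \<le> V * l" .
  have "V\<^sup>2 \<le> l * W"
  proof (cases "V = 0")
    case False
    then have V: "V > 0" using V0 by simp
    \<comment> \<open>Cauchy-Schwarz is used as the weighted inequality
      \<open>2 * d \<le> s + d\<^sup>2 / s\<close>. With this weight \<open>s * l\<close> equals
      \<open>V\<close> and cancels one of the two copies of \<open>V\<close>, leaving
      \<open>V\<^sup>2 \<le> l * W\<close>.\<close>
    define s where "s = V / l"
    have s: "s > 0" using V l by (simp add: s_def)
    have "2 * V = (\<integral>\<theta>. 2 * norm (weak_deriv ?w \<theta>) \<partial>circle)" by (simp add: V_def)
    also have "\<dots> \<le> (\<integral>\<theta>. s * norm (?c \<theta>) + (Ds2 c h \<theta> \<bullet> Ds2 c h \<theta>) * norm (?c \<theta>) / s \<partial>circle)"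
    proof (rule circle_integral_mono)
      fix \<theta>
      let ?n = "norm (?c \<theta>)" and ?d = "norm (Ds2 c h \<theta>)"
      have "0 \<le> (s - ?d)\<^sup>2 * ?n / s" using s nz[of \<theta>] by (intro divide_nonneg_pos mult_nonneg_nonneg) auto
      moreover have "norm (weak_deriv ?w \<theta>) = ?d * ?n" using nz[of \<theta>] by (simp add: Ds2_def)
      ultimately show "2 * norm (weak_deriv ?w \<theta>) \<le> s * ?n + (Ds2 c h \<theta> \<bullet> Ds2 c h \<theta>) * ?n / s"
        using s by (simp add: power2_norm_eq_inner[symmetric] power2_diff field_simps power2_eq_square)
    next
      show "integrable circle (\<lambda>\<theta>. s * norm (?c \<theta>) + (Ds2 c h \<theta> \<bullet> Ds2 c h \<theta>) * norm (?c \<theta>) / s)"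
        using Ds2_sq_integrable[OF c, of h] curve_length_integrable[of c] by auto
    qed (use wi in auto)
    also have "\<dots> = s * l + W / s"
      using Ds2_sq_integrable[OF c, of h] curve_length_integrable[of c]
      by (simp add: l_def curve_length_def W_def)
    also have "\<dots> = V + W * l / V" using l V by (simp add: s_def)
    finally have "V \<le> W * l / V" by simp
    then show ?thesis using V by (simp add: field_simps power2_eq_square)
  qed (use W0 l in simp)
  then have V: "V \<le> sqrt (l * W)" by (rule real_le_rsqrt)
  have "l powr ((p - 3) / 2) * \<bar>length_variation c h\<bar> \<le> l powr ((p - 3) / 2) * (sqrt (l * W) * l)"
    using L V l by (intro mult_left_mono order_trans[OF L] mult_right_mono) auto
  also have "\<dots> = (l powr ((p - 3) / 2) * l powr (1/2) * l powr 1) * sqrt W"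
    using l by (simp add: real_sqrt_mult powr_half_sqrt)
  \<comment> \<open>Exponent count: 1/2 comes from Cauchy-Schwarz and 1 from integrating the
    supremum bound over the curve. This is the origin of \<open>(p - 3) / 2\<close>, which completes
    them to \<open>p / 2\<close>, the square root of the weight in the metric.\<close>
  also have "l powr ((p - 3) / 2) * l powr (1/2) * l powr 1 = l powr (p / 2)"
  proof -
    have "p / 2 = (p - 3) / 2 + 1 / 2 + 1" by (simp add: field_simps)
    then show ?thesis by (simp only: powr_add)
  qed
  also have "l powr (p / 2) * sqrt W = sqrt (l powr p * W)"
    using l by (simp add: real_sqrt_mult powr_half_sqrt[symmetric] powr_powr)
  also have "\<dots> \<le> sqrt (sobolev_metric p q c h h)"
    unfolding sobolev_metric_eq[OF c] W_def[symmetric] l_def[symmetric]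
    by (intro real_sqrt_le_mono) (auto intro!: mult_nonneg_nonneg Bochner_Integration.integral_nonneg)
  finally show ?thesis by (simp add: l_def)
qed

section \<open>The length along paths\<close>

text \<open>Around a point that is neither an end point nor a break point a small closed interval
  avoids all of these, and the derivative within that interval is two-sided at its centre.\<close>

lemma piecewise_smooth_path_has_vector_derivative:
  assumes "piecewise_smooth_path \<gamma>"
  obtains K where "finite K"
    "\<And>t. t \<in> {0<..<1} - K \<Longrightarrow> (\<gamma> has_vector_derivative vector_derivative \<gamma> (at t)) (at t)"
proof -
  obtain K where K: "finite K"
    "\<And>a b. 0 \<le> a \<Longrightarrow> a < b \<Longrightarrow> b \<le> 1 \<Longrightarrow> {a<..<b} \<inter> K = {} \<Longrightarrow> smooth_on_interval a b \<gamma>"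
    using assms by (auto simp: piecewise_smooth_path_def)
  have "(\<gamma> has_vector_derivative vector_derivative \<gamma> (at t)) (at t)" if t: "t \<in> {0<..<1} - K" for t
  proof -
    have "open ({0<..<1} - K)" using K(1) by (intro open_Diff finite_imp_closed) auto
    then obtain e where e: "e > 0" "cball t e \<subseteq> {0<..<1} - K"
      using t open_contains_cball_eq by metis
    define a b where "a = t - e" and "b = t + e"
    have ab: "{a..b} \<subseteq> {0<..<1} - K" using e(2) by (simp add: a_def b_def cball_eq_atLeastAtMost)
    have t': "a < t" "t < b" using e by (auto simp: a_def b_def)
    moreover from t' have "a \<in> {a..b}" "b \<in> {a..b}" by auto
    with ab have "a \<in> {0<..<1}" "b \<in> {0<..<1}" by blast+
    moreover have "{a<..<b} \<inter> K = {}"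
      using ab greaterThanLessThan_subseteq_atLeastAtMost_iff[of a b a b] by blast
    ultimately have "smooth_on_interval a b \<gamma>" by (intro K(2)) auto
    then obtain D where D: "\<forall>s\<in>{a..b}. D 0 s = \<gamma> s"
      "\<forall>n::nat. \<forall>s\<in>{a..b}. (D n has_vector_derivative D (Suc n) s) (at s within {a..b})"
      unfolding smooth_on_interval_def by blast
    have "(D 0 has_vector_derivative D (Suc 0) t) (at t)"
      using D(2)[rule_format, of t 0] t' by (simp add: at_within_Icc_at)
    then have "(\<gamma> has_vector_derivative D (Suc 0) t) (at t)"
      by (rule has_vector_derivative_transform_within_open[where S = "{a<..<b}"]) (use D(1) t' in auto)
    then show ?thesis by (simp add: vector_derivative_at)
  qed
  with K(1) show ?thesis by (rule that)
qed

text \<open>A gauge integrable \<open>f\<close> need not be absolutely integrable, but then the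
  right-hand side is infinite. Otherwise \<open>f\<close> is Lebesgue integrable and the usual bound
  applies; passing to the completion accommodates an \<open>f\<close> that is only Lebesgue
  measurable.\<close>

lemma has_integral_le_nn_integral:
  fixes f :: "real \<Rightarrow> real"
  assumes f: "(f has_integral I) {a..b}"
  shows "ennreal \<bar>I\<bar> \<le> (\<integral>\<^sup>+t\<in>{a..b}. ennreal \<bar>f t\<bar> \<partial>lborel)"
proof (cases "(\<integral>\<^sup>+t\<in>{a..b}. ennreal \<bar>f t\<bar> \<partial>lborel) = \<infinity>")
  case False
  let ?g = "\<lambda>t. indicat_real {a..b} t *\<^sub>R f t"
  have "f \<in> borel_measurable (lebesgue_on {a..b})"
    using f by (auto intro: integrable_imp_measurable)
  then have m: "?g \<in> borel_measurable lebesgue"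
    by (simp add: borel_measurable_restrict_space_iff)
  have eq: "(\<integral>\<^sup>+t\<in>{a..b}. ennreal \<bar>f t\<bar> \<partial>lborel) = (\<integral>\<^sup>+t. ennreal (norm (?g t)) \<partial>lebesgue)"
    unfolding nn_integral_completion
    by (intro nn_integral_cong) (auto split: split_indicator)
  have i: "integrable lebesgue ?g"
    using m False eq by (intro integrableI_bounded) (auto simp: top.not_eq_extremum)
  then have "set_lebesgue_integral lebesgue {a..b} f = I"
    using f set_lebesgue_integral_eq_integral(2)[of "{a..b}" f]
    by (simp add: set_integrable_def integral_unique)
  then have "I = integral\<^sup>L lebesgue ?g" by (simp add: set_lebesgue_integral_def)
  then show ?thesis using integral_norm_bound_ennreal[OF i] eq by simp
qed simp

lemma length_powr_has_vector_derivative: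
  assumes \<gamma>: "(\<gamma> has_vector_derivative v) (at t)" and c: "\<gamma> t \<in> immersions"
  shows "((\<lambda>t. curve_length (\<gamma> t) powr r) has_vector_derivative
      r * curve_length (\<gamma> t) powr (r - 1) * length_variation (\<gamma> t) v) (at t)"
proof -
  interpret bounded_linear "length_variation (\<gamma> t)"
    using curve_length_has_derivative[OF c] by (rule has_derivative_bounded_linear)
  have "((\<lambda>t. curve_length (\<gamma> t)) has_derivative (\<lambda>x. length_variation (\<gamma> t) (x *\<^sub>R v))) (at t)"
    using \<gamma> unfolding has_vector_derivative_def
    by (rule has_derivative_compose) (rule curve_length_has_derivative[OF c])
  then have "((\<lambda>t. curve_length (\<gamma> t)) has_real_derivative length_variation (\<gamma> t) v) (at t)"
    by (simp add: has_real_derivative_iff_has_vector_derivative has_vector_derivative_def scaleR)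
  then show ?thesis
    unfolding has_real_derivative_iff_has_vector_derivative[symmetric]
    using curve_length_pos[OF c] by (auto intro!: derivative_eq_intros simp: mult_ac)
qed

lemma length_powr_le_path_length:
  assumes p: "p \<noteq> 1" and \<gamma>: "piecewise_smooth_path \<gamma>" "path_image \<gamma> \<subseteq> immersions"
  shows "ennreal (2 / \<bar>p - 1\<bar> * \<bar>curve_length (pathfinish \<gamma>) powr ((p - 1) / 2)
      - curve_length (pathstart \<gamma>) powr ((p - 1) / 2)\<bar>) \<le> path_length p q \<gamma>"
proof -
  obtain K where K: "finite K"
    "\<And>t. t \<in> {0<..<1} - K \<Longrightarrow> (\<gamma> has_vector_derivative vector_derivative \<gamma> (at t)) (at t)"
    using piecewise_smooth_path_has_vector_derivative[OF \<gamma>(1)] by metis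
  have im: "\<gamma> t \<in> immersions" if "t \<in> {0..1}" for t
    using \<gamma>(2) that by (auto simp: path_image_def)
  \<comment> \<open>The factor \<open>2 / \<bar>p - 1\<bar>\<close> cancels the exponent produced by
    differentiation, so that \<open>\<bar>f t\<bar>\<close> is exactly the quantity that the metric
    bounds.\<close>
  define F where "F t = 2 / \<bar>p - 1\<bar> * curve_length (\<gamma> t) powr ((p - 1) / 2)" for t
  define f where "f t = 2 / \<bar>p - 1\<bar> * ((p - 1) / 2 * curve_length (\<gamma> t) powr ((p - 1) / 2 - 1)
      * length_variation (\<gamma> t) (vector_derivative \<gamma> (at t)))" for t
  \<comment> \<open>The break points form a finite exceptional set, where continuity of
    \<open>F\<close> is enough for the fundamental theorem.\<close>
  have "(f has_integral (F 1 - F 0)) {0..1}"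
  proof (rule fundamental_theorem_of_calculus_interior_strong[OF K(1)])
    show "(F has_vector_derivative f t) (at t)" if "t \<in> {0<..<1} - K" for t
    proof -
      have "\<gamma> t \<in> immersions" using that by (intro im) auto
      from length_powr_has_vector_derivative[OF K(2)[OF that] this, of "(p - 1) / 2"]
      show ?thesis
        unfolding F_def f_def by (rule bounded_linear.has_vector_derivative[OF bounded_linear_mult_right])
    qed
    have "continuous_on (\<gamma> ` {0..1}) curve_length"
    proof (intro continuous_at_imp_continuous_on ballI)
      fix c assume "c \<in> \<gamma> ` {0..1}"
      then have "c \<in> immersions" using im by auto
      then show "isCont curve_length c" by (rule has_derivative_continuous[OF curve_length_has_derivative])
    qed
    moreover have "continuous_on {0..1} \<gamma>"
      using \<gamma>(1) by (simp add: piecewise_smooth_path_def path_def)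
    ultimately have "continuous_on {0..1} (\<lambda>t. curve_length (\<gamma> t))"
      by (rule continuous_on_compose2) simp
    moreover have "\<forall>t\<in>{0..1}. curve_length (\<gamma> t) \<noteq> 0"
      using im curve_length_pos by fastforce
    ultimately show "continuous_on {0..1} F"
      unfolding F_def by (intro continuous_intros)
  qed simp
  from has_integral_le_nn_integral[OF this]
  have "ennreal \<bar>F 1 - F 0\<bar> \<le> (\<integral>\<^sup>+t\<in>{0..1}. ennreal \<bar>f t\<bar> \<partial>lborel)" .
  also have "\<dots> \<le> path_length p q \<gamma>"
    unfolding path_length_def
  proof (rule nn_integral_mono)
    fix t
    show "ennreal \<bar>f t\<bar> * indicator {0..1} t \<le> ennreal (sqrt (sobolev_metric p q (\<gamma> t)
        (vector_derivative \<gamma> (at t)) (vector_derivative \<gamma> (at t)))) * indicator {0..1} t"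
    proof (cases "t \<in> {0..1}")
      case True
      have "\<bar>f t\<bar> = curve_length (\<gamma> t) powr ((p - 3) / 2) * \<bar>length_variation (\<gamma> t) (vector_derivative \<gamma> (at t))\<bar>"
      proof -
        have "(p - 1) / 2 - 1 = (p - 3) / 2" by (simp add: field_simps)
        then show ?thesis using p unfolding f_def by (simp only: abs_mult abs_divide) simp
      qed
      also have "\<dots> \<le> sqrt (sobolev_metric p q (\<gamma> t) (vector_derivative \<gamma> (at t)) (vector_derivative \<gamma> (at t)))"
        by (rule length_variation_le_sobolev_metric[OF im[OF True]])
      finally show ?thesis by (intro mult_right_mono ennreal_leI) auto
    qed simp
  qed
  also have "\<bar>F 1 - F 0\<bar> = 2 / \<bar>p - 1\<bar> * \<bar>curve_length (\<gamma> 1) powr ((p - 1) / 2)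
      - curve_length (\<gamma> 0) powr ((p - 1) / 2)\<bar>"
    unfolding F_def right_diff_distrib[symmetric] abs_mult by simp
  finally show ?thesis by (simp only: pathfinish_def pathstart_def)
qed

lemma length_powr_le_geodesic_dist:
  assumes "p \<noteq> 1"
  shows "ennreal (2 / \<bar>p - 1\<bar> * \<bar>curve_length c\<^sub>1 powr ((p - 1) / 2) - curve_length c\<^sub>0 powr ((p - 1) / 2)\<bar>)
      \<le> geodesic_dist p q c\<^sub>0 c\<^sub>1"
  unfolding geodesic_dist_def using length_powr_le_path_length[OF assms] by (intro INF_greatest) auto

section \<open>Concatenation of paths\<close>

text \<open>The tower of derivatives is carried over explicitly: the \<open>n\<close>-th one
  acquires the factor \<open>m ^ n\<close>.\<close>

lemma smooth_on_interval_affine: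
  assumes "smooth_on_interval (m * a + c) (m * b + c) \<gamma>" "m > 0"
    and eq: "\<And>t. t \<in> {a..b} \<Longrightarrow> \<beta> t = \<gamma> (m * t + c)"
  shows "smooth_on_interval a b \<beta>"
proof -
  let ?I = "{m * a + c..m * b + c}"
  obtain D where D: "\<forall>t\<in>?I. D 0 t = \<gamma> t"
    "\<forall>n::nat. \<forall>t\<in>?I. (D n has_vector_derivative D (Suc n) t) (at t within ?I)"
    using assms(1) unfolding smooth_on_interval_def by blast
  have I: "m * t + c \<in> ?I" if "t \<in> {a..b}" for t using that assms(2) by auto
  show ?thesis
    unfolding smooth_on_interval_def
  proof (intro exI[of _ "\<lambda>n t. m ^ n *\<^sub>R D n (m * t + c)"] conjI ballI allI)
    show "m ^ 0 *\<^sub>R D 0 (m * t + c) = \<beta> t" if "t \<in> {a..b}" for t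
      using D(1) I[OF that] eq[OF that] by simp
    fix n :: nat and t assume t: "t \<in> {a..b}"
    have "((\<lambda>t. m * t + c) has_vector_derivative m) (at t within {a..b})"
      by (auto intro!: derivative_eq_intros simp: has_real_derivative_iff_has_vector_derivative[symmetric])
    moreover have "(D n has_vector_derivative D (Suc n) (m * t + c)) (at (m * t + c) within (\<lambda>t. m * t + c) ` {a..b})"
      by (rule has_vector_derivative_within_subset[OF D(2)[rule_format, OF I[OF t]]]) (use I in blast)
    ultimately have "(D n \<circ> (\<lambda>t. m * t + c) has_vector_derivative m *\<^sub>R D (Suc n) (m * t + c)) (at t within {a..b})"
      by (rule vector_diff_chain_within)
    from bounded_linear.has_vector_derivative[OF bounded_linear_scaleR_right this, of "m ^ n"]
    show "((\<lambda>t. m ^ n *\<^sub>R D n (m * t + c)) has_vector_derivative m ^ Suc n *\<^sub>R D (Suc n) (m * t + c)) (at t within {a..b})"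
      by (simp add: o_def mult.commute)
  qed
qed

lemma piecewise_smooth_path_join:
  assumes g: "piecewise_smooth_path g" and h: "piecewise_smooth_path h" and gh: "pathfinish g = pathstart h"
  shows "piecewise_smooth_path (g +++ h)"
proof -
  obtain K where K: "finite K"
    "\<And>a b. 0 \<le> a \<Longrightarrow> a < b \<Longrightarrow> b \<le> 1 \<Longrightarrow> {a<..<b} \<inter> K = {} \<Longrightarrow> smooth_on_interval a b g"
    using g by (auto simp: piecewise_smooth_path_def)
  obtain L where L: "finite L"
    "\<And>a b. 0 \<le> a \<Longrightarrow> a < b \<Longrightarrow> b \<le> 1 \<Longrightarrow> {a<..<b} \<inter> L = {} \<Longrightarrow> smooth_on_interval a b h"
    using h by (auto simp: piecewise_smooth_path_def)
  let ?M = "insert (1/2) ((\<lambda>x. x / 2) ` K \<union> (\<lambda>x. (x + 1) / 2) ` L)"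
  have "smooth_on_interval a b (g +++ h)" if ab: "0 \<le> a" "a < b" "b \<le> 1" "{a<..<b} \<inter> ?M = {}" for a b
  proof -
    have "1/2 \<notin> {a<..<b}" using ab(4) by blast
    then consider "b \<le> 1/2" | "1/2 \<le> a" by force
    then show ?thesis
    proof cases
      case 1
      have "smooth_on_interval (2 * a + 0) (2 * b + 0) g"
      proof (rule K(2))
        have "x \<notin> K" if "x \<in> {2 * a + 0<..<2 * b + 0}" for x
        proof
          assume "x \<in> K"
          then have "x / 2 \<in> {a<..<b} \<inter> ?M" using that by auto
          then show False using ab(4) by blast
        qed
        then show "{2 * a + 0<..<2 * b + 0} \<inter> K = {}" by blast
      qed (use ab 1 in auto)
      then show ?thesis
        by (rule smooth_on_interval_affine) (use 1 in \<open>auto simp: joinpaths_def\<close>)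
    next
      case 2
      have "smooth_on_interval (2 * a + (- 1)) (2 * b + (- 1)) h"
      proof (rule L(2))
        have "x \<notin> L" if "x \<in> {2 * a + (- 1)<..<2 * b + (- 1)}" for x
        proof
          assume "x \<in> L"
          then have "(x + 1) / 2 \<in> {a<..<b} \<inter> ?M" using that by auto
          then show False using ab(4) by blast
        qed
        then show "{2 * a + (- 1)<..<2 * b + (- 1)} \<inter> L = {}" by blast
      qed (use ab 2 in auto)
      then show ?thesis
      proof (rule smooth_on_interval_affine)
        show "(g +++ h) t = h (2 * t + (- 1))" if "t \<in> {a..b}" for t
        \<comment> \<open>At the junction \<open>+++\<close> takes its value from \<open>g\<close>;
          the matching condition lets it be read from \<open>h\<close>, so the right half is smooth
          up to its left end.\<close>
        proof (cases "t = 1/2")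
          case True
          show ?thesis
            unfolding True using gh by (simp add: joinpaths_def pathfinish_def pathstart_def)
        qed (use that 2 in \<open>auto simp: joinpaths_def\<close>)
      qed simp
    qed
  qed
  moreover have "finite ?M" using K(1) L(1) by simp
  moreover have "path (g +++ h)" using g h gh by (simp add: piecewise_smooth_path_def)
  ultimately show ?thesis unfolding piecewise_smooth_path_def by blast
qed

lemma piecewise_smooth_path_linepath: "piecewise_smooth_path (linepath a b)"
proof -
  have "smooth_on_interval s t (linepath a b)" for s t
    unfolding smooth_on_interval_def
  proof (intro exI[of _ "\<lambda>n. case n of 0 \<Rightarrow> linepath a b | Suc 0 \<Rightarrow> (\<lambda>_. b - a) | _ \<Rightarrow> (\<lambda>_. 0)"] conjI ballI allI)
    fix n :: nat and x
    show "((case n of 0 \<Rightarrow> linepath a b | Suc 0 \<Rightarrow> \<lambda>_. b - a | _ \<Rightarrow> \<lambda>_. 0) has_vector_derivative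
        (case Suc n of 0 \<Rightarrow> linepath a b | Suc 0 \<Rightarrow> \<lambda>_. b - a | _ \<Rightarrow> \<lambda>_. 0) x) (at x within {s..t})"
      by (auto split: nat.split intro: has_vector_derivative_linepath_within)
  qed simp
  then show ?thesis unfolding piecewise_smooth_path_def by (auto intro!: exI[of _ "{}"])
qed

text \<open>The weak derivatives belonging to \<open>h\<close> and to its multiple are separate
  choices that correspond only almost everywhere, hence the comparison under the integral. The case
  \<open>r = 2\<close> accounts for paths traversed at double speed.\<close>

lemma sobolev_metric_scaleR:
  assumes c: "c \<in> immersions"
  shows "sobolev_metric p q c (r *\<^sub>R h) (r *\<^sub>R h) = r\<^sup>2 * sobolev_metric p q c h h"
proof -
  let ?n = "\<lambda>\<theta>. norm (\<theta>_deriv (H2_fun c) \<theta>)"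
  have "Ds c (r *\<^sub>R h) = (\<lambda>\<theta>. r *\<^sub>R Ds c h \<theta>)"
    by (simp add: Ds_def fun_eq_iff fun_cong[OF H2_fun_deriv_scaleR] mult.commute)
  then have "AE \<theta> in circle. weak_deriv (Ds c (r *\<^sub>R h)) \<theta> = r *\<^sub>R weak_deriv (Ds c h) \<theta>"
    using weak_deriv_scaleR_AE[OF Ds_H1[OF c]] by simp
  then have "AE \<theta> in circle. (Ds2 c (r *\<^sub>R h) \<theta> \<bullet> Ds2 c (r *\<^sub>R h) \<theta>) * ?n \<theta> = r\<^sup>2 * ((Ds2 c h \<theta> \<bullet> Ds2 c h \<theta>) * ?n \<theta>)"
    by eventually_elim (simp add: Ds2_def power2_eq_square)
  then have "(\<integral>\<theta>. (Ds2 c (r *\<^sub>R h) \<theta> \<bullet> Ds2 c (r *\<^sub>R h) \<theta>) * ?n \<theta> \<partial>circle)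
      = (\<integral>\<theta>. r\<^sup>2 * ((Ds2 c h \<theta> \<bullet> Ds2 c h \<theta>) * ?n \<theta>) \<partial>circle)"
    using Ds2_sq_integrable[OF c, of h] Ds2_sq_integrable[OF c, of "r *\<^sub>R h"]
    by (intro integral_cong_AE borel_measurable_integrable) auto
  moreover have "(\<integral>\<theta>. (H2_fun (r *\<^sub>R h) \<theta> \<bullet> H2_fun (r *\<^sub>R h) \<theta>) * ?n \<theta> \<partial>circle)
      = (\<integral>\<theta>. r\<^sup>2 * ((H2_fun h \<theta> \<bullet> H2_fun h \<theta>) * ?n \<theta>) \<partial>circle)"
    by (simp add: H2_fun_scaleR power2_eq_square mult.assoc)
  ultimately show ?thesis
    unfolding sobolev_metric_eq[OF c] by (simp add: algebra_simps)
qed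

text \<open>
  The length of a path is the Lebesgue integral of a function whose measurability is not obvious,
  so paths are compared through measurable bounds on their speed.
\<close>

definition joined_within :: "real \<Rightarrow> real \<Rightarrow> ('a::euclidean_space) H2 \<Rightarrow> 'a H2 \<Rightarrow> ennreal \<Rightarrow> bool" where
  "joined_within p q c\<^sub>0 c\<^sub>1 B \<longleftrightarrow> (\<exists>\<gamma> g K.
     piecewise_smooth_path \<gamma> \<and> path_image \<gamma> \<subseteq> immersions \<and> pathstart \<gamma> = c\<^sub>0 \<and> pathfinish \<gamma> = c\<^sub>1 \<and>
     g \<in> borel_measurable borel \<and> finite K \<and> (\<integral>\<^sup>+t\<in>{0..1}. g t \<partial>lborel) \<le> B \<and>
     (\<forall>t\<in>{0..1} - K. \<exists>v. (\<gamma> has_vector_derivative v) (at t) \<and>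
        ennreal (sqrt (sobolev_metric p q (\<gamma> t) v v)) \<le> g t))"

lemma geodesic_dist_le_if_joined_within:
  assumes "joined_within p q c\<^sub>0 c\<^sub>1 B"
  shows "geodesic_dist p q c\<^sub>0 c\<^sub>1 \<le> B"
proof -
  obtain \<gamma> g K where \<gamma>: "piecewise_smooth_path \<gamma>" "path_image \<gamma> \<subseteq> immersions"
    "pathstart \<gamma> = c\<^sub>0" "pathfinish \<gamma> = c\<^sub>1" and K: "finite K" and B: "(\<integral>\<^sup>+t\<in>{0..1}. g t \<partial>lborel) \<le> B"
    and g: "\<forall>t\<in>{0..1} - K. \<exists>v. (\<gamma> has_vector_derivative v) (at t) \<and>
        ennreal (sqrt (sobolev_metric p q (\<gamma> t) v v)) \<le> g t"
    using assms unfolding joined_within_def by blast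
  have "AE t in lborel. t \<notin> K"
    using finite_imp_null_set_lborel[OF K] by (rule AE_not_in)
  then have "path_length p q \<gamma> \<le> (\<integral>\<^sup>+t\<in>{0..1}. g t \<partial>lborel)"
    unfolding path_length_def
  proof (intro nn_integral_mono_AE, eventually_elim)
    case (elim t)
    show ?case
    proof (cases "t \<in> {0..1}")
      case True
      then show ?thesis using g elim by (auto simp: vector_derivative_at dest!: bspec[of _ _ t])
    qed simp
  qed
  then have "path_length p q \<gamma> \<le> B" using B by simp
  then show ?thesis
    unfolding geodesic_dist_def using \<gamma> by (intro INF_lower2[of \<gamma>]) auto
qed

lemma joined_within_mono:
  "joined_within p q a b A \<Longrightarrow> A \<le> B \<Longrightarrow> joined_within p q a b B"
  unfolding joined_within_def by (blast intro: order_trans)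

lemma joined_within_trans:
  assumes "joined_within p q c\<^sub>0 c\<^sub>1 A" "joined_within p q c\<^sub>1 c\<^sub>2 B"
  shows "joined_within p q c\<^sub>0 c\<^sub>2 (A + B)"
proof -
  obtain \<gamma> g K where \<gamma>: "piecewise_smooth_path \<gamma>" "path_image \<gamma> \<subseteq> immersions"
    "pathstart \<gamma> = c\<^sub>0" "pathfinish \<gamma> = c\<^sub>1" and K: "finite K" and A: "(\<integral>\<^sup>+t\<in>{0..1}. g t \<partial>lborel) \<le> A"
    and gm: "g \<in> borel_measurable borel"
    and g: "\<forall>t\<in>{0..1} - K. \<exists>v. (\<gamma> has_vector_derivative v) (at t) \<and>
        ennreal (sqrt (sobolev_metric p q (\<gamma> t) v v)) \<le> g t"
    using assms(1) unfolding joined_within_def by blast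
  obtain \<beta> h L where \<beta>: "piecewise_smooth_path \<beta>" "path_image \<beta> \<subseteq> immersions"
    "pathstart \<beta> = c\<^sub>1" "pathfinish \<beta> = c\<^sub>2" and L: "finite L" and B: "(\<integral>\<^sup>+t\<in>{0..1}. h t \<partial>lborel) \<le> B"
    and hm: "h \<in> borel_measurable borel"
    and h: "\<forall>t\<in>{0..1} - L. \<exists>v. (\<beta> has_vector_derivative v) (at t) \<and>
        ennreal (sqrt (sobolev_metric p q (\<beta> t) v v)) \<le> h t"
    using assms(2) unfolding joined_within_def by blast
  define g' where "g' t = g t * indicator {0..1} t" for t
  define h' where "h' t = h t * indicator {0..1} t" for t
  have [measurable]: "g' \<in> borel_measurable borel" "h' \<in> borel_measurable borel"
    unfolding g'_def h'_def using gm hm by measurable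
  \<comment> \<open>Each path is run through at double speed, and the substitution halves its
    integral, so the total is \<open>A + B\<close>. The truncations vanish outside their own closed
    half, and a plain sum stays measurable without a case distinction.\<close>
  define k where "k t = 2 * g' (0 + 2 * t) + 2 * h' (-1 + 2 * t)" for t
  have km[measurable]: "k \<in> borel_measurable borel" unfolding k_def by measurable
  have speed: "ennreal (sqrt (sobolev_metric p q c (2 *\<^sub>R v) (2 *\<^sub>R v))) = 2 * ennreal (sqrt (sobolev_metric p q c v v))"
    if "c \<in> immersions" for c v :: "'a H2"
    by (simp add: sobolev_metric_scaleR[OF that] real_sqrt_mult ennreal_mult')
  let ?\<alpha> = "\<gamma> +++ \<beta>"
  let ?M = "insert (1/2) ((\<lambda>x. x / 2) ` K \<union> (\<lambda>x. (x + 1) / 2) ` L)"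
  show ?thesis
    unfolding joined_within_def
  proof (intro exI[of _ ?\<alpha>] exI[of _ k] exI[of _ ?M] conjI ballI km)
    show "piecewise_smooth_path ?\<alpha>" using \<gamma> \<beta> by (intro piecewise_smooth_path_join) auto
    show "path_image ?\<alpha> \<subseteq> immersions" using \<gamma> \<beta> by (simp add: path_image_join)
    show "finite ?M" using K L by simp
    have "(\<integral>\<^sup>+t\<in>{0..1}. k t \<partial>lborel) \<le> (\<integral>\<^sup>+t. k t \<partial>lborel)"
      by (intro nn_integral_mono) (auto split: split_indicator)
    also have "\<dots> = 2 * (\<integral>\<^sup>+t. g' (0 + 2 * t) \<partial>lborel) + 2 * (\<integral>\<^sup>+t. h' (-1 + 2 * t) \<partial>lborel)"
      unfolding k_def by (simp add: nn_integral_add nn_integral_cmult)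
    also have "\<dots> = (\<integral>\<^sup>+t. g' t \<partial>lborel) + (\<integral>\<^sup>+t. h' t \<partial>lborel)"
      using nn_integral_real_affine[of g' 2 0] nn_integral_real_affine[of h' 2 "-1"] by simp
    also have "\<dots> \<le> A + B" using A B by (intro add_mono) (auto simp: g'_def h'_def)
    finally show "(\<integral>\<^sup>+t\<in>{0..1}. k t \<partial>lborel) \<le> A + B" .
    fix t assume t: "t \<in> {0..1} - ?M"
    then consider "t < 1/2" | "t > 1/2" by force
    then show "\<exists>v. (?\<alpha> has_vector_derivative v) (at t) \<and> ennreal (sqrt (sobolev_metric p q (?\<alpha> t) v v)) \<le> k t"
    proof cases
      case 1
      have "2 * t \<notin> K" using t by (auto simp: image_iff mult.commute)
      then have t': "2 * t \<in> {0..1} - K" using 1 t by auto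
      then obtain v where v: "(\<gamma> has_vector_derivative v) (at (2 * t))"
        "ennreal (sqrt (sobolev_metric p q (\<gamma> (2 * t)) v v)) \<le> g (2 * t)" using g by blast
      have "((\<lambda>t. 2 * t) has_vector_derivative 2) (at t)"
        by (auto intro!: derivative_eq_intros simp: has_real_derivative_iff_has_vector_derivative[symmetric])
      from vector_diff_chain_at[OF this v(1)]
      have "(?\<alpha> has_vector_derivative 2 *\<^sub>R v) (at t)"
        by (rule has_vector_derivative_transform_within_open[where S = "{..<1/2}"])
          (use 1 in \<open>auto simp: joinpaths_def\<close>)
      moreover have "\<gamma> (2 * t) \<in> immersions" using t' \<gamma>(2) by (auto simp: path_image_def)
      then have "ennreal (sqrt (sobolev_metric p q (?\<alpha> t) (2 *\<^sub>R v) (2 *\<^sub>R v))) \<le> 2 * g (2 * t)"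
        using 1 v(2) by (simp add: joinpaths_def speed mult_left_mono)
      moreover have "2 * g (2 * t) \<le> k t" using t' by (simp add: k_def g'_def)
      ultimately show ?thesis by (meson order_trans)
    next
      case 2
      have "2 * t - 1 \<notin> L"
      proof
        assume "2 * t - 1 \<in> L"
        then have "(2 * t - 1 + 1) / 2 \<in> ?M" by blast
        then show False using t by simp
      qed
      then have t': "2 * t - 1 \<in> {0..1} - L" using 2 t by auto
      then obtain v where v: "(\<beta> has_vector_derivative v) (at (2 * t - 1))"
        "ennreal (sqrt (sobolev_metric p q (\<beta> (2 * t - 1)) v v)) \<le> h (2 * t - 1)" using h by blast
      have "((\<lambda>t. 2 * t - 1) has_vector_derivative 2) (at t)"
        by (auto intro!: derivative_eq_intros simp: has_real_derivative_iff_has_vector_derivative[symmetric])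
      from vector_diff_chain_at[OF this v(1)]
      have "(?\<alpha> has_vector_derivative 2 *\<^sub>R v) (at t)"
        by (rule has_vector_derivative_transform_within_open[where S = "{1/2<..}"])
          (use 2 in \<open>auto simp: joinpaths_def\<close>)
      moreover have "\<beta> (2 * t - 1) \<in> immersions" using t' \<beta>(2) by (auto simp: path_image_def)
      then have "ennreal (sqrt (sobolev_metric p q (?\<alpha> t) (2 *\<^sub>R v) (2 *\<^sub>R v))) \<le> 2 * h (2 * t - 1)"
        using 2 v(2) by (simp add: joinpaths_def speed mult_left_mono)
      moreover have "2 * h (2 * t - 1) \<le> k t" using t' by (simp add: k_def h'_def)
      ultimately show ?thesis by (meson order_trans)
    qed
  qed (use \<gamma> \<beta> in auto)
qed

lemma joined_within_refl:
  assumes "c \<in> immersions"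
  shows "joined_within p q c c 0"
  unfolding joined_within_def
proof (intro exI[of _ "linepath c c"] exI[of _ "\<lambda>_. 0"] exI[of _ "{}"] conjI ballI)
  fix t :: real
  have "sobolev_metric p q c 0 0 = 0"
    using sobolev_metric_scaleR[OF assms, of p q 0 0] by simp
  then show "\<exists>v. (linepath c c has_vector_derivative v) (at t) \<and>
      ennreal (sqrt (sobolev_metric p q (linepath c c t) v v)) \<le> 0"
    by (intro exI[of _ 0]) (simp add: linepath_refl)
qed (use assms in \<open>auto simp: piecewise_smooth_path_linepath\<close>)

lemma joined_within_linepath:
  assumes "\<And>t. t \<in> {0..1} \<Longrightarrow> linepath a b t \<in> immersions \<and> sobolev_metric p q (linepath a b t) (b - a) (b - a) \<le> B\<^sup>2"
    and "B \<ge> 0"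
  shows "joined_within p q a b (ennreal B)"
  unfolding joined_within_def
proof (intro exI[of _ "linepath a b"] exI[of _ "\<lambda>_. ennreal B"] exI[of _ "{}"] conjI ballI)
  fix t :: real assume "t \<in> {0..1} - {}"
  then have "sqrt (sobolev_metric p q (linepath a b t) (b - a) (b - a)) \<le> B"
    using assms by (intro real_le_lsqrt) auto
  then show "\<exists>v. (linepath a b has_vector_derivative v) (at t) \<and>
      ennreal (sqrt (sobolev_metric p q (linepath a b t) v v)) \<le> ennreal B"
    by (intro exI[of _ "b - a"]) (auto intro: has_vector_derivative_linepath_within ennreal_leI)
qed (use assms in \<open>auto simp: piecewise_smooth_path_linepath path_image_def nn_integral_cmult\<close>)

section \<open>Oscillating curves\<close>

text \<open>The quotient rule expands \<open>Ds2 c h\<close> into a term with \<open>H\<close> and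
  one with \<open>c' \<bullet> C\<close> and \<open>h'\<close>; Cauchy-Schwarz bounds each
  pointwise. The representatives \<open>C\<close> and \<open>H\<close> are arguments because
  pointwise bounds make sense only for fixed representatives.\<close>

lemma sobolev_metric_upper_bound:
  fixes c h :: "'a::euclidean_space H2"
  assumes c: "c \<in> immersions" and C: "has_weak_deriv (\<theta>_deriv (H2_fun c)) C"
    and H: "has_weak_deriv (\<theta>_deriv (H2_fun h)) H" and m: "m > 0"
    and speed: "\<And>\<theta>. m \<le> norm (\<theta>_deriv (H2_fun c) \<theta>)" "\<And>\<theta>. norm (\<theta>_deriv (H2_fun c) \<theta>) \<le> M"
    and C2: "\<And>\<theta>. norm (C \<theta>) \<le> C2" and H0: "\<And>\<theta>. norm (H2_fun h \<theta>) \<le> H0"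
    and H1: "\<And>\<theta>. norm (\<theta>_deriv (H2_fun h) \<theta>) \<le> H1" and H2: "\<And>\<theta>. norm (H \<theta>) \<le> H2"
  shows "sobolev_metric p q c h h \<le> 2 * pi * M *
    (curve_length c powr q * H0\<^sup>2 + curve_length c powr p * ((H2 / m + C2 * H1 / m\<^sup>2) / m)\<^sup>2)"
proof -
  let ?c = "\<theta>_deriv (H2_fun c)" and ?h = "\<theta>_deriv (H2_fun h)"
  define D where "D = (H2 / m + C2 * H1 / m\<^sup>2) / m"
  have nz: "norm (?c \<theta>) > 0" for \<theta> using m speed(1)[of \<theta>] by linarith
  have M: "M > 0" using nz[of 0] speed(2)[of 0] by linarith
  have H2p: "0 \<le> H2" and H1p: "0 \<le> H1" and C2p: "0 \<le> C2" and H0p: "0 \<le> H0"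
    using order_trans[OF norm_ge_zero H2[of 0]] order_trans[OF norm_ge_zero H1[of 0]]
      order_trans[OF norm_ge_zero C2[of 0]] order_trans[OF norm_ge_zero H0[of 0]] by auto
  have D0: "D \<ge> 0" unfolding D_def using H2p H1p C2p m by simp
  have "(\<integral>\<theta>. (H2_fun h \<theta> \<bullet> H2_fun h \<theta>) * norm (?c \<theta>) \<partial>circle) \<le> (\<integral>\<theta>. H0\<^sup>2 * M \<partial>circle)"
  proof (rule circle_integral_mono)
    show "integrable circle (\<lambda>\<theta>. (H2_fun h \<theta> \<bullet> H2_fun h \<theta>) * norm (?c \<theta>))"
      by (intro integrable_circle_continuous continuous_intros H2_fun_continuous H2_fun_deriv_continuous)
    show "integrable circle (\<lambda>\<theta>. H0\<^sup>2 * M)" by (intro integrable_circle_continuous) simp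
    show "(H2_fun h \<theta> \<bullet> H2_fun h \<theta>) * norm (?c \<theta>) \<le> H0\<^sup>2 * M" for \<theta>
      unfolding power2_norm_eq_inner[symmetric] by (intro mult_mono power_mono H0 speed) auto
  qed
  then have A: "(\<integral>\<theta>. (H2_fun h \<theta> \<bullet> H2_fun h \<theta>) * norm (?c \<theta>) \<partial>circle) \<le> 2 * pi * M * H0\<^sup>2"
    unfolding circle_integral_const by (simp add: mult_ac)
  have wd: "norm (H \<theta> /\<^sub>R norm (?c \<theta>) - ((?c \<theta> \<bullet> C \<theta>) / norm (?c \<theta>) ^ 3) *\<^sub>R ?h \<theta>) \<le> D * m" for \<theta>
  proof -
    let ?n = "norm (?c \<theta>)"
    have n: "?n > 0" "m \<le> ?n" using nz speed by auto
    have "norm (H \<theta> /\<^sub>R ?n) \<le> H2 / m"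
      using n m H2[of \<theta>] H2p by (simp add: divide_inverse[symmetric] mult.commute[of "inverse _"] frac_le)
    moreover have "norm (((?c \<theta> \<bullet> C \<theta>) / ?n ^ 3) *\<^sub>R ?h \<theta>) \<le> C2 * H1 / m\<^sup>2"
    proof -
      have "\<bar>?c \<theta> \<bullet> C \<theta>\<bar> \<le> ?n * C2"
        using C2[of \<theta>] n by (intro order_trans[OF Cauchy_Schwarz_ineq2] mult_left_mono) auto
      then have "\<bar>?c \<theta> \<bullet> C \<theta>\<bar> / ?n ^ 3 \<le> C2 / ?n\<^sup>2"
        using n by (simp add: field_simps power2_eq_square power3_eq_cube)
      also have "\<dots> \<le> C2 / m\<^sup>2"
        using n m C2p by (intro divide_left_mono power_mono mult_pos_pos) auto
      finally have "\<bar>?c \<theta> \<bullet> C \<theta>\<bar> / ?n ^ 3 * norm (?h \<theta>) \<le> C2 / m\<^sup>2 * H1"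
        using C2p H1[of \<theta>] by (intro mult_mono) auto
      then show ?thesis by simp
    qed
    ultimately have "norm (H \<theta> /\<^sub>R ?n - ((?c \<theta> \<bullet> C \<theta>) / ?n ^ 3) *\<^sub>R ?h \<theta>) \<le> H2 / m + C2 * H1 / m\<^sup>2"
      by (rule order_trans[OF norm_triangle_ineq4 add_mono])
    then show ?thesis using m by (simp add: D_def)
  qed
  have "AE \<theta> in circle. (Ds2 c h \<theta> \<bullet> Ds2 c h \<theta>) * norm (?c \<theta>) \<le> D\<^sup>2 * M"
    using weak_deriv_Ds_AE[OF c C H]
  proof eventually_elim
    case (elim \<theta>)
    have "norm (weak_deriv (Ds c h) \<theta>) \<le> D * norm (?c \<theta>)"
      using wd[of \<theta>] D0 mult_left_mono[OF speed(1)[of \<theta>] D0] unfolding elim by linarith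
    then have "norm (Ds2 c h \<theta>) \<le> D" using nz[of \<theta>] by (simp add: Ds2_def field_simps)
    then show ?case
      unfolding power2_norm_eq_inner[symmetric] by (intro mult_mono power_mono speed) auto
  qed
  then have "(\<integral>\<theta>. (Ds2 c h \<theta> \<bullet> Ds2 c h \<theta>) * norm (?c \<theta>) \<partial>circle) \<le> (\<integral>\<theta>. D\<^sup>2 * M \<partial>circle)"
    by (intro integral_mono_AE Ds2_sq_integrable c integrable_circle_continuous) auto
  then have "(\<integral>\<theta>. (Ds2 c h \<theta> \<bullet> Ds2 c h \<theta>) * norm (?c \<theta>) \<partial>circle) \<le> 2 * pi * M * D\<^sup>2"
    unfolding circle_integral_const by (simp add: mult_ac)
  with A have "sobolev_metric p q c h h \<le> curve_length c powr q * (2 * pi * M * H0\<^sup>2)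
      + curve_length c powr p * (2 * pi * M * D\<^sup>2)"
    unfolding sobolev_metric_eq[OF c] by (intro add_mono mult_left_mono) auto
  then show ?thesis unfolding D_def[symmetric] by (simp add: algebra_simps)
qed

section \<open>Sine waves and a sequence of frequencies\<close>

lemma has_weak_deriv_C1:
  assumes "\<And>\<theta>. (f has_vector_derivative g \<theta>) (at \<theta>)" "continuous_on UNIV g"
  shows "has_weak_deriv f g"
  unfolding has_weak_deriv_def
proof (intro conjI ballI)
  show "g \<in> L2_circle" using assms(2) by (rule continuous_imp_L2_circle)
  show "(g has_integral (f \<theta> - f 0)) {0..\<theta>}" if "\<theta> \<in> {0..2 * pi}" for \<theta>
    using that by (intro fundamental_theorem_of_calculus has_vector_derivative_at_within[OF assms(1)]) auto
qed

text \<open>Division by \<open>n\<close> gives the derivative amplitude \<open>norm e\<close> at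
  every frequency: lengths stay comparable while the extent is of order
  \<open>1 / n\<close>.\<close>

definition sine_wave :: "nat \<Rightarrow> 'a::euclidean_space \<Rightarrow> 'a H2" where
  "sine_wave n e = Abs_H2 (\<lambda>\<theta>. (sin (n * \<theta>) / n) *\<^sub>R e)"

lemma sine_wave:
  fixes e :: "'a::euclidean_space"
  assumes n: "n > 0"
  shows "H2_fun (sine_wave n e) = (\<lambda>\<theta>. (sin (n * \<theta>) / n) *\<^sub>R e)" (is ?fun)
    and "\<theta>_deriv (H2_fun (sine_wave n e)) = (\<lambda>\<theta>. cos (n * \<theta>) *\<^sub>R e)" (is ?deriv)
    and "has_weak_deriv (\<theta>_deriv (H2_fun (sine_wave n e))) (\<lambda>\<theta>. - (n * sin (n * \<theta>)) *\<^sub>R e)" (is ?weak)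
proof -
  have shift: "n * (\<theta> + 2 * pi) = n * \<theta> + 2 * real n * pi" for \<theta> :: real
    by (simp add: algebra_simps)
  have per: "sin (n * (\<theta> + 2 * pi)) = sin (n * \<theta>)" "cos (n * (\<theta> + 2 * pi)) = cos (n * \<theta>)" for \<theta> :: real
    unfolding shift by (simp_all add: sin_add cos_add)
  have "((\<lambda>\<theta>. sin (n * \<theta>) / n) has_real_derivative cos (n * \<theta>)) (at \<theta>)" for \<theta> :: real
    using n by (auto intro!: derivative_eq_intros)
  then have d: "((\<lambda>\<theta>. (sin (n * \<theta>) / n) *\<^sub>R e) has_vector_derivative cos (n * \<theta>) *\<^sub>R e) (at \<theta>)" for \<theta> :: real
    unfolding has_real_derivative_iff_has_vector_derivative
    by (rule bounded_linear.has_vector_derivative[OF bounded_linear_scaleR_left])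
  have "((\<lambda>\<theta>. cos (n * \<theta>)) has_real_derivative - (n * sin (n * \<theta>))) (at \<theta>)" for \<theta> :: real
    by (auto intro!: derivative_eq_intros)
  then have d2: "((\<lambda>\<theta>. cos (n * \<theta>) *\<^sub>R e) has_vector_derivative - (n * sin (n * \<theta>)) *\<^sub>R e) (at \<theta>)" for \<theta> :: real
    unfolding has_real_derivative_iff_has_vector_derivative
    by (rule bounded_linear.has_vector_derivative[OF bounded_linear_scaleR_left])
  have w: "has_weak_deriv (\<lambda>\<theta>. cos (n * \<theta>) *\<^sub>R e) (\<lambda>\<theta>. - (n * sin (n * \<theta>)) *\<^sub>R e)"
    by (rule has_weak_deriv_C1[OF d2]) (intro continuous_intros)
  have D: "\<theta>_deriv (\<lambda>\<theta>. (sin (n * \<theta>) / n) *\<^sub>R e) \<theta> = cos (n * \<theta>) *\<^sub>R e" for \<theta> :: real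
    using d by (rule vector_derivative_at)
  have "(\<lambda>\<theta>. (sin (n * \<theta>) / n) *\<^sub>R e) \<in> H2_circle"
    unfolding H2_circle_def H1_circle_def mem_Collect_eq
  proof (intro conjI allI)
    let ?f = "\<lambda>\<theta>::real. (sin (n * \<theta>) / n) *\<^sub>R e"
    show "periodic ?f" by (simp add: periodic_fun_simple_def per)
    show "periodic (\<theta>_deriv ?f)" unfolding D by (simp add: periodic_fun_simple_def per)
    show "\<exists>g. has_weak_deriv (\<theta>_deriv ?f) g" unfolding D using w by blast
  qed (use d in \<open>auto intro: differentiableI_vector\<close>)
  then show *: ?fun by (simp add: sine_wave_def Abs_H2_inverse)
  show ?deriv unfolding * D ..
  then show ?weak using w by simp
qed

text \<open>The outer frequencies differ by 4 times the middle one. If \<open>x\<close> is the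
  middle phase, the difference of the outer cosines contains \<open>sin (2 * x)\<close> and hence
  the factor \<open>cos x\<close>; a difference of 2 times the middle frequency would give only
  \<open>sin x\<close>. By monotonicity each later frequency is between 4 and 5 times its
  predecessor.\<close>

fun freq :: "nat \<Rightarrow> nat" where
  "freq 0 = 0"
| "freq (Suc 0) = 1"
| "freq (Suc (Suc k)) = 4 * freq (Suc k) + freq k"

lemma freq_mono: "freq k \<le> freq (Suc k)"
  by (cases k) auto

lemma freq_lower: "4 ^ k \<le> freq (Suc k)"
  by (induction k) auto

lemma freq_upper: "freq (Suc k) \<le> 5 ^ k"
proof (induction k)
  case (Suc k)
  then show ?case using freq_mono[of k] by simp
qed simp

lemma freq_pos: "freq (Suc k) > 0"
  by (rule order_less_le_trans[OF _ freq_lower]) simp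

lemma freq_upper_mono: "i \<le> j \<Longrightarrow> real (freq (Suc i)) \<le> 5 ^ j"
  using order_trans[OF freq_upper[of i] power_increasing[of i j 5]] of_nat_mono by fastforce

lemma freq_lower_mono: "j \<le> i \<Longrightarrow> 4 ^ j \<le> real (freq (Suc i))"
  using order_trans[OF power_increasing[of j i 4] freq_lower[of i]] of_nat_mono by fastforce

text \<open>Sum-to-product around \<open>2 * ?x + ?y\<close>: this formula and the double angle
  formula contribute a factor 2 each.\<close>

lemma cos_freq_diff:
  fixes \<theta> :: real
  shows "\<bar>cos (freq (Suc (Suc k)) * \<theta>) - cos (freq k * \<theta>)\<bar> \<le> 4 * \<bar>cos (freq (Suc k) * \<theta>)\<bar>"
proof -
  let ?x = "freq (Suc k) * \<theta>" and ?y = "freq k * \<theta>"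
  have "cos (freq (Suc (Suc k)) * \<theta>) - cos (freq k * \<theta>) = cos ((2 * ?x + ?y) + 2 * ?x) - cos ((2 * ?x + ?y) - 2 * ?x)"
    by (simp add: algebra_simps)
  also have "\<dots> = - 2 * sin (2 * ?x + ?y) * (2 * sin ?x * cos ?x)"
    unfolding cos_diff[of "2 * ?x + ?y"] cos_add[of "2 * ?x + ?y"] sin_double by simp
  finally have "\<bar>cos (freq (Suc (Suc k)) * \<theta>) - cos (freq k * \<theta>)\<bar>
      = 4 * (\<bar>sin (2 * ?x + ?y)\<bar> * \<bar>sin ?x\<bar>) * \<bar>cos ?x\<bar>"
    by (simp add: abs_mult)
  also have "\<dots> \<le> 4 * (1 * 1) * \<bar>cos ?x\<bar>"
    by (intro mult_right_mono mult_left_mono mult_mono) auto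
  finally show ?thesis by simp
qed

text \<open>Consecutive cosines never vanish together. If \<open>y\<close>, \<open>x\<close>,
  \<open>z\<close> are the absolute values at the older, middle and newer frequency, then
  \<open>y \<le> z + 4 * x\<close>, so \<open>y + x \<le> 5 * (x + z)\<close> and each step loses at
  most a factor 5. The induction starts from \<open>cos 0 = 1\<close>.\<close>

lemma cos_freq_lower:
  fixes \<theta> :: real
  shows "1 / 5 ^ k \<le> \<bar>cos (freq k * \<theta>)\<bar> + \<bar>cos (freq (Suc k) * \<theta>)\<bar>"
proof (induction k)
  case (Suc k)
  have *: "d / 5 \<le> x + z" if "d \<le> y + x" "\<bar>z - y\<bar> \<le> 4 * x" "0 \<le> z" for d x y z :: real
    using that by linarith
  have "\<bar>\<bar>cos (freq (Suc (Suc k)) * \<theta>)\<bar> - \<bar>cos (freq k * \<theta>)\<bar>\<bar> \<le> 4 * \<bar>cos (freq (Suc k) * \<theta>)\<bar>"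
    by (rule order_trans[OF abs_triangle_ineq3 cos_freq_diff])
  from *[OF Suc this] show ?case by simp
qed simp

declare freq.simps(3) [simp del]

text \<open>The value is the same for all frequencies; as the absolute value of a cosine dominates
  its square, this yields length bounds independent of \<open>k\<close>.\<close>

lemma integral_cos_sq:
  assumes "n > 0"
  shows "(\<integral>\<theta>. (cos (real n * \<theta>))\<^sup>2 \<partial>circle) = pi"
proof -
  define P where "P \<theta> = \<theta> / 2 + sin (2 * real n * \<theta>) / (4 * real n)" for \<theta> :: real
  have "(P has_real_derivative (cos (real n * x))\<^sup>2) (at x within {0..2 * pi})" for x
  proof -
    have "(P has_real_derivative (1 + cos (2 * real n * x)) / 2) (at x within {0..2 * pi})"
      unfolding P_def using assms by (auto intro!: derivative_eq_intros simp: field_simps)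
    moreover have "(1 + cos (2 * real n * x)) / 2 = (cos (real n * x))\<^sup>2"
      using cos_double_cos[of "real n * x"] by (simp add: mult.assoc)
    ultimately show ?thesis by simp
  qed
  then have "((\<lambda>\<theta>. (cos (real n * \<theta>))\<^sup>2) has_integral (P (2 * pi) - P 0)) {0..2 * pi}"
    unfolding has_real_derivative_iff_has_vector_derivative
    by (intro fundamental_theorem_of_calculus) auto
  moreover have "sin (2 * real n * (2 * pi)) = 0"
    using sin_npi[of "4 * n"] by (simp add: mult_ac)
  ultimately have "integral {0..2 * pi} (\<lambda>\<theta>. (cos (real n * \<theta>))\<^sup>2) = pi"
    by (simp add: integral_unique P_def)
  then show ?thesis
    by (subst lebesgue_integral_eq_integral) (auto intro!: integrable_circle_continuous continuous_intros)
qed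

text \<open>The sum of both end values covers increasing and decreasing powers at once; the sign of
  \<open>p\<close> and of \<open>(p - 1) / 2\<close> is not fixed.\<close>

lemma powr_le_sum_ends:
  fixes x y z :: real
  assumes "0 < x" "x \<le> y" "y \<le> z"
  shows "y powr e \<le> x powr e + z powr e"
proof (cases "e \<ge> 0")
  case True
  then have "y powr e \<le> z powr e" using assms by (intro powr_mono2) auto
  then show ?thesis by (simp add: add_increasing)
next
  case False
  then have "y powr e \<le> x powr e" using assms by (intro powr_mono2') auto
  then show ?thesis by (simp add: add_increasing2)
qed

text \<open>\<open>R\<close> may lie on either side of 1, whence \<open>min 1 R\<close> and
  \<open>1 + R\<close>.\<close>

lemma convex_combination_bounds:
  fixes R \<sigma> \<tau> :: real
  assumes R: "R > 0" and st: "\<sigma> \<ge> 0" "\<tau> \<ge> 0" "\<sigma> + \<tau> = 1"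
  shows "min 1 R \<le> \<sigma> + \<tau> * R" "\<sigma> + \<tau> * R \<le> 1 + R"
proof -
  have "min 1 R * (\<sigma> + \<tau>) \<le> \<sigma> + \<tau> * R"
    unfolding distrib_left using st R by (intro add_mono) (auto simp: mult.commute[of \<tau>] intro!: mult_right_mono mult_left_le_one_le)
  then show "min 1 R \<le> \<sigma> + \<tau> * R" using st by simp
  have "\<sigma> + \<tau> * R \<le> 1 + 1 * R" using st R by (intro add_mono mult_right_mono) auto
  then show "\<sigma> + \<tau> * R \<le> 1 + R" by simp
qed

section \<open>Segments between consecutive Lissajous curves\<close>

locale orthonormal_pair =
  fixes u v :: "'a::euclidean_space"
  assumes uv: "norm u = 1" "norm v = 1" "u \<bullet> v = 0"
begin

text \<open>By the alternation, the frequency that leaves and the one that enters between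
  \<open>lissajous k\<close> and \<open>lissajous (Suc k)\<close> oscillate in the same direction,
  while the shared frequency keeps the other direction to itself.\<close>

definition frame :: "nat \<Rightarrow> 'a" where
  "frame k = (if even k then u else v)"

text \<open>The indices start at \<open>Suc k\<close> because \<open>freq 0 = 0\<close> yields no
  wave; that value serves the recursion and the base of the cosine estimate.\<close>

definition lissajous :: "nat \<Rightarrow> 'a H2" where
  "lissajous k = sine_wave (freq (Suc k)) (frame k) + sine_wave (freq (Suc (Suc k))) (frame (Suc k))"

text \<open>Nonnegative coefficients give points of a segment, coefficients of opposite sign its
  velocity, so the same formulas cover base point and tangent vector.\<close>

definition blend :: "nat \<Rightarrow> real \<Rightarrow> real \<Rightarrow> 'a H2" where
  "blend k r s = r *\<^sub>R lissajous k + s *\<^sub>R lissajous (Suc k)"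

text \<open>The grouping is the one that the sum rule for weak derivatives produces and that
  \<open>norm_combination_le\<close> estimates.\<close>

definition blend_deriv2 :: "nat \<Rightarrow> real \<Rightarrow> real \<Rightarrow> real \<Rightarrow> 'a" where
  "blend_deriv2 k r s = (\<lambda>\<theta>::real.
    r *\<^sub>R (- (freq (Suc k) * sin (freq (Suc k) * \<theta>)) *\<^sub>R frame k
      + - (freq (Suc (Suc k)) * sin (freq (Suc (Suc k)) * \<theta>)) *\<^sub>R frame (Suc k))
    + s *\<^sub>R (- (freq (Suc (Suc k)) * sin (freq (Suc (Suc k)) * \<theta>)) *\<^sub>R frame (Suc k)
      + - (freq (Suc (Suc (Suc k))) * sin (freq (Suc (Suc (Suc k))) * \<theta>)) *\<^sub>R frame k))"

lemma frame_norm: "norm (frame i) = 1"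
  using uv by (simp add: frame_def)

lemma frame_orthogonal: "frame i \<bullet> frame (Suc i) = 0"
  using uv by (simp add: frame_def inner_commute)

lemma frame_Suc_Suc: "frame (Suc (Suc i)) = frame i"
  by (simp add: frame_def)

lemma H2_fun_blend:
  fixes \<theta> :: real
  shows "H2_fun (blend k r s) \<theta> =
    r *\<^sub>R ((sin (freq (Suc k) * \<theta>) / freq (Suc k)) *\<^sub>R frame k
      + (sin (freq (Suc (Suc k)) * \<theta>) / freq (Suc (Suc k))) *\<^sub>R frame (Suc k))
    + s *\<^sub>R ((sin (freq (Suc (Suc k)) * \<theta>) / freq (Suc (Suc k))) *\<^sub>R frame (Suc k)
      + (sin (freq (Suc (Suc (Suc k))) * \<theta>) / freq (Suc (Suc (Suc k)))) *\<^sub>R frame k)"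
  unfolding blend_def lissajous_def H2_fun_simps sine_wave(1)[OF freq_pos] frame_Suc_Suc ..

lemma blend_deriv:
  fixes \<theta> :: real
  shows "\<theta>_deriv (H2_fun (blend k r s)) \<theta> =
    (r * cos (freq (Suc k) * \<theta>) + s * cos (freq (Suc (Suc (Suc k))) * \<theta>)) *\<^sub>R frame k
    + ((r + s) * cos (freq (Suc (Suc k)) * \<theta>)) *\<^sub>R frame (Suc k)"
  unfolding blend_def lissajous_def H2_fun_deriv_plus fun_cong[OF H2_fun_deriv_plus]
    fun_cong[OF H2_fun_deriv_scaleR] fun_cong[OF sine_wave(2)[OF freq_pos]] frame_Suc_Suc
  by (simp add: algebra_simps)

lemma blend_weak_deriv: "has_weak_deriv (\<theta>_deriv (H2_fun (blend k r s))) (blend_deriv2 k r s)"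
  unfolding blend_def lissajous_def H2_fun_deriv_plus H2_fun_deriv_scaleR
    fun_cong[OF H2_fun_deriv_plus] fun_cong[OF H2_fun_deriv_scaleR] blend_deriv2_def
    frame_Suc_Suc
  by (intro has_weak_deriv_add has_weak_deriv_scaleR sine_wave(3) freq_pos)

text \<open>A blend, its derivative and its second derivative all have this shape, with
  \<open>B\<close> equal to \<open>1 / 4 ^ k\<close>, \<open>1\<close> and
  \<open>5 ^ (k + 2)\<close>.\<close>

lemma norm_combination_le:
  assumes "\<bar>a\<bar> \<le> B" "\<bar>b\<bar> \<le> B" "\<bar>c\<bar> \<le> B" "\<bar>d\<bar> \<le> B"
  shows "norm (r *\<^sub>R (a *\<^sub>R frame i + b *\<^sub>R frame j) + s *\<^sub>R (c *\<^sub>R frame j + d *\<^sub>R frame i))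
    \<le> 2 * (\<bar>r\<bar> + \<bar>s\<bar>) * B"
proof -
  have *: "norm (x *\<^sub>R (a *\<^sub>R frame i + b *\<^sub>R frame j)) \<le> \<bar>x\<bar> * (2 * B)"
    if "\<bar>a\<bar> \<le> B" "\<bar>b\<bar> \<le> B" for x a b i j
    using that norm_triangle_ineq[of "a *\<^sub>R frame i" "b *\<^sub>R frame j"]
    by (auto simp: frame_norm intro!: mult_left_mono)
  have "norm (r *\<^sub>R (a *\<^sub>R frame i + b *\<^sub>R frame j) + s *\<^sub>R (c *\<^sub>R frame j + d *\<^sub>R frame i))
      \<le> \<bar>r\<bar> * (2 * B) + \<bar>s\<bar> * (2 * B)"
    using assms by (intro order_trans[OF norm_triangle_ineq] add_mono *)
  then show ?thesis by (simp add: algebra_simps)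
qed

lemma norm_blend_le:
  fixes \<theta> :: real
  shows "norm (H2_fun (blend k r s) \<theta>) \<le> 2 * (\<bar>r\<bar> + \<bar>s\<bar>) * (1 / 4 ^ k)"
proof -
  have *: "\<bar>sin (freq (Suc i) * \<theta>) / freq (Suc i)\<bar> \<le> 1 / 4 ^ k" if "i \<ge> k" for i
    unfolding abs_divide using freq_lower_mono[OF that] by (intro frac_le) auto
  show ?thesis unfolding H2_fun_blend by (intro norm_combination_le *) auto
qed

lemma norm_blend_deriv_le:
  fixes \<theta> :: real
  shows "norm (\<theta>_deriv (H2_fun (blend k r s)) \<theta>) \<le> 2 * (\<bar>r\<bar> + \<bar>s\<bar>)"
proof -
  have "\<theta>_deriv (H2_fun (blend k r s)) \<theta> =
    r *\<^sub>R (cos (freq (Suc k) * \<theta>) *\<^sub>R frame k + cos (freq (Suc (Suc k)) * \<theta>) *\<^sub>R frame (Suc k))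
    + s *\<^sub>R (cos (freq (Suc (Suc k)) * \<theta>) *\<^sub>R frame (Suc k)
      + cos (freq (Suc (Suc (Suc k))) * \<theta>) *\<^sub>R frame k)"
    unfolding blend_deriv by (simp add: algebra_simps)
  also have "norm \<dots> \<le> 2 * (\<bar>r\<bar> + \<bar>s\<bar>) * 1"
    by (intro norm_combination_le) auto
  finally show ?thesis by simp
qed

lemma norm_blend_deriv2_le: "norm (blend_deriv2 k r s \<theta>) \<le> 2 * (\<bar>r\<bar> + \<bar>s\<bar>) * 5 ^ (k + 2)"
proof -
  have *: "\<bar>- (freq (Suc i) * sin (freq (Suc i) * \<theta>))\<bar> \<le> 5 ^ (k + 2)" if "i \<le> k + 2" for i
  proof -
    have "\<bar>- (freq (Suc i) * sin (freq (Suc i) * \<theta>))\<bar> \<le> real (freq (Suc i)) * 1"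
      unfolding abs_minus_cancel abs_mult by (intro mult_mono) auto
    then show ?thesis using freq_upper_mono[OF that] by simp
  qed
  show ?thesis unfolding blend_deriv2_def by (intro norm_combination_le *) auto
qed

lemma norm_frame_combination_ge:
  shows "\<bar>a\<bar> \<le> norm (a *\<^sub>R frame k + b *\<^sub>R frame (Suc k))"
    and "\<bar>b\<bar> \<le> norm (a *\<^sub>R frame k + b *\<^sub>R frame (Suc k))"
proof -
  let ?w = "a *\<^sub>R frame k + b *\<^sub>R frame (Suc k)"
  have "frame i \<bullet> frame i = 1" for i
    using frame_norm[of i] by (simp add: norm_eq_1)
  then have "?w \<bullet> frame k = a" "?w \<bullet> frame (Suc k) = b"
    using frame_orthogonal[of k] inner_commute[of "frame (Suc k)" "frame k"]
    by (simp_all add: inner_add_left)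
  then show "\<bar>a\<bar> \<le> norm ?w" "\<bar>b\<bar> \<le> norm ?w"
    using Cauchy_Schwarz_ineq2[of ?w "frame k"] Cauchy_Schwarz_ineq2[of ?w "frame (Suc k)"]
    by (simp_all add: frame_norm)
qed

text \<open>The shared component bounds \<open>(r + s) * \<bar>?x\<bar>\<close> by the speed. The
  other component mixes two cosines that differ by at most \<open>4 * \<bar>?x\<bar>\<close>, so
  \<open>(r + s) * \<bar>?y\<bar>\<close> is at most 5 times the speed. Adding the two gives the
  factor 6, and \<open>cos_freq_lower\<close> prevents both cosines from being small.\<close>

lemma norm_blend_deriv_ge:
  fixes \<theta> :: real
  assumes rs: "r \<ge> 0" "s \<ge> 0"
  shows "(r + s) / (6 * 5 ^ (k + 1)) \<le> norm (\<theta>_deriv (H2_fun (blend k r s)) \<theta>)"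
proof -
  let ?x = "cos (freq (Suc (Suc k)) * \<theta>)" and ?y = "cos (freq (Suc k) * \<theta>)"
    and ?z = "cos (freq (Suc (Suc (Suc k))) * \<theta>)"
  let ?N = "norm (\<theta>_deriv (H2_fun (blend k r s)) \<theta>)"
  have 1: "(r + s) * \<bar>?x\<bar> \<le> ?N"
    using norm_frame_combination_ge(2)[of "(r + s) * ?x"] rs unfolding blend_deriv
    by (simp add: abs_mult)
  have "\<bar>r * ?y + s * ?z\<bar> \<le> ?N"
    unfolding blend_deriv by (rule norm_frame_combination_ge(1))
  moreover have "\<bar>s * (?z - ?y)\<bar> \<le> (r + s) * (4 * \<bar>?x\<bar>)"
    unfolding abs_mult using cos_freq_diff[of "Suc k" \<theta>] rs by (intro mult_mono) auto
  moreover have "(r + s) * \<bar>?y\<bar> = \<bar>(r * ?y + s * ?z) - s * (?z - ?y)\<bar>"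
    using rs by (simp add: algebra_simps flip: abs_mult)
      (metis abs_mult abs_of_nonneg add_nonneg_nonneg distrib_right)
  ultimately have 2: "(r + s) * \<bar>?y\<bar> \<le> ?N + 4 * ((r + s) * \<bar>?x\<bar>)" by linarith
  have "(r + s) * (1 / 5 ^ Suc k) \<le> (r + s) * (\<bar>?y\<bar> + \<bar>?x\<bar>)"
    using rs by (intro mult_left_mono cos_freq_lower) auto
  with 1 2 have "(r + s) * (1 / 5 ^ Suc k) \<le> 6 * ?N" unfolding distrib_left by linarith
  then show ?thesis by (simp add: field_simps)
qed

lemma blend_immersion:
  assumes "r \<ge> 0" "s \<ge> 0" "r + s > 0"
  shows "blend k r s \<in> immersions"
proof -
  have "0 < norm (\<theta>_deriv (H2_fun (blend k r s)) \<theta>)" for \<theta>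
    by (rule order_less_le_trans[OF _ norm_blend_deriv_ge[OF assms(1,2), where \<theta> = \<theta>]]) (use assms(3) in simp)
  then show ?thesis by (simp add: immersions_def)
qed

text \<open>The lower bound uses the shared component alone, whose amplitude is \<open>r + s\<close>
  throughout; the upper one integrates the bound on the speed.\<close>

lemma blend_length:
  assumes rs: "r \<ge> 0" "s \<ge> 0"
  shows "pi * (r + s) \<le> curve_length (blend k r s)" "curve_length (blend k r s) \<le> 4 * pi * (r + s)"
proof -
  let ?g = "freq (Suc (Suc k))"
  have "pi * (r + s) = (\<integral>\<theta>. (r + s) * (cos (?g * \<theta>))\<^sup>2 \<partial>circle)"
    using integral_cos_sq[OF freq_pos[of "Suc k"]] by simp
  also have "\<dots> \<le> curve_length (blend k r s)"
    unfolding curve_length_def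
  proof (rule circle_integral_mono[OF _ curve_length_integrable])
    show "integrable circle (\<lambda>\<theta>. (r + s) * (cos (?g * \<theta>))\<^sup>2)"
      by (intro integrable_circle_continuous continuous_intros)
    fix \<theta> :: real
    have "\<bar>cos (?g * \<theta>)\<bar> * \<bar>cos (?g * \<theta>)\<bar> \<le> \<bar>cos (?g * \<theta>)\<bar> * 1"
      by (intro mult_left_mono) auto
    then have "(cos (?g * \<theta>))\<^sup>2 \<le> \<bar>cos (?g * \<theta>)\<bar>" by (simp add: power2_eq_square)
    then have "(r + s) * (cos (?g * \<theta>))\<^sup>2 \<le> \<bar>(r + s) * cos (?g * \<theta>)\<bar>"
      using rs by (simp add: abs_mult mult_left_mono)
    also have "\<dots> \<le> norm (\<theta>_deriv (H2_fun (blend k r s)) \<theta>)"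
      unfolding blend_deriv by (rule norm_frame_combination_ge(2))
    finally show "(r + s) * (cos (?g * \<theta>))\<^sup>2 \<le> norm (\<theta>_deriv (H2_fun (blend k r s)) \<theta>)" .
  qed
  finally show "pi * (r + s) \<le> curve_length (blend k r s)" .
  have "curve_length (blend k r s) \<le> (\<integral>\<theta>. 2 * (\<bar>r\<bar> + \<bar>s\<bar>) \<partial>circle)"
    unfolding curve_length_def
    by (intro circle_integral_mono curve_length_integrable norm_blend_deriv_le integrable_circle_continuous) simp
  then show "curve_length (blend k r s) \<le> 4 * pi * (r + s)"
    unfolding circle_integral_const using rs by (simp add: algebra_simps)
qed

lemma sobolev_metric_blend_le:
  assumes rs: "r \<ge> 0" "s \<ge> 0" "r + s > 0"
  shows "sobolev_metric p q (blend k r s) (blend k r' s') (blend k r' s') \<le>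
    4 * pi * (r + s) * (curve_length (blend k r s) powr q * (2 * (\<bar>r'\<bar> + \<bar>s'\<bar>) / 4 ^ k)\<^sup>2
      + curve_length (blend k r s) powr p * (2745000 * (\<bar>r'\<bar> + \<bar>s'\<bar>) / (r + s)\<^sup>2 * 625 ^ k)\<^sup>2)"
proof -
  define a where "a = r + s"
  define b where "b = \<bar>r'\<bar> + \<bar>s'\<bar>"
  define X where "X = (5::real) ^ k"
  define m where "m = a / (6 * 5 ^ (k + 1))"
  let ?c = "blend k r s" and ?h = "blend k r' s'"
  have a: "a > 0" and b: "b \<ge> 0" and X: "X \<ge> 1" using rs by (auto simp: a_def b_def X_def)
  have m: "m > 0" using a by (simp add: m_def)
  have mX: "m = a / (30 * X)" by (simp add: m_def X_def)
  have ab: "\<bar>r\<bar> + \<bar>s\<bar> = a" using rs by (simp add: a_def)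
  let ?D = "(2 * b * 5 ^ (k + 2) / m + 2 * a * 5 ^ (k + 2) * (2 * b) / m\<^sup>2) / m"
  \<comment> \<open>Since \<open>5 ^ (k + 2) = 25 * X\<close> and \<open>m = a / (30 * X)\<close>,
    the coefficients are \<open>2 * 25 * 30 ^ 2\<close> and \<open>4 * 25 * 30 ^ 3\<close>. Raising
    \<open>X ^ 3\<close> to \<open>X ^ 4 = 625 ^ k\<close> allows them to be added to
    2745000.\<close>
  have "?D = b / a\<^sup>2 * (45000 * X ^ 3 + 2700000 * X ^ 4)"
    unfolding mX using a X by (simp add: X_def[symmetric] field_simps power2_eq_square power3_eq_cube power4_eq_xxxx)
  also have "\<dots> \<le> b / a\<^sup>2 * (45000 * X ^ 4 + 2700000 * X ^ 4)"
    using b X by (intro mult_left_mono add_right_mono power_increasing) auto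
  also have "\<dots> = 2745000 * b / a\<^sup>2 * 625 ^ k"
    by (simp add: X_def power_mult[symmetric] power_mult_distrib mult.commute[of k])
      (simp add: power_mult)
  finally have D: "?D \<le> 2745000 * b / a\<^sup>2 * 625 ^ k" .
  have "sobolev_metric p q ?c ?h ?h \<le> 2 * pi * (2 * a) *
    (curve_length ?c powr q * (2 * b * (1 / 4 ^ k))\<^sup>2 + curve_length ?c powr p * ?D\<^sup>2)"
  proof (rule sobolev_metric_upper_bound[OF blend_immersion[OF rs] blend_weak_deriv blend_weak_deriv m])
    show "m \<le> norm (\<theta>_deriv (H2_fun ?c) \<theta>)" for \<theta>
      using norm_blend_deriv_ge[OF rs(1,2)] by (simp only: m_def a_def)
  qed (use norm_blend_deriv_le[of k r s] norm_blend_deriv2_le[of k r s] norm_blend_le[of k r' s']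
      norm_blend_deriv_le[of k r' s'] norm_blend_deriv2_le[of k r' s'] in \<open>simp_all only: ab b_def\<close>)
  also have "\<dots> \<le> 2 * pi * (2 * a) *
    (curve_length ?c powr q * (2 * b * (1 / 4 ^ k))\<^sup>2 + curve_length ?c powr p * (2745000 * b / a\<^sup>2 * 625 ^ k)\<^sup>2)"
    using a b m D by (intro mult_left_mono add_left_mono power_mono) auto
  also have "2 * pi * (2 * a) = 4 * pi * a" by simp
  also have "2 * b * (1 / 4 ^ k) = 2 * b / 4 ^ k" by simp
  finally show ?thesis unfolding a_def b_def .
qed

text \<open>Divided by \<open>R ^ k\<close>, the length lies between two positive numbers
  independent of \<open>k\<close>, \<sigma> and \<tau>.\<close>

lemma curve_length_blend_powr_le:
  assumes R: "R > 0" and st: "\<sigma> \<ge> 0" "\<tau> \<ge> 0" "\<sigma> + \<tau> = 1"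
  shows "curve_length (blend k (\<sigma> * R ^ k) (\<tau> * R ^ Suc k)) powr e
      \<le> (R powr e) ^ k * ((pi * min 1 R) powr e + (4 * pi * (1 + R)) powr e)"
proof -
  define a where "a = \<sigma> + \<tau> * R"
  have a1: "min 1 R \<le> a" and a2: "a \<le> 1 + R"
    unfolding a_def using convex_combination_bounds[OF R st] .
  have Rk: "R ^ k > 0" using R by simp
  have sum: "\<sigma> * R ^ k + \<tau> * R ^ Suc k = R ^ k * a" by (simp add: a_def algebra_simps)
  let ?l = "curve_length (blend k (\<sigma> * R ^ k) (\<tau> * R ^ Suc k))"
  have "pi * (R ^ k * a) \<le> ?l" "?l \<le> 4 * pi * (R ^ k * a)"
    using blend_length[of "\<sigma> * R ^ k" "\<tau> * R ^ Suc k" k] st R unfolding sum by auto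
  then have l: "pi * a \<le> ?l / R ^ k" "?l / R ^ k \<le> 4 * pi * a"
    using Rk by (auto simp: field_simps)
  have lo: "pi * min 1 R \<le> ?l / R ^ k"
    using a1 by (intro order_trans[OF _ l(1)] mult_left_mono) auto
  have hi: "?l / R ^ k \<le> 4 * pi * (1 + R)"
    using a2 by (intro order_trans[OF l(2)] mult_left_mono) auto
  have r0: "0 < pi * min 1 R" using R by simp
  have "(?l / R ^ k) powr e \<le> (pi * min 1 R) powr e + (4 * pi * (1 + R)) powr e"
    by (rule powr_le_sum_ends[OF r0 lo hi])
  moreover have "?l powr e = (R powr e) ^ k * (?l / R ^ k) powr e"
  proof -
    have "(R powr e) ^ k = (R ^ k) powr e"
      using R by (simp add: powr_powr powr_realpow[symmetric] mult.commute)
    moreover have "?l = R ^ k * (?l / R ^ k)" using R by simp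
    then have "?l powr e = (R ^ k * (?l / R ^ k)) powr e" by simp
    moreover have "?l / R ^ k \<ge> 0" using r0 lo by linarith
    then have "(R ^ k * (?l / R ^ k)) powr e = (R ^ k) powr e * (?l / R ^ k) powr e"
      by (intro powr_mult)
    ultimately show ?thesis by simp
  qed
  ultimately show ?thesis using R by (simp add: mult_left_mono)
qed

text \<open>
  On the \<open>k\<close>-th segment the zeroth order part of the metric is at most a multiple of $16^{-k}$
  because \<open>q = -3\<close> makes it independent of the scale; the second order part is at most a multiple of
  $625^{2k} R^{k(p-1)}$, and $6250000 = 16 \cdot 625^2$.
\<close>

lemma segment_metric_bound:
  assumes R: "R > 0" "R powr (p - 1) = 1 / 6250000"
  obtains B where "B \<ge> 0" "\<And>k \<sigma> \<tau> r s. \<sigma> \<ge> 0 \<Longrightarrow> \<tau> \<ge> 0 \<Longrightarrow> \<sigma> + \<tau> = 1 \<Longrightarrow> \<bar>r\<bar> = R ^ k \<Longrightarrow> \<bar>s\<bar> = R ^ Suc k \<Longrightarrow>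
     sobolev_metric p (-3) (blend k (\<sigma> * R ^ k) (\<tau> * R ^ Suc k)) (blend k r s) (blend k r s) \<le> (B / 4 ^ k)\<^sup>2"
proof -
  define A where "A e = (pi * min 1 R) powr e + (4 * pi * (1 + R)) powr e" for e
  define B where "B = 4 * pi * (1 + R) * (A (-3) * 4 * (1 + R)\<^sup>2 + A p * (2745000 * (1 + R) / (min 1 R)\<^sup>2)\<^sup>2)"
  have A: "A e \<ge> 0" for e by (simp add: A_def)
  have B: "B \<ge> 0" unfolding B_def using R A by (intro mult_nonneg_nonneg add_nonneg_nonneg) auto
  show ?thesis
  proof (rule that[of "sqrt B"])
    fix k :: nat and \<sigma> \<tau> r s :: real
    assume st: "\<sigma> \<ge> 0" "\<tau> \<ge> 0" "\<sigma> + \<tau> = 1" and r: "\<bar>r\<bar> = R ^ k" and s: "\<bar>s\<bar> = R ^ Suc k"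
    define a where "a = \<sigma> + \<tau> * R"
    define \<rho> where "\<rho> = R ^ k"
    have \<rho>: "\<rho> > 0" using R by (simp add: \<rho>_def)
    have a1: "min 1 R \<le> a" and a2: "a \<le> 1 + R"
      unfolding a_def using convex_combination_bounds[OF R(1) st] .
    have r0: "min 1 R > 0" using R by simp
    then have a0: "a > 0" using a1 by linarith
    have sum: "\<sigma> * R ^ k + \<tau> * R ^ Suc k = \<rho> * a" by (simp add: a_def \<rho>_def algebra_simps)
    have b: "\<bar>r\<bar> + \<bar>s\<bar> = \<rho> * (1 + R)" using r s by (simp add: \<rho>_def algebra_simps)
    let ?c = "blend k (\<sigma> * R ^ k) (\<tau> * R ^ Suc k)"
    let ?l = "curve_length ?c"
    have l: "?l powr e \<le> (R powr e) ^ k * A e" for e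
      unfolding A_def by (rule curve_length_blend_powr_le[OF R(1) st])
    have Rm3: "(R powr (-3)) ^ k = 1 / \<rho> ^ 3"
      using R(1) by (simp add: \<rho>_def powr_minus power_inverse[symmetric] divide_inverse power_mult[symmetric] mult.commute)
    have Rp: "(R powr p) ^ k = \<rho> * (1 / 6250000) ^ k"
    proof -
      have "R powr p = R powr (1 + (p - 1))" by simp
      also have "\<dots> = R * (1 / 6250000)" unfolding powr_add R(2) using R(1) by simp
      finally have *: "R powr p = R * (1 / 6250000)" .
      show ?thesis unfolding * \<rho>_def by (rule power_mult_distrib)
    qed
    \<comment> \<open>The length contributes \<open>1 / \<rho> ^ 3\<close> and the squared size
      \<rho> twice. Here, as in the second order term below, \<open>1 / \<rho>\<close> is left over;
      the factor \<open>\<rho> * a\<close> from the arc length element cancels it.\<close>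
    have 1: "?l powr (-3) * (2 * (\<rho> * (1 + R)) / 4 ^ k)\<^sup>2 \<le> 1 / \<rho> * (A (-3) * 4 * (1 + R)\<^sup>2) / 16 ^ k"
    proof -
      have "?l powr (-3) * (2 * (\<rho> * (1 + R)) / 4 ^ k)\<^sup>2 \<le> (1 / \<rho> ^ 3 * A (-3)) * (2 * (\<rho> * (1 + R)) / 4 ^ k)\<^sup>2"
        using l[of "-3"] unfolding Rm3 by (intro mult_right_mono) auto
      also have "\<dots> = 1 / \<rho> * (A (-3) * 4 * (1 + R)\<^sup>2) / (4 ^ k * 4 ^ k)"
        using \<rho> by (simp add: field_simps power2_eq_square power3_eq_cube)
      also have "(4::real) ^ k * 4 ^ k = 16 ^ k" by (simp add: power_mult_distrib[symmetric])
      finally show ?thesis .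
    qed
    have 2: "?l powr p * (2745000 * (\<rho> * (1 + R)) / (\<rho> * a)\<^sup>2 * 625 ^ k)\<^sup>2
        \<le> 1 / \<rho> * (A p * (2745000 * (1 + R) / (min 1 R)\<^sup>2)\<^sup>2) / 16 ^ k"
    proof -
      have "2745000 * (\<rho> * (1 + R)) / (\<rho> * a)\<^sup>2 * 625 ^ k = 2745000 * (1 + R) / a\<^sup>2 * (625 ^ k / \<rho>)"
        using \<rho> a0 by (simp add: field_simps power2_eq_square)
      also have "\<dots> \<le> 2745000 * (1 + R) / (min 1 R)\<^sup>2 * (625 ^ k / \<rho>)"
        using R(1) \<rho> r0 a1 a0 by (intro mult_right_mono divide_left_mono power_mono mult_pos_pos) auto
      finally have "(2745000 * (\<rho> * (1 + R)) / (\<rho> * a)\<^sup>2 * 625 ^ k)\<^sup>2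
          \<le> (2745000 * (1 + R) / (min 1 R)\<^sup>2 * (625 ^ k / \<rho>))\<^sup>2"
        using R(1) \<rho> a0 by (intro power_mono) auto
      then have "?l powr p * (2745000 * (\<rho> * (1 + R)) / (\<rho> * a)\<^sup>2 * 625 ^ k)\<^sup>2
          \<le> (\<rho> * (1 / 6250000) ^ k * A p) * (2745000 * (1 + R) / (min 1 R)\<^sup>2 * (625 ^ k / \<rho>))\<^sup>2"
        using l[of p] \<rho> A unfolding Rp by (intro mult_mono) auto
      also have "\<dots> = 1 / \<rho> * (A p * (2745000 * (1 + R) / (min 1 R)\<^sup>2)\<^sup>2) * ((1 / 6250000) ^ k * (625 ^ k * 625 ^ k))"
      proof -
        have "(\<rho> * y * z) * (K * (w / \<rho>))\<^sup>2 = 1 / \<rho> * (z * K\<^sup>2) * (y * (w * w))" for y z K w :: real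
          using \<rho> by (simp add: field_simps power2_eq_square)
        then show ?thesis .
      qed
      also have "(1 / 6250000) ^ k * (625 ^ k * 625 ^ k) = 1 / (16::real) ^ k"
        by (simp add: power_mult_distrib[symmetric] power_one_over[symmetric] del: power_one_over)
      finally show ?thesis by simp
    qed
    have "sobolev_metric p (-3) ?c (blend k r s) (blend k r s) \<le> 4 * pi * (\<rho> * a) *
        (?l powr (-3) * (2 * (\<rho> * (1 + R)) / 4 ^ k)\<^sup>2
        + ?l powr p * (2745000 * (\<rho> * (1 + R)) / (\<rho> * a)\<^sup>2 * 625 ^ k)\<^sup>2)"
      using sobolev_metric_blend_le[of "\<sigma> * R ^ k" "\<tau> * R ^ Suc k" p "-3" k r s] st R(1) a0 \<rho>
      unfolding sum b by simp
    also have "\<dots> \<le> 4 * pi * (\<rho> * (1 + R)) * (1 / \<rho> * (A (-3) * 4 * (1 + R)\<^sup>2) / 16 ^ k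
        + 1 / \<rho> * (A p * (2745000 * (1 + R) / (min 1 R)\<^sup>2)\<^sup>2) / 16 ^ k)"
      using 1 2 \<rho> a2 R(1) by (intro mult_mono add_mono mult_left_mono) auto
    also have "\<dots> = B / 16 ^ k"
      using \<rho> by (simp add: B_def field_simps)
    also have "\<dots> = (sqrt B / 4 ^ k)\<^sup>2"
      using B by (simp add: power_divide power2_eq_square power_mult_distrib[symmetric])
    finally show "sobolev_metric p (-3) ?c (blend k r s) (blend k r s) \<le> (sqrt B / 4 ^ k)\<^sup>2" .
  qed (use B in simp)
qed

end

section \<open>Incompleteness\<close>

text \<open>The step costs form a geometric series. Both directions are carried along because the
  Cauchy condition compares indices in either order.\<close>

lemma geodesic_dist_Cauchy:
  assumes x: "\<And>k. x k \<in> immersions" and B: "B \<ge> 0"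
    and fwd: "\<And>k. joined_within p q (x k) (x (Suc k)) (ennreal (B / 4 ^ k))"
    and bwd: "\<And>k. joined_within p q (x (Suc k)) (x k) (ennreal (B / 4 ^ k))"
    and e: "\<epsilon> > (0::ennreal)"
  shows "\<exists>N. \<forall>m\<ge>N. \<forall>n\<ge>N. geodesic_dist p q (x m) (x n) < \<epsilon>"
proof -
  \<comment> \<open>The bound is in telescoping form: passing from \<open>j\<close> to
    \<open>Suc j\<close> enlarges it by \<open>3 / 2 * B / 4 ^ (m + j)\<close>, at least the cost of
    the new segment.\<close>
  have step: "ennreal (2 * B * (1 / 4 ^ m - 1 / 4 ^ (m + j))) + ennreal (B / 4 ^ (m + j))
      \<le> ennreal (2 * B * (1 / 4 ^ m - 1 / 4 ^ (m + Suc j)))" for m j :: nat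
  proof -
    have "1 / 4 ^ (m + j) \<le> (1 / 4 ^ m :: real)" by (simp add: frac_le power_add)
    then have "ennreal (2 * B * (1 / 4 ^ m - 1 / 4 ^ (m + j))) + ennreal (B / 4 ^ (m + j))
        = ennreal (2 * B * (1 / 4 ^ m - 1 / 4 ^ (m + j)) + B / 4 ^ (m + j))"
      using B by (intro ennreal_plus[symmetric]) auto
    also have "\<dots> \<le> ennreal (2 * B * (1 / 4 ^ m - 1 / 4 ^ (m + Suc j)))"
      using B by (intro ennreal_leI) (simp add: field_simps power_add)
    finally show ?thesis .
  qed
  have "joined_within p q (x m) (x (m + j)) (ennreal (2 * B * (1 / 4 ^ m - 1 / 4 ^ (m + j)))) \<and>
      joined_within p q (x (m + j)) (x m) (ennreal (2 * B * (1 / 4 ^ m - 1 / 4 ^ (m + j))))" for m j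
  proof (induction j)
    case 0
    then show ?case using joined_within_refl[OF x] by simp
  next
    case (Suc j)
    have "joined_within p q (x m) (x (Suc (m + j)))
        (ennreal (2 * B * (1 / 4 ^ m - 1 / 4 ^ (m + j))) + ennreal (B / 4 ^ (m + j)))"
      using Suc fwd by (blast intro: joined_within_trans)
    moreover have "joined_within p q (x (Suc (m + j))) (x m)
        (ennreal (B / 4 ^ (m + j)) + ennreal (2 * B * (1 / 4 ^ m - 1 / 4 ^ (m + j))))"
      using Suc bwd by (blast intro: joined_within_trans)
    ultimately show ?case
      using step[of m j] by (auto intro: joined_within_mono simp: add.commute[of "ennreal (B / 4 ^ (m + j))"])
  qed
  then have *: "geodesic_dist p q (x m) (x (m + j)) \<le> ennreal (2 * B / 4 ^ m) \<and>
      geodesic_dist p q (x (m + j)) (x m) \<le> ennreal (2 * B / 4 ^ m)" for m j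
  proof -
    have "2 * B * (1 / 4 ^ m - 1 / 4 ^ (m + j)) \<le> 2 * B / 4 ^ m"
      using B by (simp add: right_diff_distrib)
    then have "ennreal (2 * B * (1 / 4 ^ m - 1 / 4 ^ (m + j))) \<le> ennreal (2 * B / 4 ^ m)"
      by (rule ennreal_leI)
    then show ?thesis
      using \<open>\<And>m j. joined_within p q (x m) (x (m + j)) _ \<and> _\<close>[of m j]
      by (blast intro: order_trans geodesic_dist_le_if_joined_within)
  qed
  have "(\<lambda>N. 2 * B / 4 ^ N) \<longlonglongrightarrow> 0"
    by (intro LIMSEQ_divide_realpow_zero) simp
  then have "(\<lambda>N. ennreal (2 * B / 4 ^ N)) \<longlonglongrightarrow> ennreal 0" by (rule tendsto_ennrealI)
  then have "\<forall>\<^sub>F N in sequentially. ennreal (2 * B / 4 ^ N) < \<epsilon>"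
    using e by (intro order_tendstoD) auto
  then obtain N where N: "ennreal (2 * B / 4 ^ n) < \<epsilon>" if "n \<ge> N" for n
    by (auto simp: eventually_sequentially)
  have "geodesic_dist p q (x m) (x n) < \<epsilon>" if "m \<ge> N" "n \<ge> N" for m n
  proof (cases "m \<le> n")
    case True
    then show ?thesis using *[of m "n - m"] N[OF that(1)] by (auto intro: le_less_trans)
  next
    case False
    then show ?thesis using *[of n "m - n"] N[OF that(2)] by (auto intro: le_less_trans)
  qed
  then show ?thesis by blast
qed

lemma (in orthonormal_pair) not_metrically_complete:
  assumes p: "p \<noteq> 1"
  shows "\<not> metrically_complete (immersions :: 'a H2 set) (geodesic_dist p (-3))"
proof
  assume complete: "metrically_complete (immersions :: 'a H2 set) (geodesic_dist p (-3))"
  define e where "e = (p - 1) / 2"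
  \<comment> \<open>The exponent gives \<open>R powr e = 1 / 2500\<close>, hence
    \<open>R powr (p - 1) = 1 / 2500\<^sup>2 = 1 / 6250000\<close>. Here \<open>R < 1\<close> for
    \<open>p > 1\<close> and \<open>R > 1\<close> for \<open>p < 1\<close>.\<close>
  define R where "R = (1 / 2500 :: real) powr (1 / e)"
  have e: "e \<noteq> 0" using p by (simp add: e_def)
  have R: "R > 0" by (simp add: R_def)
  have Re: "R powr e = 1 / 2500" using e by (simp add: R_def powr_powr)
  have "R powr (p - 1) = R powr (e + e)" by (simp add: e_def)
  also have "\<dots> = 1 / 6250000" unfolding powr_add Re by simp
  finally obtain B where B: "B \<ge> 0"
    "\<And>k \<sigma> \<tau> r s. \<sigma> \<ge> 0 \<Longrightarrow> \<tau> \<ge> 0 \<Longrightarrow> \<sigma> + \<tau> = 1 \<Longrightarrow> \<bar>r\<bar> = R ^ k \<Longrightarrow> \<bar>s\<bar> = R ^ Suc k \<Longrightarrow>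
     sobolev_metric p (-3) (blend k (\<sigma> * R ^ k) (\<tau> * R ^ Suc k)) (blend k r s) (blend k r s) \<le> (B / 4 ^ k)\<^sup>2"
    using segment_metric_bound[OF R] by metis
  define x where "x k = R ^ k *\<^sub>R lissajous k" for k
  have x_blend: "x k = blend k (1 * R ^ k) (0 * R ^ Suc k)" for k by (simp add: x_def blend_def)
  have x: "x k \<in> immersions" for k
    unfolding x_blend using R by (intro blend_immersion) auto
  have im: "blend k (\<sigma> * R ^ k) (\<tau> * R ^ Suc k) \<in> immersions" if "\<sigma> \<ge> 0" "\<tau> \<ge> 0" "\<sigma> + \<tau> = 1" for k \<sigma> \<tau>
  proof (rule blend_immersion)
    have "\<sigma> > 0 \<or> \<tau> > 0" using that by linarith
    then show "\<sigma> * R ^ k + \<tau> * R ^ Suc k > 0"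
      using that R by (auto intro: add_pos_nonneg add_nonneg_pos)
  qed (use that R in auto)
  have fwd: "joined_within p (-3) (x k) (x (Suc k)) (ennreal (B / 4 ^ k))" for k
  proof (rule joined_within_linepath)
    fix t :: real assume t: "t \<in> {0..1}"
    have 1: "linepath (x k) (x (Suc k)) t = blend k ((1 - t) * R ^ k) (t * R ^ Suc k)"
      by (simp add: linepath_def x_def blend_def)
    have 2: "x (Suc k) - x k = blend k (- (R ^ k)) (R ^ Suc k)"
      by (simp add: x_def blend_def)
    show "linepath (x k) (x (Suc k)) t \<in> immersions \<and>
        sobolev_metric p (-3) (linepath (x k) (x (Suc k)) t) (x (Suc k) - x k) (x (Suc k) - x k) \<le> (B / 4 ^ k)\<^sup>2"
      unfolding 1 2 using t R by (intro conjI im B(2)) auto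
  qed (use B in simp)
  have bwd: "joined_within p (-3) (x (Suc k)) (x k) (ennreal (B / 4 ^ k))" for k
  proof (rule joined_within_linepath)
    fix t :: real assume t: "t \<in> {0..1}"
    have 1: "linepath (x (Suc k)) (x k) t = blend k (t * R ^ k) ((1 - t) * R ^ Suc k)"
      by (simp add: linepath_def x_def blend_def)
    have 2: "x k - x (Suc k) = blend k (R ^ k) (- (R ^ Suc k))"
      by (simp add: x_def blend_def)
    show "linepath (x (Suc k)) (x k) t \<in> immersions \<and>
        sobolev_metric p (-3) (linepath (x (Suc k)) (x k) t) (x k - x (Suc k)) (x k - x (Suc k)) \<le> (B / 4 ^ k)\<^sup>2"
      unfolding 1 2 using t R by (intro conjI im B(2)) auto
  qed (use B in simp)
  have "range x \<subseteq> immersions" using x by blast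
  then obtain l where l: "l \<in> immersions" "(\<lambda>n. geodesic_dist p (-3) (x n) l) \<longlonglongrightarrow> 0"
    using complete geodesic_dist_Cauchy[OF x B(1) fwd bwd]
    unfolding metrically_complete_def by blast
  define F where "F c = curve_length c powr e" for c :: "'a H2"
  \<comment> \<open>The Lipschitz bound forces \<open>F (x n)\<close> to converge to
    \<open>F l\<close>, while it tends to zero like \<open>(1 / 2500) ^ n\<close>. So
    \<open>F l = 0\<close>, against the positive length of \<open>l\<close>.\<close>
  have "ennreal (2 / \<bar>p - 1\<bar> * \<bar>F l - F (x n)\<bar>) \<le> geodesic_dist p (-3) (x n) l" for n
    unfolding F_def e_def by (rule length_powr_le_geodesic_dist[OF p])
  then have "(\<lambda>n. ennreal (2 / \<bar>p - 1\<bar> * \<bar>F l - F (x n)\<bar>)) \<longlonglongrightarrow> 0"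
    by (intro tendsto_sandwich[OF _ _ tendsto_const l(2)] always_eventually allI) simp_all
  then have "(\<lambda>n. ennreal (2 / \<bar>p - 1\<bar> * \<bar>F l - F (x n)\<bar>)) \<longlonglongrightarrow> ennreal 0" by simp
  then have "(\<lambda>n. 2 / \<bar>p - 1\<bar> * \<bar>F l - F (x n)\<bar>) \<longlonglongrightarrow> 0"
    by (rule tendsto_ennrealD) auto
  moreover have Fx: "(\<lambda>n. F (x n)) \<longlonglongrightarrow> 0"
  proof (rule tendsto_sandwich[OF _ _ tendsto_const])
    let ?A = "(pi * min 1 R) powr e + (4 * pi * (1 + R)) powr e"
    show "\<forall>\<^sub>F n in sequentially. F (x n) \<le> (1 / 2500) ^ n * ?A"
      using curve_length_blend_powr_le[OF R, of 1 0 _ e] unfolding Re x_blend[symmetric]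
      by (auto simp: F_def)
    show "(\<lambda>n. (1 / 2500) ^ n * ?A) \<longlonglongrightarrow> 0"
      by (intro tendsto_mult_left_zero LIMSEQ_power_zero) simp
  qed (simp add: F_def)
  have "(\<lambda>n. 2 / \<bar>p - 1\<bar> * \<bar>F l - F (x n)\<bar>) \<longlonglongrightarrow> 2 / \<bar>p - 1\<bar> * \<bar>F l - 0\<bar>"
    using Fx by (intro tendsto_intros)
  ultimately have "2 / \<bar>p - 1\<bar> * \<bar>F l - 0\<bar> = 0" by (metis LIMSEQ_unique)
  then show False using p curve_length_pos[OF l(1)] by (simp add: F_def)
qed

text \<open>Two distinct indices supply the orthonormal pair. In dimension one
  \<open>immersions\<close> is empty and would be complete vacuously, whence the lower bound on the
  dimension.\<close>

theorem proposition5p1: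
  fixes p q :: real
  assumes "CARD('d::finite) \<ge> 2"
  shows "(q = -3 \<and> p < 1 \<longrightarrow>
           \<not> metrically_complete (immersions :: (real ^ 'd) H2 set) (geodesic_dist p q)) \<and>
         (q = -3 \<and> p > 1 \<longrightarrow>
           \<not> metrically_complete (immersions :: (real ^ 'd) H2 set) (geodesic_dist p q))"
proof -
  obtain i j :: 'd where "i \<noteq> j"
    using assms card_2_iff' by (metis UNIV_I card_le_Suc0_iff_eq finite not_less_eq_eq numeral_2_eq_2)
  then interpret orthonormal_pair "axis i 1 :: real ^ 'd" "axis j 1"
    by unfold_locales (simp_all add: inner_axis_axis)
  show ?thesis using not_metrically_complete[of p] by auto
qed

end
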